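(* The covering number of the symmetric group $S_{12}$ is $761$, i.e. $\sigma(S_{12})=761$.
   Context: For a group $G$, a cover of $G$ is a finite collection $\{A_1,\dots,A_n\}$ of proper subgroups of $G$ with $G=\bigcup_{i=1}^n A_i$. The covering number $\sigma(G)$ is the smallest number of members in a cover of $G$. $S_n$ denotes the symmetric group of degree $n$. *)

theory Defs
  imports "HOL-Algebra.Sym_Groups" "HOL-Library.Extended_Nat"
begin

definition group_cover :: "('a, 'b) monoid_scheme \<Rightarrow> 'a set set \<Rightarrow> bool" where
  "group_cover G \<A> \<longleftrightarrow>
     finite \<A> \<and> (\<forall>A\<in>\<A>. subgroup A G \<and> A \<noteq> carrier G) \<and> carrier G = \<Union>\<A>"

(* The infimum in enat is attained as soon as some cover exists. A group without covers
   (for instance a cyclic group) gets the value infinity. *)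
definition covering_number :: "('a, 'b) monoid_scheme \<Rightarrow> enat" where
  "covering_number G = (INF \<A>\<in>{\<A>. group_cover G \<A>}. enat (card \<A>))"

end

theory Submission
  imports Defs
begin

text \<open>
  Upper bound: an odd permutation of 12 points has an odd number of cycles, so either it fixes a
  set of size 1, 2 or 3, or all its cycles are even and it swaps two sets of size 6. Together with
  the alternating group this gives a cover with 1 + 12 + 66 + 220 + 462 members.

  Lower bound: take permutations with cycle types (5,7), (1,4,7), (2,5,5), (3,4,5), (12); each
  lies in exactly one member of this cover, in the respective five families. Give the five
  conjugacy classes the total weights 1, 12, 66, 220, 462, spread evenly over each class. The point
  is that every proper subgroup has weight at most 1. For intransitive groups and for the
  stabilizers of two blocks of size 6 this is a count of invariant sets; other imprimitive groups
  are small. A primitive group containing a 3-cycle contains the alternating group. A primitive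
  group without 3-cycles has no two elements whose supports meet in one point, as their commutator
  would be a 3-cycle; hence it has a base of at most 6 points, which suffices unless it
  contains a 12-cycle. In that case the translates under the 12-cycle rule out supports of size at
  most 5, commutators then produce a base of 5 points, and the group is small enough.\<close>

text \<open>The lower bound is linear programming duality: if every proper subgroup has weight at
  most 1, a cover has at least as many members as the total weight. Each coefficient makes this
  constraint an equality for the members of its own family, so no estimate may lose anything on
  those. The remaining obstacle is the primitive groups, treated without their classification. After
  scaling by 12!, a 12-cycle contributes up to 462 * 12 = 5544, an element of type (1,4,7) or (5,7)
  at most 12 * 28 = 336. A base of 6 points bounds the order by 12*11*10*9*8*7 = 665280. This is
  good enough with the factor 336, but far too weak with 5544. Even the bound 12*11*10*9*8 = 95040
  from a base of 5 points exceeds 12!/5544 = 86400. Hence the search for a smaller base when there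
  is a 12-cycle, and the separate count of the 12-cycles, which brings 95040 down to 79200.\<close>

section \<open>Counting by successive choices\<close>

text \<open>This is the order bound of a stabilizer chain, stated for an arbitrary set
  \<open>X\<close> of functions so that it also counts the 12-cycles of a group. The candidates
  \<open>T\<close> may depend on the earlier values; only their number is bounded. The induction
  runs over the fibres of the first value.\<close>

lemma card_le_prod_choices:
  fixes l :: "nat \<Rightarrow> 'a" and X :: "('a \<Rightarrow> 'b) set" and c :: "nat \<Rightarrow> nat"
  assumes "finite X"
    and "\<And>f h. f \<in> X \<Longrightarrow> h \<in> X \<Longrightarrow> (\<And>i. i < n \<Longrightarrow> f (l i) = h (l i)) \<Longrightarrow> f = h"
    and "\<And>f i. f \<in> X \<Longrightarrow> i < n \<Longrightarrow>
      \<exists>T. finite T \<and> card T \<le> c i \<and> (\<forall>h\<in>X. (\<forall>j<i. h (l j) = f (l j)) \<longrightarrow> h (l i) \<in> T)"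
  shows "card X \<le> (\<Prod>i<n. c i)"
  using assms
proof (induction n arbitrary: X l c)
  case 0
  have "f = h" if "f \<in> X" "h \<in> X" for f h
    by (rule 0(2)[OF that]) simp
  then show ?case
    unfolding lessThan_0 prod.empty One_nat_def card_le_Suc0_iff_eq[OF 0(1)] by (intro ballI)
next
  case (Suc n)
  show ?case
  proof (cases "X = {}")
    case False
    then obtain f0 where "f0 \<in> X" by blast
    define V where "V = (\<lambda>h. h (l 0)) ` X"
    have "finite V" using Suc.prems(1) by (simp add: V_def)
    have "card V \<le> c 0"
    proof -
      obtain T where "finite T" "card T \<le> c 0" "\<forall>h\<in>X. h (l 0) \<in> T"
        using Suc.prems(3)[OF \<open>f0 \<in> X\<close>, of 0] by auto
      moreover have "V \<subseteq> T" using calculation(3) by (auto simp: V_def)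
      ultimately show ?thesis
        using card_mono[of T V] by linarith
    qed
    have X: "X = (\<Union>v\<in>V. {h\<in>X. h (l 0) = v})" by (auto simp: V_def)
    have "card {h\<in>X. h (l 0) = v} \<le> (\<Prod>i<n. c (Suc i))" for v
    proof (rule Suc.IH[of _ "\<lambda>i. l (Suc i)" "\<lambda>i. c (Suc i)"])
      show "finite {h \<in> X. h (l 0) = v}" using Suc.prems(1) by simp
    next
      fix f h assume *: "f \<in> {h \<in> X. h (l 0) = v}" "h \<in> {h \<in> X. h (l 0) = v}"
        "\<And>i. i < n \<Longrightarrow> f (l (Suc i)) = h (l (Suc i))"
      then have "f (l i) = h (l i)" if "i < Suc n" for i
        using that by (cases i) auto
      with * show "f = h" using Suc.prems(2) by blast
    next
      fix f i assume *: "f \<in> {h \<in> X. h (l 0) = v}" "i < n"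
      then obtain T where T: "finite T" "card T \<le> c (Suc i)"
        "\<forall>h\<in>X. (\<forall>j<Suc i. h (l j) = f (l j)) \<longrightarrow> h (l (Suc i)) \<in> T"
        using Suc.prems(3)[of f "Suc i"] by auto
      moreover have "\<forall>j<Suc i. h (l j) = f (l j)"
        if "h (l 0) = v" "\<forall>j<i. h (l (Suc j)) = f (l (Suc j))" for h
        using that * by (auto simp: less_Suc_eq_0_disj)
      ultimately show "\<exists>T. finite T \<and> card T \<le> c (Suc i) \<and>
          (\<forall>h\<in>{h \<in> X. h (l 0) = v}. (\<forall>j<i. h (l (Suc j)) = f (l (Suc j))) \<longrightarrow> h (l (Suc i)) \<in> T)"
        by (intro exI[of _ T]) auto
    qed
    then have "card X \<le> (\<Sum>v\<in>V. \<Prod>i<n. c (Suc i))"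
      by (subst X, intro order_trans[OF card_UN_le[OF \<open>finite V\<close>]] sum_mono)
    also have "\<dots> \<le> c 0 * (\<Prod>i<n. c (Suc i))"
      using \<open>card V \<le> c 0\<close> by simp
    finally show ?thesis by (simp only: prod.lessThan_Suc_shift)
  qed simp
qed

section \<open>Orbits of a permutation\<close>

definition orb :: "('a \<Rightarrow> 'a) \<Rightarrow> 'a \<Rightarrow> 'a set" where
  "orb p x = range (\<lambda>k. (p ^^ k) x)"

lemma orb_self: "x \<in> orb p x"
  unfolding orb_def by (metis funpow_0 rangeI)

lemma funpow_in_orb: "(p ^^ k) x \<in> orb p x"
  unfolding orb_def by blast

context
  fixes p :: "'a \<Rightarrow> 'a" and S :: "'a set"
  assumes p: "p permutes S" and fin: "finite S"
begin

lemma funpow_eq_iff_least_power: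
  "(p ^^ n) x = x \<longleftrightarrow> least_power p x dvd n"
proof -
  have "permutation p" using p fin permutation_permutes by blast
  then show ?thesis
    by (rule least_power_dvd[symmetric])
qed

lemma least_power_pos: "least_power p x > 0"
proof -
  have "permutation p" using p fin permutation_permutes by blast
  then show ?thesis by (rule least_power_of_permutation(2))
qed

lemma funpow_eq_iff_mod:
  "(p ^^ i) x = (p ^^ j) x \<longleftrightarrow> i mod least_power p x = j mod least_power p x"
proof -
  have *: "(p ^^ i) x = (p ^^ j) x \<longleftrightarrow> i mod least_power p x = j mod least_power p x" if "i \<le> j" for i j
  proof -
    have "(p ^^ j) x = (p ^^ i) ((p ^^ (j - i)) x)"
      using that by (metis comp_apply funpow_add le_add_diff_inverse)
    moreover have "inj (p ^^ i)"
      using p permutes_funpow permutes_inj by blast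
    ultimately have "(p ^^ i) x = (p ^^ j) x \<longleftrightarrow> (p ^^ (j - i)) x = x"
      by (metis inj_eq)
    also have "\<dots> \<longleftrightarrow> least_power p x dvd j - i"
      by (rule funpow_eq_iff_least_power)
    also have "\<dots> \<longleftrightarrow> j mod least_power p x = i mod least_power p x"
      using mod_eq_dvd_iff_nat[OF that] by simp
    finally show ?thesis by (rule trans) (rule eq_commute)
  qed
  show ?thesis using *[of i j] *[of j i] by (metis linear)
qed

lemma orb_eq_image: "orb p x = (\<lambda>k. (p ^^ k) x) ` {..<least_power p x}"
proof -
  have "(p ^^ k) x = (p ^^ (k mod least_power p x)) x" for k
    unfolding funpow_eq_iff_mod by (rule mod_mod_trivial[symmetric])
  then have "(p ^^ k) x \<in> (\<lambda>k. (p ^^ k) x) ` {..<least_power p x}" for k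
    using least_power_pos[of x] by (metis image_eqI lessThan_iff mod_less_divisor)
  then show ?thesis unfolding orb_def by blast
qed

lemma card_orb: "card (orb p x) = least_power p x"
proof -
  have "inj_on (\<lambda>k. (p ^^ k) x) {..<least_power p x}"
    by (rule inj_onI) (simp only: funpow_eq_iff_mod lessThan_iff mod_less)
  then show ?thesis unfolding orb_eq_image by (simp add: card_image)
qed

lemma orb_subset:
  assumes "p ` A \<subseteq> A" "x \<in> A" shows "orb p x \<subseteq> A"
proof -
  have "(p ^^ k) x \<in> A" for k
  proof (induction k)
    case (Suc k)
    then have "p ((p ^^ k) x) \<in> A" using assms(1) by blast
    then show ?case by simp
  qed (use assms(2) in simp)
  then show ?thesis unfolding orb_def by (rule image_subsetI)
qed

lemma orb_image: "p ` orb p x = orb p x"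
proof (rule card_subset_eq)
  show "finite (orb p x)" unfolding orb_eq_image by simp
  show "p ` orb p x \<subseteq> orb p x"
  proof -
    have "p ((p ^^ k) x) = (p ^^ Suc k) x" for k by simp
    then have "p ((p ^^ k) x) \<in> orb p x" for k
      using funpow_in_orb by metis
    then show ?thesis unfolding orb_def image_image by (rule image_subsetI)
  qed
  show "card (p ` orb p x) = card (orb p x)"
    by (rule card_image) (meson inj_on_subset p permutes_inj subset_UNIV)
qed

lemma orb_eq:
  assumes "y \<in> orb p x" shows "orb p y = orb p x"
proof
  show "orb p y \<subseteq> orb p x"
    using assms orb_image by (intro orb_subset) auto
  obtain i where y: "y = (p ^^ i) x" using assms unfolding orb_def by blast
  \<comment> \<open>\<open>n + i\<close> is a multiple of the period, and the subtraction is exact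
    because the period is positive. So \<open>p ^^ n\<close> leads from \<open>y\<close> back to
    \<open>x\<close>.\<close>
  define n where "n = least_power p x * i - i"
  have n: "n + i = least_power p x * i"
    using least_power_pos[of x] by (simp add: n_def)
  have "(p ^^ n) y = (p ^^ (n + i)) x"
    by (simp only: y funpow_add comp_apply)
  also have "\<dots> = x"
    unfolding n funpow_eq_iff_least_power by simp
  finally have "x \<in> orb p y" using funpow_in_orb[where p=p and k=n and x=y] by simp
  then show "orb p x \<subseteq> orb p y"
    using orb_image by (intro orb_subset) auto
qed

lemma orb_disjoint: "orb p x = orb p y \<or> orb p x \<inter> orb p y = {}"
  using orb_eq by blast

end

section \<open>Commutators and three-cycles\<close>

definition moved :: "('a \<Rightarrow> 'a) \<Rightarrow> 'a set" where
  "moved p = {x. p x \<noteq> x}"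

definition rot3 :: "'a \<Rightarrow> 'a \<Rightarrow> 'a \<Rightarrow> 'a \<Rightarrow> 'a" where
  "rot3 a b c = transpose a b \<circ> transpose b c"

lemma rot3_apply:
  "a \<noteq> b \<Longrightarrow> a \<noteq> c \<Longrightarrow> b \<noteq> c \<Longrightarrow>
   rot3 a b c x = (if x = a then b else if x = b then c else if x = c then a else x)"
  by (auto simp: rot3_def transpose_def)

text \<open>Away from \<open>x\<close> every point is fixed by \<open>u\<close> or by
  \<open>v\<close>, so the two can fail to commute only near \<open>x\<close>. With
  \<open>y = v z\<close> and \<open>z = u t\<close> the commutator maps \<open>y\<close> to
  \<open>u (v t)\<close>; the exceptional cases \<open>t = x\<close>, \<open>z = x\<close>,
  \<open>y = x\<close> give the points \<open>u x\<close>, \<open>v x\<close>, \<open>x\<close> of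
  the 3-cycle.\<close>

lemma commutator_eq_rot3:
  assumes "bij u" "bij v" and x: "moved u \<inter> moved v = {x}"
  shows "u \<circ> v \<circ> inv' u \<circ> inv' v = rot3 x (u x) (v x)" and "distinct [x, u x, v x]"
proof -
  have inj: "u y = u z \<longleftrightarrow> y = z" "v y = v z \<longleftrightarrow> y = z" for y z
    using assms(1,2) by (simp_all add: bij_def inj_eq)
  have inv: "inv' u y = z \<longleftrightarrow> y = u z" "inv' v y = z \<longleftrightarrow> y = v z" for y z
    using assms(1,2) by (metis bij_inv_eq_iff)+
  have disj: "u y = y \<or> v y = y" if "y \<noteq> x" for y
    using x that unfolding moved_def by blast+
  have ux: "u x \<noteq> x" and vx: "v x \<noteq> x"
    using x unfolding moved_def by blast+
  have vux: "v (u x) = u x" and uvx: "u (v x) = v x"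
    using disj[OF ux] disj[OF vx] inj ux vx by auto
  have "u x \<noteq> v x" using vux inj ux by metis
  then show d: "distinct [x, u x, v x]" using ux vx by auto
  show "u \<circ> v \<circ> inv' u \<circ> inv' v = rot3 x (u x) (v x)"
  proof
    fix y
    obtain z where y: "y = v z" using assms(2) by (metis bij_pointE)
    obtain t where z: "z = u t" using assms(1) by (metis bij_pointE)
    have "inv' v y = z" "inv' u z = t" using y z inv by auto
    then have *: "(u \<circ> v \<circ> inv' u \<circ> inv' v) y = u (v t)" by simp
    show "(u \<circ> v \<circ> inv' u \<circ> inv' v) y = rot3 x (u x) (v x) y"
    proof (cases "t = x")
      case True
      then have "y = u x" using y z vux by simp
      then show ?thesis using * True uvx d ux by (simp add: rot3_apply)
    next
      case False
      note t = False
      show ?thesis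
      proof (cases "z = x")
        case True
        then have "u t \<noteq> t" using z t by simp
        then have "v t = t" using disj[OF t] by blast
        then show ?thesis using * True d y z vx \<open>u x \<noteq> v x\<close>[symmetric] by (simp add: rot3_apply)
      next
        case False
        show ?thesis
        proof (cases "y = x")
          case True
          then have "v z \<noteq> z" using y False by simp
          then have "u z = z" using disj[OF False] by blast
          then have "t = z" using z inj by metis
          then show ?thesis using * d True y by (simp add: rot3_apply)
        next
          case y': False
          have "y \<noteq> u x" using y z vux t inj by metis
          moreover have "y \<noteq> v x" using y False inj by metis
          moreover have "u (v t) = y"
          proof (cases "u t = t")
            case True
            then have "v t = y" using y z by simp
            moreover have "u y = y"
              using disj[OF y'] \<open>v t = y\<close> disj[OF t] inj y True y' z by metis
            ultimately show ?thesis by simp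
          next
            case False
            then have "v t = t" using disj[OF t] by blast
            moreover have "u z \<noteq> z" using False z inj by metis
            then have "v z = z" using disj[OF \<open>z \<noteq> x\<close>] by blast
            ultimately show ?thesis using y z by simp
          qed
          ultimately show ?thesis using * y' d by (simp add: rot3_apply)
        qed
      qed
    qed
  qed
qed

lemma transpose_conj:
  assumes "bij h" shows "h \<circ> transpose a b \<circ> inv' h = transpose (h a) (h b)"
proof
  fix y
  obtain x where y: "y = h x" using assms by (metis bij_pointE)
  then have "inv' h y = x" using assms by (simp add: bij_is_inj)
  then show "(h \<circ> transpose a b \<circ> inv' h) y = transpose (h a) (h b) y"
    unfolding y using assms by (auto simp: transpose_def bij_def inj_eq)
qed

lemma rot3_conj:
  assumes "bij h" shows "h \<circ> rot3 a b c \<circ> inv' h = rot3 (h a) (h b) (h c)"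
proof -
  have "h \<circ> rot3 a b c \<circ> inv' h = (h \<circ> transpose a b \<circ> inv' h) \<circ> (h \<circ> transpose b c \<circ> inv' h)"
    unfolding rot3_def using assms by (auto simp: fun_eq_iff bij_is_inj)
  then show ?thesis unfolding rot3_def transpose_conj[OF assms] .
qed

section \<open>Permutation groups\<close>

locale perm_group =
  fixes S :: "'a set" and H :: "('a \<Rightarrow> 'a) set"
  assumes finite_S: "finite S"
    and permutes: "h \<in> H \<Longrightarrow> h permutes S"
    and id_mem: "id \<in> H"
    and comp_mem: "g \<in> H \<Longrightarrow> h \<in> H \<Longrightarrow> g \<circ> h \<in> H"
    and inv_mem: "h \<in> H \<Longrightarrow> inv' h \<in> H"
begin

lemma bij_mem: "h \<in> H \<Longrightarrow> bij h"
  using permutes permutes_bij by blast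

lemma mem_S_iff: "h \<in> H \<Longrightarrow> h x \<in> S \<longleftrightarrow> x \<in> S"
  using permutes permutes_in_image by metis

lemma moved_subset: "h \<in> H \<Longrightarrow> moved h \<subseteq> S"
  using permutes permutes_not_in unfolding moved_def by fastforce

lemma finite_moved: "h \<in> H \<Longrightarrow> finite (moved h)"
  using moved_subset finite_S finite_subset by blast

lemma finite_H: "finite H"
proof (rule finite_subset)
  show "H \<subseteq> {p. p permutes S}" using permutes by blast
  show "finite {p. p permutes S}" using finite_S by (rule finite_permutations)
qed

lemma conj_mem: "g \<in> H \<Longrightarrow> h \<in> H \<Longrightarrow> g \<circ> h \<circ> inv' g \<in> H"
  by (intro comp_mem inv_mem)

lemma funpow_mem: "h \<in> H \<Longrightarrow> h ^^ k \<in> H"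
proof (induction k)
  case (Suc k)
  then show ?case using comp_mem[of h "h ^^ k"] by (simp only: funpow.simps)
qed (simp only: funpow.simps id_mem)

definition invariant_equiv :: "('a \<times> 'a) set \<Rightarrow> bool" where
  "invariant_equiv R \<longleftrightarrow> equiv S R \<and> (\<forall>h\<in>H. \<forall>x y. (x, y) \<in> R \<longrightarrow> (h x, h y) \<in> R)"

definition primitive :: bool where
  "primitive \<longleftrightarrow> (\<forall>R. invariant_equiv R \<longrightarrow> R = Id_on S \<or> R = S \<times> S)"

lemma primitiveD:
  assumes primitive "invariant_equiv R" "(x, y) \<in> R" "x \<noteq> y" "a \<in> S" "b \<in> S"
  shows "(a, b) \<in> R"
  using assms unfolding primitive_def by blast

definition three_cycle_free :: bool where
  "three_cycle_free \<longleftrightarrow> (\<forall>a b c. distinct [a, b, c] \<longrightarrow> rot3 a b c \<notin> H)"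

lemma moved_inter_not_singleton:
  assumes three_cycle_free "u \<in> H" "v \<in> H"
  shows "moved u \<inter> moved v \<noteq> {x}"
proof
  assume x: "moved u \<inter> moved v = {x}"
  have "u \<circ> v \<circ> inv' u \<circ> inv' v \<in> H"
    using assms(2,3) by (intro comp_mem inv_mem)
  then show False
    using commutator_eq_rot3[OF bij_mem bij_mem x] assms unfolding three_cycle_free_def by metis
qed

definition is_base :: "'a set \<Rightarrow> bool" where
  "is_base B \<longleftrightarrow> B \<subseteq> S \<and> (\<forall>h\<in>H. (\<forall>x\<in>B. h x = x) \<longrightarrow> h = id)"

text \<open>Take a base \<open>B\<close> of least size. If it had more than half of the points, its
  complement would be too small to be a base, which gives a nontrivial \<open>u\<close> supported
  inside \<open>B\<close>. Dropping from \<open>B\<close> a point \<open>x\<close> moved by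
  \<open>u\<close> gives a nontrivial \<open>v\<close> whose support meets that of \<open>u\<close>
  only in \<open>x\<close>.\<close>

lemma ex_small_base:
  assumes three_cycle_free
  shows "\<exists>B. is_base B \<and> 2 * card B \<le> card S"
proof -
  have "is_base S"
  proof -
    have "h = id" if "h \<in> H" "\<forall>x\<in>S. h x = x" for h
      using that permutes[OF that(1)] permutes_not_in by fastforce
    then show ?thesis unfolding is_base_def by blast
  qed
  then obtain B where B: "is_base B" and min: "\<And>B'. is_base B' \<Longrightarrow> card B \<le> card B'"
    using ex_has_least_nat[of is_base S card] by blast
  have BS: "B \<subseteq> S" and finB: "finite B"
    using B finite_S finite_subset unfolding is_base_def by blast+
  have "2 * card B \<le> card S"
  proof (rule ccontr)
    assume "\<not> 2 * card B \<le> card S"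
    then have "card (S - B) < card B"
      using card_Diff_subset[OF finB BS] by simp
    then have "\<not> is_base (S - B)" using min leD by blast
    then obtain u where u: "u \<in> H" "u \<noteq> id" "\<forall>x\<in>S - B. u x = x"
      unfolding is_base_def by blast
    then obtain x where x: "u x \<noteq> x" by fastforce
    then have "x \<in> S" using moved_subset[OF u(1)] unfolding moved_def by blast
    with x u(3) have "x \<in> B" by blast
    then have "card (B - {x}) < card B" using card_Diff1_less[OF finB] by blast
    then have "\<not> is_base (B - {x})" using min leD by blast
    then obtain v where v: "v \<in> H" "v \<noteq> id" "\<forall>y\<in>B - {x}. v y = y"
      using BS unfolding is_base_def by blast
    have "v x \<noteq> x" using B v unfolding is_base_def by blast
    have "moved u \<inter> moved v = {x}"
      using moved_subset[OF u(1)] u(3) v(3) x \<open>v x \<noteq> x\<close> unfolding moved_def by blast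
    with moved_inter_not_singleton[OF assms u(1) v(1)] show False by (rule notE)
  qed
  with B show ?thesis by blast
qed

section \<open>Jordan's theorem on primitive groups containing a 3-cycle\<close>

definition has3 :: "'a \<Rightarrow> 'a \<Rightarrow> 'a \<Rightarrow> bool" where
  "has3 a b c \<longleftrightarrow> distinct [a, b, c] \<and> rot3 a b c \<in> H"

lemma has3_rotate: "has3 a b c \<Longrightarrow> has3 b c a"
proof -
  assume a: "has3 a b c"
  then have "rot3 b c a = rot3 a b c"
    unfolding has3_def by (intro ext) (auto simp: rot3_apply)
  with a show ?thesis unfolding has3_def by auto
qed

lemma has3_swap: "has3 a b c \<Longrightarrow> has3 b a c"
proof -
  assume a: "has3 a b c"
  have "rot3 a b c \<circ> rot3 b a c = id"
  proof
    fix x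
    show "(rot3 a b c \<circ> rot3 b a c) x = id x"
      using a unfolding has3_def
      by (cases "x = a"; cases "x = b"; cases "x = c") (auto simp: rot3_apply)
  qed
  moreover have "bij (rot3 a b c)" using a bij_mem unfolding has3_def by blast
  ultimately have "rot3 b a c = inv' (rot3 a b c)"
    by (metis bij_is_inj comp_assoc comp_id id_comp inv_o_cancel)
  then show ?thesis using a inv_mem unfolding has3_def by auto
qed

lemma has3_conj: "has3 a b c \<Longrightarrow> h \<in> H \<Longrightarrow> has3 (h a) (h b) (h c)"
  unfolding has3_def using rot3_conj[OF bij_mem] conj_mem bij_is_inj[OF bij_mem]
  by (auto simp: inj_eq) metis

lemma has3_conj3:
  assumes "has3 a b c" "has3 x y z"
  shows "has3 (rot3 x y z a) (rot3 x y z b) (rot3 x y z c)"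
  using assms has3_conj unfolding has3_def[of x] by blast

text \<open>Conjugation by \<open>rot3 j l m\<close> moves \<open>j\<close> to \<open>l\<close> and
  keeps \<open>i\<close>, unless \<open>m = i\<close>. In that case, and for \<open>k = l\<close>,
  one of the given 3-cycles already contains both \<open>i\<close> and \<open>l\<close>.\<close>

lemma has3_trans:
  assumes "has3 i j k" "has3 j l m" "i \<noteq> l"
  shows "\<exists>n. has3 i l n"
proof (cases "k = l \<or> m = i")
  case True
  then show ?thesis using assms has3_rotate has3_swap by metis
next
  case False
  have "has3 (rot3 j l m i) (rot3 j l m j) (rot3 j l m k)"
    using assms by (intro has3_conj3)
  moreover have "rot3 j l m i = i" "rot3 j l m j = l"
    using assms False unfolding has3_def by (auto simp: rot3_apply)
  ultimately show ?thesis by metis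
qed

lemma has3_mem_S: "has3 a b c \<Longrightarrow> a \<in> S"
  using moved_subset[of "rot3 a b c"] unfolding has3_def moved_def by (auto simp: rot3_apply)

text \<open>Lying in a common 3-cycle of \<open>H\<close> is an invariant equivalence relation, so
  by primitivity any two points do. This yields a 3-cycle through \<open>a\<close> and
  \<open>b\<close>; it remains to replace its third point by \<open>c\<close>.\<close>

lemma primitive_all_three_cycles:
  assumes primitive "\<not> three_cycle_free" "distinct [a, b, c]" "{a, b, c} \<subseteq> S"
  shows "rot3 a b c \<in> H"
proof -
  obtain x y z where xyz: "has3 x y z"
    using assms(2) unfolding three_cycle_free_def has3_def by blast
  define R where "R = {(x, y). x \<in> S \<and> y \<in> S \<and> (x = y \<or> (\<exists>z. has3 x y z))}"
  have "equiv S R"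
  proof (rule equivI)
    show "R \<subseteq> S \<times> S" unfolding R_def by blast
    show "refl_on S R" unfolding R_def refl_on_def by blast
    show "sym R" unfolding R_def sym_def using has3_swap by blast
    show "trans R" unfolding trans_def R_def using has3_trans by blast
  qed
  then have "invariant_equiv R"
    unfolding invariant_equiv_def R_def using mem_S_iff has3_conj by blast
  moreover have "(x, y) \<in> R" "x \<noteq> y"
    unfolding R_def using xyz has3_mem_S has3_rotate[OF xyz] unfolding has3_def by auto
  ultimately have rel: "\<exists>z. has3 a b z" if "a \<in> S" "b \<in> S" "a \<noteq> b" for a b
    using primitiveD[OF assms(1)] that unfolding R_def by blast
  have "has3 a b c"
  proof -
    obtain k where k: "has3 a b k" using rel assms by auto
    show ?thesis
    proof (cases "k = c")
      case False
      have "k \<in> S" using k has3_rotate has3_mem_S by metis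
      then obtain m where m: "has3 k c m" using rel[of k c] assms False by auto
      \<comment> \<open>Conjugation by \<open>?r\<close> replaces \<open>k\<close> by
        \<open>c\<close>. If \<open>m\<close> is \<open>a\<close> or \<open>b\<close>, that point is
        disturbed too, but a second conjugation gives \<open>a\<close>, \<open>b\<close>,
        \<open>c\<close> in some order, and \<open>has3\<close> does not depend on the
        order.\<close>
      let ?r = "rot3 k c m"
      have 1: "has3 (?r a) (?r b) (?r k)"
        by (rule has3_conj3[OF k m])
      have 2: "has3 (?r (?r a)) (?r (?r b)) (?r (?r k))"
        by (rule has3_conj3[OF 1 m])
      consider "m \<noteq> a" "m \<noteq> b" | "m = a" | "m = b" by blast
      then show ?thesis
      proof cases
        case 1
        then show ?thesis using \<open>has3 (?r a) (?r b) (?r k)\<close> k m assms(3)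
          by (auto simp: has3_def rot3_apply)
      next
        case 2
        have "?r (?r a) = c" "?r (?r b) = b" "?r (?r k) = a"
          using k m assms(3) \<open>m = a\<close> unfolding has3_def by (auto simp: rot3_apply)
        then have "has3 c b a"
          using \<open>has3 (?r (?r a)) (?r (?r b)) (?r (?r k))\<close> by simp
        then show ?thesis using has3_rotate has3_swap by metis
      next
        case 3
        have "?r (?r a) = a" "?r (?r b) = c" "?r (?r k) = b"
          using k m assms(3) \<open>m = b\<close> unfolding has3_def by (auto simp: rot3_apply)
        then have "has3 a c b"
          using \<open>has3 (?r (?r a)) (?r (?r b)) (?r (?r k))\<close> by simp
        then show ?thesis using has3_rotate has3_swap by metis
      qed
    qed (use k in simp)
  qed
  then show ?thesis unfolding has3_def by blast
qed

text \<open>Being equal or interchanged by a transposition of \<open>H\<close> is an invariant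
  equivalence relation. So \<open>H\<close> contains all transpositions, and two that share one
  point multiply to a 3-cycle.\<close>

lemma primitive_transposition:
  assumes primitive "transpose a b \<in> H" "a \<noteq> b" "card S \<ge> 3"
  shows "\<not> three_cycle_free"
proof -
  define R where "R = {(x, y). x \<in> S \<and> y \<in> S \<and> transpose x y \<in> H}"
  have conj: "transpose (h x) (h y) \<in> H" if "h \<in> H" "transpose x y \<in> H" for h x y
    using conj_mem[OF that] transpose_conj[OF bij_mem[OF that(1)]] by metis
  have "equiv S R"
  proof (rule equivI)
    show "R \<subseteq> S \<times> S" unfolding R_def by blast
    show "refl_on S R" unfolding R_def refl_on_def using id_mem by auto
    show "sym R" unfolding R_def sym_def by (auto simp: transpose_commute)
    have "transpose x z \<in> H" if "transpose x y \<in> H" "transpose y z \<in> H" for x y z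
    proof (cases "x = y \<or> x = z")
      case True
      then show ?thesis using that id_mem by auto
    next
      case False
      then show ?thesis using conj[OF that(2,1)] by (cases "y = z") (auto simp: that transpose_def)
    qed
    then show "trans R" unfolding trans_def R_def by blast
  qed
  then have inv: "invariant_equiv R"
    unfolding invariant_equiv_def R_def using mem_S_iff conj by blast
  have ab: "(a, b) \<in> R"
    using moved_subset[OF assms(2)] assms(2,3) unfolding R_def moved_def by (auto simp: transpose_def split: if_splits)
  have all: "transpose x y \<in> H" if "x \<in> S" "y \<in> S" for x y
    using primitiveD[OF assms(1) inv ab assms(3) that] unfolding R_def by blast
  obtain c where "c \<in> S" "c \<noteq> a" "c \<noteq> b"
  proof -
    have "card {a, b} < card S" using assms(3,4) by simp
    then have "\<not> S \<subseteq> {a, b}" by (metis card_mono finite.intros leD)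
    then show ?thesis using that by blast
  qed
  moreover have "rot3 a b c \<in> H"
    unfolding rot3_def using all ab calculation R_def by (intro comp_mem) auto
  moreover have "distinct [a, b, c]"
    using assms(3) calculation(2,3) by auto
  ultimately show ?thesis unfolding three_cycle_free_def by blast
qed

end

lemma alt_group_subset:
  assumes "perm_group {1..n} H"
    and "\<And>a b c. distinct [a, b, c] \<Longrightarrow> {a, b, c} \<subseteq> {1..n} \<Longrightarrow> rot3 a b c \<in> H"
  shows "carrier (alt_group n) \<subseteq> H"
proof
  interpret perm_group "{1..n}" H by fact
  fix p assume "p \<in> carrier (alt_group n)"
  then have "p \<in> generate (alt_group n) (three_cycles n)"
    using alt_group_carrier_as_three_cycles by blast
  moreover have three: "three_cycles n \<subseteq> H"
  proof clarify
    fix cs :: "nat list" assume cs: "distinct cs" "length cs = 3" "set cs \<subseteq> {1..n}"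
    then obtain a b c where "cs = [a, b, c]" using stupid_lemma by metis
    with cs show "cycle_of_list cs \<in> H"
      using assms(2)[of a b c] by (simp add: rot3_def)
  qed
  ultimately show "p \<in> H"
  proof induction
    case one
    then show ?case using id_mem by (simp only: alt_group_one)
  next
    case (inv h)
    then have "h \<in> carrier (alt_group n)" using three_cycles_incl by blast
    then show ?case using inv three inv_mem alt_group_inv_equality by auto
  next
    case (eng h1 h2)
    then show ?case using comp_mem by (simp only: alt_group_mult)
  qed (use three in blast)
qed

section \<open>Subsets of the integers modulo 12\<close>

text \<open>The autocorrelation of \<open>T\<close> modulo 12. For the positions of a support along
  a 12-cycle it is the number of points common to the support and its translate by
  \<open>j\<close>.\<close>

definition overlap :: "nat set \<Rightarrow> nat \<Rightarrow> nat" where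
  "overlap T j = card {t. t < 12 \<and> t \<in> T \<and> (t + j) mod 12 \<in> T}"

fun count_both :: "bool list \<Rightarrow> bool list \<Rightarrow> nat" where
  "count_both (x # xs) (y # ys) = (if x \<and> y then Suc (count_both xs ys) else count_both xs ys)"
| "count_both _ _ = 0"

fun all_rotations :: "nat \<Rightarrow> (bool list \<Rightarrow> bool) \<Rightarrow> bool list \<Rightarrow> bool" where
  "all_rotations 0 P xs = True"
| "all_rotations (Suc n) P xs = (if P xs then all_rotations n P (rotate1 xs) else False)"

text \<open>Tested on \<open>xs\<close> and on \<open>rotate1 xs\<close>; one of the two holds
  exactly if the encoded subset lies in one parity class (for even length).\<close>

fun even_part :: "bool list \<Rightarrow> bool" where
  "even_part [] = True"
| "even_part [x] = True"
| "even_part (x # y # xs) = (\<not> y \<and> even_part xs)"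

lemma count_both_eq:
  "length xs = length ys \<Longrightarrow> count_both xs ys = card {i. i < length xs \<and> xs ! i \<and> ys ! i}"
proof (induction xs ys rule: list_induct2)
  case (Cons x xs y ys)
  have "{i. i < length (x # xs) \<and> (x # xs) ! i \<and> (y # ys) ! i} =
     (if x \<and> y then {0} else {}) \<union> Suc ` {i. i < length xs \<and> xs ! i \<and> ys ! i}"
    (is "?L = ?R")
  proof (rule Set.set_eqI)
    fix i show "i \<in> ?L \<longleftrightarrow> i \<in> ?R" by (cases i) auto
  qed
  moreover have "card \<dots> = (if x \<and> y then 1 else 0) + card {i. i < length xs \<and> xs ! i \<and> ys ! i}"
    by (subst card_Un_disjoint) (auto simp: card_image)
  ultimately show ?case using Cons by simp
qed simp

lemma all_rotations_iff: "all_rotations n P xs \<longleftrightarrow> (\<forall>i<n. P (rotate i xs))"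
proof (induction n arbitrary: xs)
  case (Suc n)
  have "(\<forall>i<Suc n. P (rotate i xs)) \<longleftrightarrow> P xs \<and> (\<forall>i<n. P (rotate (Suc i) xs))"
    by (simp add: All_less_Suc2)
  moreover have "rotate i (rotate1 xs) = rotate (Suc i) xs" for i
    by (metis rotate1_rotate_swap rotate_Suc)
  ultimately show ?case using Suc by simp
qed simp


fun subsets_of_card :: "nat \<Rightarrow> nat \<Rightarrow> bool list list" where
  "subsets_of_card 0 0 = [[]]"
| "subsets_of_card 0 (Suc k) = []"
| "subsets_of_card (Suc n) 0 = map ((#) False) (subsets_of_card n 0)"
| "subsets_of_card (Suc n) (Suc k) =
     map ((#) False) (subsets_of_card n (Suc k)) @ map ((#) True) (subsets_of_card n k)"

text \<open>Unary numerals, so that the evaluation below can recurse on them.\<close>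

abbreviation "twelve \<equiv> Suc (Suc (Suc (Suc (Suc (Suc (Suc (Suc (Suc (Suc (Suc (Suc 0)))))))))))"

text \<open>A subset of the integers modulo 12 is encoded as its list of membership bits. The tests use
  nested conditionals because the simplifier evaluates both arguments of a connective.\<close>

definition check4 :: "bool list \<Rightarrow> bool" where "check4 xs =
  (if all_rotations twelve (\<lambda>ys. count_both xs ys \<noteq> Suc 0) xs
   then if rotate1 (rotate1 (rotate1 (rotate1 (rotate1 (rotate1 xs))))) = xs then True
   else if even_part xs then \<not> all_rotations twelve (\<lambda>ys. count_both xs ys \<noteq> Suc (Suc (Suc 0))) xs
   else if even_part (rotate1 xs) then \<not> all_rotations twelve (\<lambda>ys. count_both xs ys \<noteq> Suc (Suc (Suc 0))) xs
   else False else True)"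

definition check5 :: "bool list \<Rightarrow> bool" where "check5 xs =
  (if all_rotations twelve (\<lambda>ys. count_both xs ys \<noteq> Suc 0) xs
   then if all_rotations twelve (\<lambda>ys. count_both xs ys \<noteq> Suc (Suc 0)) xs
   then if even_part xs then True else even_part (rotate1 xs)
   else True else True)"

lemma check4_all: "list_all check4 (subsets_of_card twelve (Suc (Suc (Suc (Suc 0)))))"
  by code_simp

lemma check5_all: "list_all check5 (subsets_of_card twelve (Suc (Suc (Suc (Suc (Suc 0))))))"
  by code_simp

lemma mem_subsets_of_card:
  "xs \<in> set (subsets_of_card (length xs) (length (filter (\<lambda>x. x) xs)))"
proof (induction xs)
  case (Cons x xs)
  then show ?case
    by (cases x; cases "length (filter (\<lambda>x. x) xs)") auto
qed simp

lemma even_part_iff: "even_part xs \<longleftrightarrow> (\<forall>i<length xs. odd i \<longrightarrow> \<not> xs ! i)"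
proof (induction xs rule: even_part.induct)
  case (3 x y xs)
  have "(\<forall>i<length (x # y # xs). odd i \<longrightarrow> \<not> (x # y # xs) ! i) \<longleftrightarrow>
    \<not> y \<and> (\<forall>i<length xs. odd i \<longrightarrow> \<not> xs ! i)"
    by (simp add: All_less_Suc2)
  then show ?case using 3 by simp
qed auto

context
  fixes T :: "nat set"
  assumes T: "T \<subseteq> {..<12}"
begin

definition "bits = map (\<lambda>i. i \<in> T) [0..<12]"

lemma length_bits: "length bits = 12" and nth_bits: "i < 12 \<Longrightarrow> bits ! i \<longleftrightarrow> i \<in> T"
  by (simp_all add: bits_def)

lemma bits_mem: "bits \<in> set (subsets_of_card 12 (card T))"
proof -
  have "length (filter (\<lambda>x. x) bits) = card {i. i < length bits \<and> bits ! i}"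
    by (rule length_filter_conv_card)
  also have "{i. i < length bits \<and> bits ! i} = T"
    using T nth_bits length_bits by auto
  finally show ?thesis using mem_subsets_of_card[of bits] length_bits by simp
qed

lemma nth_rotate_bits: "i < 12 \<Longrightarrow> rotate j bits ! i \<longleftrightarrow> (i + j) mod 12 \<in> T"
  using nth_bits[of "(j + i) mod 12"] length_bits by (simp add: nth_rotate add.commute)

lemma count_rotate: "count_both bits (rotate j bits) = overlap T j"
  unfolding overlap_def using nth_rotate_bits nth_bits
  by (subst count_both_eq) (auto simp: length_bits intro!: arg_cong[of _ _ card])

lemma all_rotations_bits:
  "all_rotations twelve (\<lambda>ys. count_both bits ys \<noteq> k) bits \<longleftrightarrow> (\<forall>j<12. overlap T j \<noteq> k)"
  unfolding all_rotations_iff count_rotate by (simp add: numeral_eq_Suc)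

lemma even_part_bits:
  assumes "even_part bits \<or> even_part (rotate1 bits)" "s \<in> T" "t \<in> T"
  shows "even (s + t)"
  using assms(1)
proof
  assume "even_part bits"
  then have "even i" if "i \<in> T" for i
    using that T nth_bits length_bits unfolding even_part_iff by auto
  then show ?thesis using assms(2,3) by simp
next
  assume *: "even_part (rotate1 bits)"
  have "odd i" if "i \<in> T" for i
  proof
    assume "even i"
    have "i < 12" using that T by auto
    \<comment> \<open>Adding 11 is subtracting 1 modulo 12: \<open>k\<close> is the place to which
      \<open>i\<close> moves under \<open>rotate1\<close>.\<close>
    define k where "k = (i + 11) mod 12"
    have "odd k" "(k + 1) mod 12 = i" "k < 12"
      unfolding k_def using \<open>even i\<close> \<open>i < 12\<close> by presburger+
    moreover have "rotate1 bits = rotate 1 bits" by simp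
    ultimately show False
      using * that nth_rotate_bits[of k 1] length_bits unfolding even_part_iff by auto
  qed
  then show ?thesis using assms(2,3) by simp
qed

text \<open>Overlap 1 would mean two supports with a single common point. Typical sets that avoid it
  are {0,1,6,7}, which is periodic, and {0,2,4,6}, whose shift by 2 has overlap 3. This overlap is
  recorded because it is a property of the supports that does not refer to the 12-cycle.\<close>

lemma four_subset_mod_12:
  assumes "card T = 4" "\<And>j. j < 12 \<Longrightarrow> overlap T j \<noteq> 1"
  shows "(\<forall>t\<in>T. (t + 6) mod 12 \<in> T) \<or>
    (\<forall>s\<in>T. \<forall>t\<in>T. even (s + t)) \<and> (\<exists>j<12. overlap T j = 3)"
proof -
  have "twelve = 12" "Suc (Suc (Suc (Suc 0))) = 4" by simp_all
  then have "bits \<in> set (subsets_of_card twelve (Suc (Suc (Suc (Suc 0)))))"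
    using bits_mem assms(1) by metis
  then have "check4 bits" using check4_all unfolding list_all_iff by blast
  moreover have "rotate1 (rotate1 (rotate1 (rotate1 (rotate1 (rotate1 bits))))) = rotate 6 bits"
    by (simp add: rotate_def numeral_eq_Suc)
  moreover have "all_rotations twelve (\<lambda>ys. count_both bits ys \<noteq> Suc 0) bits"
    unfolding all_rotations_bits using assms(2) by simp
  ultimately have "rotate 6 bits = bits \<or>
     (even_part bits \<or> even_part (rotate1 bits)) \<and> (\<exists>j<12. overlap T j = Suc (Suc (Suc 0)))"
    unfolding check4_def all_rotations_bits by (auto split: if_splits)
  then show ?thesis
  proof
    assume *: "rotate 6 bits = bits"
    have "(t + 6) mod 12 \<in> T" if "t \<in> T" for t
    proof -
      have "t < 12" using that T by auto
      then show ?thesis using nth_rotate_bits[of t 6] nth_bits[of t] * that by simp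
    qed
    then show ?thesis by blast
  next
    assume *: "(even_part bits \<or> even_part (rotate1 bits)) \<and> (\<exists>j<12. overlap T j = Suc (Suc (Suc 0)))"
    then have "\<exists>j<12. overlap T j = 3" by (simp only: numeral_3_eq_3)
    moreover have "even (s + t)" if "s \<in> T" "t \<in> T" for s t
      using even_part_bits[OF _ that] * by blast
    ultimately show ?thesis by blast
  qed
qed

text \<open>Five of the six members of a parity class do satisfy the hypothesis: nonzero even shifts
  have overlap 4, odd shifts 0. Overlap 2 will be excluded by \<open>moved_5_inter\<close>.\<close>

lemma five_subset_mod_12:
  assumes "card T = 5" "\<And>j. j < 12 \<Longrightarrow> overlap T j \<noteq> 1 \<and> overlap T j \<noteq> 2" "s \<in> T" "t \<in> T"
  shows "even (s + t)"
proof -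
  have "twelve = 12" "Suc (Suc (Suc (Suc (Suc 0)))) = 5" by simp_all
  then have "bits \<in> set (subsets_of_card twelve (Suc (Suc (Suc (Suc (Suc 0))))))"
    using bits_mem assms(1) by metis
  then have "check5 bits" using check5_all unfolding list_all_iff by blast
  moreover have "all_rotations twelve (\<lambda>ys. count_both bits ys \<noteq> Suc 0) bits"
    "all_rotations twelve (\<lambda>ys. count_both bits ys \<noteq> Suc (Suc 0)) bits"
    unfolding all_rotations_bits using assms(2) by (simp_all add: numeral_eq_Suc)
  ultimately have "even_part bits \<or> even_part (rotate1 bits)"
    unfolding check5_def by presburger
  then show ?thesis using even_part_bits assms(3,4) by blast
qed

end

section \<open>Supports of commutators and elements of small support\<close>

context perm_group
begin

lemma moved_conj: "h \<in> H \<Longrightarrow> moved (h \<circ> u \<circ> inv' h) = h ` moved u"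
proof -
  assume h: "h \<in> H"
  have "y \<in> moved (h \<circ> u \<circ> inv' h) \<longleftrightarrow> y \<in> h ` moved u" for y
  proof -
    obtain x where y: "y = h x" using bij_mem[OF h] by (metis bij_pointE)
    then have "inv' h y = x" using bij_mem[OF h] by (simp add: bij_is_inj)
    moreover have "h a = h b \<longleftrightarrow> a = b" for a b
      using bij_mem[OF h] by (simp add: bij_def inj_eq)
    ultimately show ?thesis unfolding moved_def y by (auto simp: image_iff)
  qed
  then show ?thesis by blast
qed

lemma inj_mem: "h \<in> H \<Longrightarrow> h x = h y \<longleftrightarrow> x = y"
  using bij_mem by (simp add: bij_def inj_eq)

lemma inv_eq_iff: "h \<in> H \<Longrightarrow> inv' h y = x \<longleftrightarrow> y = h x"
  using bij_mem by (metis bij_inv_eq_iff)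

text \<open>A point can be moved only if both permutations act at some stage of its path through the
  commutator. For two common points this bounds the support by 6, and every coincidence among the
  six points lowers the bound further.\<close>

lemma moved_commutator_subset:
  assumes u: "u \<in> H" and v: "v \<in> H" and I: "I = moved u \<inter> moved v"
  shows "moved (u \<circ> v \<circ> inv' u \<circ> inv' v) \<subseteq> I \<union> u ` I \<union> v ` I"
proof -
  have "(u \<circ> v \<circ> inv' u \<circ> inv' v) y = y" if y: "y \<notin> I \<union> u ` I \<union> v ` I" for y
  proof -
    obtain z where z: "y = v z" using bij_mem[OF v] by (metis bij_pointE)
    obtain t where t: "z = u t" using bij_mem[OF u] by (metis bij_pointE)
    obtain s where s: "y = u s" using bij_mem[OF u] by (metis bij_pointE)
    have "inv' v y = z" "inv' u z = t" using z t u v inv_eq_iff by auto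
    then have w: "(u \<circ> v \<circ> inv' u \<circ> inv' v) y = u (v t)" by simp
    have nI: "y \<notin> I" "z \<notin> I" "s \<notin> I" using y z s by (blast, blast, blast)
    show ?thesis
    proof (cases "v z = z")
      case True
      then have "y = z" "s = t" using z s t u inj_mem by auto
      then consider "v t = t" | "u t = t" using nI I unfolding moved_def by blast
      then show ?thesis
        using w z t True \<open>y = z\<close> by cases simp_all
    next
      case False
      then have "u z = z" using nI I unfolding moved_def by blast
      then have "t = z" using t u inj_mem by metis
      have "v y \<noteq> y" using False z v inj_mem by metis
      then have "u y = y" using nI I unfolding moved_def by blast
      then show ?thesis using w z \<open>t = z\<close> by simp
    qed
  qed
  then show ?thesis unfolding moved_def by blast
qed

lemma commutator_id_commute:
  assumes "u \<in> H" "v \<in> H" "u \<circ> v \<circ> inv' u \<circ> inv' v = id"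
  shows "u (v x) = v (u x)"
proof -
  have "(u \<circ> v \<circ> inv' u \<circ> inv' v) (v (u x)) = v (u x)" using assms(3) by simp
  moreover have "inv' v (v (u x)) = u x" "inv' u (u x) = x"
    using assms(1,2) inv_eq_iff by auto
  ultimately show ?thesis by simp
qed

text \<open>Commuting elements preserve each other's supports. Trivial commutators are refuted by
  exhibiting a point of \<open>moved v\<close> that \<open>u\<close> moves out of it.\<close>

lemma commute_moved:
  assumes "u \<in> H" "v \<in> H" "u \<circ> v \<circ> inv' u \<circ> inv' v = id" "x \<in> moved v"
  shows "u x \<in> moved v"
  using commutator_id_commute[OF assms(1-3), of x] assms(4) inj_mem[OF assms(1)]
  unfolding moved_def by auto

lemma moved_image_self: "u \<in> H \<Longrightarrow> u x \<in> moved u \<longleftrightarrow> x \<in> moved u"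
  unfolding moved_def using inj_mem by auto

lemma commutator_mem: "u \<in> H \<Longrightarrow> v \<in> H \<Longrightarrow> u \<circ> v \<circ> inv' u \<circ> inv' v \<in> H"
  by (intro comp_mem inv_mem)

lemma moved_eq_empty: "moved u = {} \<longleftrightarrow> u = id"
  unfolding moved_def by auto

lemma card_moved_pos: "u \<in> H \<Longrightarrow> u \<noteq> id \<Longrightarrow> card (moved u) \<noteq> 0"
  using moved_eq_empty finite_moved by auto

lemma card_moved_neq_1: "u \<in> H \<Longrightarrow> card (moved u) \<noteq> 1"
proof
  assume u: "u \<in> H" and "card (moved u) = 1"
  then obtain x where x: "moved u = {x}" using card_1_singletonE by blast
  then have "u x = x" using moved_image_self[OF u, of x] by auto
  then show False using x unfolding moved_def by auto
qed

lemma card_moved_2_transpose: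
  assumes "u \<in> H" "card (moved u) = 2"
  obtains a b where "a \<noteq> b" "u = transpose a b"
proof -
  obtain a b where ab: "moved u = {a, b}" "a \<noteq> b" using assms(2) by (meson card_2_iff)
  have "u a \<in> {a, b}" "u b \<in> {a, b}" "u a \<noteq> a" "u b \<noteq> b"
    using moved_image_self[OF assms(1)] ab unfolding moved_def by auto
  then have "u = transpose a b"
    using ab unfolding moved_def by (intro ext) (auto simp: transpose_def)
  with ab show ?thesis using that by blast
qed

lemma card_moved_3:
  assumes "three_cycle_free" "u \<in> H" shows "card (moved u) \<noteq> 3"
proof
  assume "card (moved u) = 3"
  then obtain a b c where abc: "moved u = {a, b, c}" "a \<noteq> b" "b \<noteq> c" "a \<noteq> c"
    by (auto simp: card_3_iff)
  have *: "u a \<in> {a, b, c}" "u b \<in> {a, b, c}" "u c \<in> {a, b, c}"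
    "u a \<noteq> a" "u b \<noteq> b" "u c \<noteq> c" "u a \<noteq> u b" "u a \<noteq> u c" "u b \<noteq> u c"
    using moved_image_self[OF assms(2)] abc inj_mem[OF assms(2)] unfolding moved_def by auto
  have fx: "u x = x" if "x \<noteq> a" "x \<noteq> b" "x \<noteq> c" for x
    using that abc(1) unfolding moved_def by auto
  have "u = rot3 a b c \<or> u = rot3 a c b"
  proof (cases "u a = b")
    case True
    then have "u b = c" "u c = a" using * by auto
    then have "u x = rot3 a b c x" for x
      using True fx[of x] abc by (simp add: rot3_apply)
    then show ?thesis by blast
  next
    case False
    then have "u a = c" "u b = a" "u c = b" using * by auto
    then have "u x = rot3 a c b x" for x
      using fx[of x] abc by (simp add: rot3_apply)
    then show ?thesis by blast
  qed
  then show False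
    using assms abc unfolding three_cycle_free_def by auto
qed

text \<open>All powers of such an element have support of size 0 or 5, so it acts semiregularly on
  its support.\<close>

lemma orb_eq_moved:
  assumes u: "u \<in> H" and card: "card (moved u) = 5" and a: "a \<in> moved u"
    and small: "\<And>w. w \<in> H \<Longrightarrow> card (moved w) \<le> 4 \<Longrightarrow> w = id"
  shows "orb u a = moved u"
proof -
  note u_perm = permutes[OF u] finite_S
  have dvd: "least_power u y dvd least_power u x" if "x \<in> moved u" for x y
  proof -
    let ?w = "u ^^ least_power u x"
    have "?w x = x" unfolding funpow_eq_iff_least_power[OF u_perm] by simp
    moreover have "u z = z \<Longrightarrow> (u ^^ k) z = z" for z k by (induction k) simp_all
    ultimately have "moved ?w \<subseteq> moved u - {x}" unfolding moved_def by auto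
    moreover have "card (moved u - {x}) = 4" using that card finite_moved[OF u] by simp
    ultimately have "card (moved ?w) \<le> 4"
      using finite_moved[OF u] card_mono[of "moved u - {x}" "moved ?w"] by simp
    then have "?w = id" using small funpow_mem[OF u] by blast
    then have "?w y = y" by simp
    then show ?thesis unfolding funpow_eq_iff_least_power[OF u_perm] .
  qed
  define m where "m = least_power u a"
  have m: "least_power u x = m" if "x \<in> moved u" for x
    unfolding m_def using dvd that a by (meson dvd_antisym)
  have sub: "orb u x \<subseteq> moved u" if "x \<in> moved u" for x
    using orb_subset[OF u_perm, of "moved u" x] that moved_image_self[OF u] by auto
  \<comment> \<open>The orbits on \<open>moved u\<close> all have size \<open>m\<close> and
    partition 5 points, hence \<open>m\<close> divides 5.\<close>
  have "m * card (orb u ` moved u) = card (\<Union> (orb u ` moved u))"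
  proof (rule card_partition)
    show "finite (orb u ` moved u)" using finite_moved[OF u] by simp
    have U: "\<Union> (orb u ` moved u) \<subseteq> moved u" using sub by blast
    then show "finite (\<Union> (orb u ` moved u))" using finite_moved[OF u] finite_subset by blast
    show "card c = m" if "c \<in> orb u ` moved u" for c
      using that m card_orb[OF u_perm] by auto
    show "c \<inter> d = {}" if "c \<in> orb u ` moved u" "d \<in> orb u ` moved u" "c \<noteq> d" for c d
      using that orb_disjoint[OF u_perm] by (metis imageE)
  qed
  also have "\<Union> (orb u ` moved u) = moved u" using sub orb_self by fast
  finally have "m dvd 5" using card by (metis dvd_triv_left)
  then have "m \<le> 5" by (simp add: dvd_imp_le)
  then consider "m = 0" | "m = 1" | "m = 2" | "m = 3" | "m = 4" | "m = 5" by linarith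
  then have "m = 1 \<or> m = 5"
    using \<open>m dvd 5\<close> by cases simp_all
  moreover have "m \<noteq> 1"
  proof
    assume "m = 1"
    then have "(u ^^ 1) a = a" unfolding funpow_eq_iff_least_power[OF u_perm] m_def by simp
    then show False using a unfolding moved_def by simp
  qed
  ultimately have "m = 5" by blast
  then have "card (orb u a) = card (moved u)" using card_orb[OF u_perm] card m_def by simp
  then show ?thesis using sub[OF a] finite_moved[OF u] card_subset_eq by blast
qed

text \<open>If the supports meet in two points, powers of both elements map one of the points to the
  other, and the commutator of these powers moves at most 4 points.\<close>

lemma moved_5_inter:
  assumes u: "u \<in> H" and v: "v \<in> H" and card: "card (moved u) = 5" "card (moved v) = 5"
    and small: "\<And>w. w \<in> H \<Longrightarrow> card (moved w) \<le> 4 \<Longrightarrow> w = id"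
  shows "card (moved u \<inter> moved v) \<noteq> 2"
proof
  assume "card (moved u \<inter> moved v) = 2"
  then obtain a b where ab: "moved u \<inter> moved v = {a, b}" "a \<noteq> b" by (meson card_2_iff)
  have power: "\<exists>w\<in>H. moved w = moved f \<and> w a = b"
    if f: "f \<in> H" "card (moved f) = 5" "a \<in> moved f" "b \<in> moved f" for f
  proof -
    have "b \<in> orb f a" using orb_eq_moved[OF f(1-3) small] f(4) by blast
    then obtain k where k: "(f ^^ k) a = b" unfolding orb_def by blast
    have kH: "f ^^ k \<in> H" using funpow_mem[OF f(1)] .
    have "f z = z \<Longrightarrow> (f ^^ k) z = z" for z by (induction k) simp_all
    then have "moved (f ^^ k) \<subseteq> moved f" unfolding moved_def by auto
    moreover have "5 \<le> card (moved (f ^^ k))"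
    proof (rule ccontr)
      assume "\<not> 5 \<le> card (moved (f ^^ k))"
      then have "f ^^ k = id" using small[OF kH] by simp
      then show False using k ab by simp
    qed
    ultimately have "moved (f ^^ k) = moved f"
      using finite_moved[OF f(1)] f(2) by (metis card_seteq)
    with k kH show ?thesis by blast
  qed
  obtain u' where u': "u' \<in> H" "moved u' = moved u" "u' a = b"
    using power[OF u card(1)] ab by blast
  obtain v' where v': "v' \<in> H" "moved v' = moved v" "v' a = b"
    using power[OF v card(2)] ab by blast
  define w where "w = u' \<circ> v' \<circ> inv' u' \<circ> inv' v'"
  have "w \<in> H" unfolding w_def using u' v' commutator_mem by blast
  have "moved w \<subseteq> {a, b} \<union> u' ` {a, b} \<union> v' ` {a, b}"
    unfolding w_def using moved_commutator_subset[OF u'(1) v'(1)] u' v' ab by simp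
  then have "moved w \<subseteq> {a, b, u' b, v' b}" using u' v' by auto
  then have "card (moved w) \<le> card {a, b, u' b, v' b}" by (intro card_mono) auto
  also have "\<dots> \<le> 4" by (simp add: card_insert_if)
  finally have "w = id" using small \<open>w \<in> H\<close> by blast
  \<comment> \<open>Since \<open>u'\<close> commutes with \<open>v'\<close>, it keeps both supports
    and so maps \<open>b\<close> back to \<open>a\<close>. This 2-cycle contradicts the orbit of
    length 5.\<close>
  then have "u' b \<in> moved v'" using commute_moved[OF u'(1) v'(1)] ab v'(2) unfolding w_def by blast
  moreover have "u' b \<in> moved u'" using moved_image_self[OF u'(1), of b] ab u'(2) by blast
  ultimately have "u' b \<in> {a, b}" using ab u'(2) v'(2) by blast
  moreover have "u' b \<noteq> b" using ab u'(2) unfolding moved_def by blast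
  ultimately have "(u' ^^ 2) a = a" using u'(3) by (simp add: numeral_2_eq_2)
  moreover have "orb u' a = moved u'"
    using orb_eq_moved[OF u'(1) _ _ small] u' ab card by auto
  then have "least_power u' a = 5"
    using card_orb[OF permutes[OF u'(1)] finite_S, of a] u'(2) card by simp
  ultimately show False
    using funpow_eq_iff_least_power[OF permutes[OF u'(1)] finite_S, of 2 a] by simp
qed

end

section \<open>Primitive groups containing a 12-cycle\<close>

text \<open>The labelling \<open>e\<close> by residues modulo 12 turns \<open>c\<close> into
  addition of 1, so that supports become subsets of the residues.\<close>

locale primitive_12_cycle = perm_group S H for S :: "'a set" and H +
  fixes c :: "'a \<Rightarrow> 'a" and e :: "nat \<Rightarrow> 'a"
  assumes e: "bij_betw e {..<12} S" and c_mem: "c \<in> H"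
    and c_e: "i < 12 \<Longrightarrow> c (e i) = e (Suc i mod 12)"
    and prim: primitive and free: three_cycle_free
begin

lemma card_S: "card S = 12"
  using bij_betw_same_card[OF e] by simp

lemma e_eq_iff: "i < 12 \<Longrightarrow> j < 12 \<Longrightarrow> e i = e j \<longleftrightarrow> i = j"
  using e unfolding bij_betw_def inj_on_def by blast

lemma e_mem: "i < 12 \<Longrightarrow> e i \<in> S"
  using e unfolding bij_betw_def by blast

lemma ex_e: "x \<in> S \<Longrightarrow> \<exists>i<12. x = e i"
  using e unfolding bij_betw_def by blast

lemma funpow_c: "i < 12 \<Longrightarrow> (c ^^ j) (e i) = e ((i + j) mod 12)"
proof (induction j)
  case (Suc j)
  then show ?case using c_e[of "(i + j) mod 12"] by (simp add: mod_Suc_eq)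
qed simp

definition pos :: "'a set \<Rightarrow> nat set" where
  "pos A = {i. i < 12 \<and> e i \<in> A}"

lemma pos_subset: "pos A \<subseteq> {..<12}"
  unfolding pos_def by blast

lemma card_pos: "A \<subseteq> S \<Longrightarrow> card (pos A) = card A"
proof -
  assume A: "A \<subseteq> S"
  have "inj_on e (pos A)"
    using e unfolding bij_betw_def by (meson inj_on_subset pos_subset)
  moreover have "e ` pos A = A"
    using A ex_e unfolding pos_def by fastforce
  ultimately show ?thesis by (metis card_image)
qed

text \<open>Conjugating \<open>u\<close> by the inverse of \<open>c ^^ j\<close> shifts its support
  by \<open>-j\<close> along the 12-cycle, so every overlap is realised as the intersection of two
  supports of the same size.\<close>

lemma overlap_pos:
  assumes "u \<in> H"
  shows "\<exists>v\<in>H. card (moved v) = card (moved u) \<and> card (moved u \<inter> moved v) = overlap (pos (moved u)) j"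
proof -
  define h where "h = inv' (c ^^ j)"
  have h: "h \<in> H" unfolding h_def using inv_mem funpow_mem c_mem by blast
  have h_iff: "e i \<in> h ` A \<longleftrightarrow> e ((i + j) mod 12) \<in> A" if "i < 12" for i A
  proof -
    have cj: "c ^^ j \<in> H" using funpow_mem[OF c_mem] .
    have "h y = e i \<longleftrightarrow> y = e ((i + j) mod 12)" for y
      unfolding h_def using inv_eq_iff[OF cj] funpow_c[OF that] by simp
    then show ?thesis by (metis imageE imageI)
  qed
  define v where "v = h \<circ> u \<circ> inv' h"
  have "v \<in> H" unfolding v_def using conj_mem h assms by blast
  have mv: "moved v = h ` moved u" unfolding v_def using moved_conj[OF h] .
  have "card (moved v) = card (moved u)"
    unfolding mv using inj_mem[OF h] by (intro card_image) (simp add: inj_on_def)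
  moreover have "card (moved u \<inter> moved v) = card (pos (moved u \<inter> moved v))"
    using card_pos moved_subset[OF assms] by (metis inf.coboundedI1)
  moreover have "pos (moved u \<inter> moved v) = {t. t < 12 \<and> t \<in> pos (moved u) \<and> (t + j) mod 12 \<in> pos (moved u)}"
    unfolding pos_def mv using h_iff by auto
  ultimately show ?thesis using \<open>v \<in> H\<close> unfolding overlap_def by auto
qed

lemma overlap_neq_1:
  assumes "u \<in> H" shows "overlap (pos (moved u)) j \<noteq> 1"
proof
  assume "overlap (pos (moved u)) j = 1"
  then obtain v where v: "v \<in> H" "card (moved u \<inter> moved v) = 1"
    using overlap_pos[OF assms] by metis
  then obtain x where "moved u \<inter> moved v = {x}" using card_1_singletonE by blast
  with moved_inter_not_singleton[OF free assms v(1)] show False by (rule notE)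
qed

text \<open>Lying in the same members of the family is an invariant equivalence relation that
  identifies opposite points of the 12-cycle.\<close>

lemma no_periodic_family:
  assumes "A0 \<in> F" "A0 \<noteq> {}" "A0 \<subset> S"
    and F_inv: "\<And>A h. A \<in> F \<Longrightarrow> h \<in> H \<Longrightarrow> h ` A \<in> F"
    and periodic: "\<And>A i. A \<in> F \<Longrightarrow> i \<in> pos A \<Longrightarrow> (i + 6) mod 12 \<in> pos A"
  shows False
proof -
  define R where "R = {(x, y). x \<in> S \<and> y \<in> S \<and> (\<forall>A\<in>F. x \<in> A \<longleftrightarrow> y \<in> A)}"
  have "equiv S R"
    by (rule equivI) (auto simp: R_def refl_on_def sym_def trans_def)
  moreover have "(h x, h y) \<in> R" if "h \<in> H" "(x, y) \<in> R" for h x y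
  proof -
    have "h z \<in> A \<longleftrightarrow> z \<in> inv' h ` A" for z A
    proof -
      have "inv' h (h z) = z" "h (inv' h y) = y" for y
        using permutes_inverses[OF permutes[OF that(1)]] by auto
      then show ?thesis by (metis imageE imageI)
    qed
    moreover have "inv' h ` A \<in> F" if "A \<in> F" for A
      using F_inv[OF that] inv_mem \<open>h \<in> H\<close> by blast
    ultimately show ?thesis using that(2) mem_S_iff[OF that(1)] unfolding R_def by auto
  qed
  ultimately have inv: "invariant_equiv R" unfolding invariant_equiv_def by blast
  have "e 0 \<in> A \<longleftrightarrow> e 6 \<in> A" if "A \<in> F" for A
    using periodic[OF that, of 0] periodic[OF that, of 6] unfolding pos_def by auto
  then have "(e 0, e 6) \<in> R" unfolding R_def using e_mem by simp
  moreover have "e 0 \<noteq> e 6" by (simp add: e_eq_iff)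
  moreover obtain a b where "a \<in> A0" "b \<in> S" "b \<notin> A0" using assms(2,3) by blast
  ultimately show False
    using primitiveD[OF prim inv, of "e 0" "e 6" a b] assms(1,3) unfolding R_def by blast
qed

text \<open>Being connected by members of the family is an invariant equivalence relation that
  respects the parity along the 12-cycle.\<close>

lemma no_parity_family:
  assumes "A0 \<in> F" "a \<in> A0" "b \<in> A0" "a \<noteq> b"
    and F_sub: "\<And>A. A \<in> F \<Longrightarrow> A \<subseteq> S"
    and F_inv: "\<And>A h. A \<in> F \<Longrightarrow> h \<in> H \<Longrightarrow> h ` A \<in> F"
    and parity: "\<And>A i j. A \<in> F \<Longrightarrow> i \<in> pos A \<Longrightarrow> j \<in> pos A \<Longrightarrow> even (i + j)"
  shows False
proof -
  define Q where "Q = {(x, y). \<exists>A\<in>F. x \<in> A \<and> y \<in> A}"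
  define R where "R = Q\<^sup>* \<inter> S \<times> S"
  have "sym Q" unfolding Q_def sym_def by blast
  then have "sym (Q\<^sup>*)" by (rule sym_rtrancl)
  have "equiv S R"
  proof (rule equivI)
    show "sym R" using \<open>sym (Q\<^sup>*)\<close> unfolding R_def sym_def by blast
    show "trans R" unfolding R_def trans_def by (auto intro: rtrancl_trans)
  qed (auto simp: R_def refl_on_def)
  moreover have "(h x, h y) \<in> Q\<^sup>*" if "h \<in> H" "(x, y) \<in> Q\<^sup>*" for h x y
    using that(2)
  proof induction
    case (step y z)
    then have "(h y, h z) \<in> Q" unfolding Q_def using F_inv[OF _ that(1)] by blast
    with step show ?case by (meson rtrancl.rtrancl_into_rtrancl)
  qed simp
  ultimately have inv: "invariant_equiv R"
    unfolding invariant_equiv_def R_def using mem_S_iff by blast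
  have "even (i + j)" if "(e i, y) \<in> Q\<^sup>*" "i < 12" "j < 12" "y = e j" for i j y
    using that
  proof (induction arbitrary: j)
    case base
    then show ?case using e_eq_iff by simp
  next
    case (step y z)
    then obtain A where A: "A \<in> F" "y \<in> A" "z \<in> A" unfolding Q_def by blast
    then obtain k where k: "k < 12" "y = e k" using ex_e F_sub by blast
    have "even (i + k)" using step.IH k step.prems by blast
    moreover have "even (k + j)"
      using parity[OF A(1), of k j] A k step.prems unfolding pos_def by auto
    ultimately show ?case by presburger
  qed
  from this[of 0 "e 1" 1] have "(e 0, e 1) \<notin> R" unfolding R_def by auto
  moreover have "(a, b) \<in> Q" "a \<in> S" "b \<in> S"
    using assms(1-3) F_sub[OF assms(1)] unfolding Q_def by blast+
  then have "(a, b) \<in> R" unfolding R_def by blast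
  moreover have "e 0 \<in> S" "e 1 \<in> S" using e_mem by simp_all
  ultimately show False
    using primitiveD[OF prim inv _ assms(4)] by blast
qed

lemma card_moved_neq_2:
  assumes "u \<in> H" shows "card (moved u) \<noteq> 2"
proof
  assume "card (moved u) = 2"
  then obtain a b where "a \<noteq> b" "u = transpose a b"
    using card_moved_2_transpose[OF assms] by metis
  then show False
    using primitive_transposition[OF prim, of a b] assms free card_S by simp
qed

definition supports :: "nat \<Rightarrow> 'a set set" where
  "supports k = {moved u | u. u \<in> H \<and> card (moved u) = k}"

lemma supports_image:
  assumes "A \<in> supports k" "h \<in> H" shows "h ` A \<in> supports k"
proof -
  obtain u where u: "u \<in> H" "A = moved u" "card (moved u) = k"
    using assms(1) unfolding supports_def by blast
  have "card (h ` A) = card A"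
    using inj_mem[OF assms(2)] by (intro card_image) (simp add: inj_on_def)
  then show ?thesis
    unfolding supports_def mem_Collect_eq
    using u moved_conj[OF assms(2), of u] conj_mem[OF assms(2) u(1)]
    by (intro exI[of _ "h \<circ> u \<circ> inv' h"]) simp
qed

lemma supports_subset: "A \<in> supports k \<Longrightarrow> A \<subseteq> S"
  unfolding supports_def using moved_subset by blast

text \<open>The family of supports of size 4 that meet another one in 3 points is invariant. If it
  is empty then all supports of size 4 are periodic, otherwise its members lie in parity classes.\<close>

lemma card_moved_neq_4:
  assumes "u0 \<in> H" shows "card (moved u0) \<noteq> 4"
proof
  assume u0: "card (moved u0) = 4"
  have cases4: "(\<forall>t\<in>pos A. (t + 6) mod 12 \<in> pos A) \<or>
    (\<forall>s\<in>pos A. \<forall>t\<in>pos A. even (s + t)) \<and> (\<exists>B\<in>supports 4. card (A \<inter> B) = 3)"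
    if A: "A \<in> supports 4" for A
  proof -
    obtain u where u: "u \<in> H" "A = moved u" "card (moved u) = 4"
      using A unfolding supports_def by blast
    have "card (pos A) = 4" using card_pos u moved_subset by simp
    from four_subset_mod_12[OF pos_subset this] overlap_neq_1[OF u(1)] u(2)
    have "(\<forall>t\<in>pos A. (t + 6) mod 12 \<in> pos A) \<or>
      (\<forall>s\<in>pos A. \<forall>t\<in>pos A. even (s + t)) \<and> (\<exists>j<12. overlap (pos A) j = 3)" by blast
    moreover have "\<exists>B\<in>supports 4. card (A \<inter> B) = overlap (pos A) j" for j
      using overlap_pos[OF u(1), of j] u unfolding supports_def by force
    ultimately show ?thesis by metis
  qed
  define F where "F = {A \<in> supports 4. \<exists>B\<in>supports 4. card (A \<inter> B) = 3}"
  have F_inv: "h ` A \<in> F" if A: "A \<in> F" and h: "h \<in> H" for A h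
  proof -
    obtain B where B: "B \<in> supports 4" "card (A \<inter> B) = 3" using A unfolding F_def by blast
    have inj: "inj h" using bij_mem[OF h] by (rule bij_is_inj)
    then have "h ` A \<inter> h ` B = h ` (A \<inter> B)" by (simp add: image_Int)
    moreover have "card (h ` (A \<inter> B)) = 3"
      using B(2) inj by (metis card_image inj_on_subset subset_UNIV)
    moreover have "h ` A \<in> supports 4" "h ` B \<in> supports 4"
      using A B(1) supports_image h unfolding F_def by blast+
    ultimately have "h ` A \<in> supports 4 \<and> h ` B \<in> supports 4 \<and> card (h ` A \<inter> h ` B) = 3" by simp
    then show ?thesis unfolding F_def by blast
  qed
  show False
  proof (cases "F = {}")
    case True
    have "(i + 6) mod 12 \<in> pos A" if "A \<in> supports 4" "i \<in> pos A" for A i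
      using cases4[OF that(1)] that True unfolding F_def by blast
    moreover have "moved u0 \<in> supports 4" using u0 assms unfolding supports_def by blast
    moreover have "moved u0 \<noteq> {}" "moved u0 \<subset> S"
      using u0 card_S moved_subset[OF assms] by auto
    ultimately show False using no_periodic_family[of "moved u0" "supports 4"] supports_image by blast
  next
    case False
    have parity: "even (i + j)" if A: "A \<in> F" and ij: "i \<in> pos A" "j \<in> pos A" for A i j
    proof (cases "\<forall>t\<in>pos A. (t + 6) mod 12 \<in> pos A")
      case False
      then show ?thesis using cases4[of A] A ij unfolding F_def by blast
    next
      \<comment> \<open>The partner \<open>B\<close> is not periodic, since three common points do
        not split into pairs \<open>t\<close>, \<open>t + 6\<close>. So \<open>B\<close>, and with
        it the intersection \<open>X\<close>, lies in one parity class. The fourth point of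
        \<open>A\<close> is opposite to a point of \<open>X\<close>, and adding 6 keeps the
        parity.\<close>
      case periodic_A: True
      obtain B where B: "B \<in> supports 4" "card (A \<inter> B) = 3" using A unfolding F_def by blast
      define X where "X = pos (A \<inter> B)"
      have X: "X = pos A \<inter> pos B" unfolding X_def pos_def by blast
      have "finite X" using finite_subset[OF pos_subset] unfolding X_def by blast
      have "card X = 3" unfolding X_def using B(2) card_pos supports_subset[OF B(1)]
        by (metis inf.coboundedI2)
      have "A \<in> supports 4" using A unfolding F_def by blast
      then have "card A = 4" unfolding supports_def by blast
      then have "card (pos A) = 4" using card_pos[OF supports_subset[OF \<open>A \<in> supports 4\<close>]] by simp
      have "\<not> (\<forall>t\<in>pos B. (t + 6) mod 12 \<in> pos B)"
      proof
        assume "\<forall>t\<in>pos B. (t + 6) mod 12 \<in> pos B"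
        then have per: "(t + 6) mod 12 \<in> X" if "t \<in> X" for t
          using that periodic_A X by blast
        have X12: "X \<subseteq> {..<12}" unfolding X_def by (rule pos_subset)
        have "X = (X \<inter> {..<6}) \<union> (\<lambda>t. t + 6) ` (X \<inter> {..<6})" (is "X = ?Y")
        proof (rule Set.set_eqI)
          fix t show "t \<in> X \<longleftrightarrow> t \<in> ?Y"
          proof (cases "t < 6")
            case True
            then show ?thesis by auto
          next
            case False
            have "t \<in> X \<longleftrightarrow> t < 12 \<and> t - 6 \<in> X"
            proof
              assume t: "t \<in> X"
              then have "t < 12" using X12 by blast
              then have "(t + 6) mod 12 = t - 6" using False by presburger
              then show "t < 12 \<and> t - 6 \<in> X" using per[OF t] \<open>t < 12\<close> by simp
            next
              assume t: "t < 12 \<and> t - 6 \<in> X"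
              then show "t \<in> X" using per[of "t - 6"] False by simp
            qed
            moreover have "t \<in> ?Y \<longleftrightarrow> t - 6 \<in> X \<and> t - 6 < 6"
              using False by (auto simp: image_iff intro!: bexI[of _ "t - 6"])
            ultimately show ?thesis using False by auto
          qed
        qed
        then have "card X = card ?Y" by (rule arg_cong)
        also have "\<dots> = card (X \<inter> {..<6}) + card ((\<lambda>t. t + 6) ` (X \<inter> {..<6}))"
          using \<open>finite X\<close> by (intro card_Un_disjoint) auto
        also have "\<dots> = 2 * card (X \<inter> {..<6})" by (simp add: card_image)
        finally show False using \<open>card X = 3\<close> by presburger
      qed
      then have evB: "even (s + t)" if "s \<in> X" "t \<in> X" for s t
        using cases4[OF B(1)] that unfolding X by blast
      have near: "\<exists>s\<in>X. even (i + s)" if i: "i \<in> pos A" for i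
      proof (cases "i \<in> X")
        case False
        have "card (pos A - X) = 1"
          using \<open>card (pos A) = 4\<close> \<open>card X = 3\<close> \<open>finite X\<close> X by (subst card_Diff_subset) auto
        then obtain z where "pos A - X = {z}" using card_1_singletonE by blast
        moreover have "(i + 6) mod 12 \<noteq> i" by presburger
        moreover have "(i + 6) mod 12 \<in> pos A" using periodic_A i by blast
        ultimately have "(i + 6) mod 12 \<in> X" using False i by (metis Diff_iff singletonD)
        moreover have "even (i + (i + 6) mod 12)" by presburger
        ultimately show ?thesis by blast
      qed (auto intro!: bexI[of _ i])
      show ?thesis
      proof -
        obtain s t where "s \<in> X" "t \<in> X" "even (i + s)" "even (j + t)" using near ij by blast
        then show ?thesis using evB[of s t] by presburger
      qed
    qed
    obtain A where A: "A \<in> F" using False by blast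
    then have "card A = 4" unfolding F_def supports_def by blast
    then obtain a b where "a \<in> A" "b \<in> A" "a \<noteq> b" by (auto simp: numeral_eq_Suc card_Suc_eq)
    moreover have "A \<subseteq> S" if "A \<in> F" for A using that supports_subset unfolding F_def by blast
    ultimately show False using no_parity_family[OF A] F_inv parity by blast
  qed
qed

lemma card_moved_le_4:
  assumes "u \<in> H" "card (moved u) \<le> 4" shows "u = id"
proof (rule ccontr)
  assume "u \<noteq> id"
  then have "card (moved u) \<notin> {0, 1, 2, 3, 4}"
    using card_moved_pos card_moved_neq_1 card_moved_neq_2 card_moved_3[OF free] card_moved_neq_4 assms(1) by blast
  then show False using assms(2) by auto
qed

lemma card_moved_neq_5:
  assumes "u0 \<in> H" shows "card (moved u0) \<noteq> 5"
proof
  assume u0: "card (moved u0) = 5"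
  have parity: "even (i + j)" if A: "A \<in> supports 5" and ij: "i \<in> pos A" "j \<in> pos A" for A i j
  proof -
    obtain u where u: "u \<in> H" "A = moved u" "card (moved u) = 5"
      using A unfolding supports_def by blast
    have "card (pos A) = 5" using card_pos u moved_subset by simp
    moreover have "overlap (pos A) j \<noteq> 2" for j
      using overlap_pos[OF u(1), of j] moved_5_inter[OF u(1) _ u(3) _ card_moved_le_4] u by metis
    ultimately show ?thesis
      using five_subset_mod_12[OF pos_subset _ _ ij] overlap_neq_1[OF u(1)] u(2) by blast
  qed
  obtain a b where "a \<in> moved u0" "b \<in> moved u0" "a \<noteq> b"
    using u0 by (auto simp: numeral_eq_Suc card_Suc_eq)
  moreover have "moved u0 \<in> supports 5" using u0 assms unfolding supports_def by blast
  ultimately show False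
    using no_parity_family[of "moved u0" "supports 5"] supports_image supports_subset parity by blast
qed

lemma card_moved_le_5:
  assumes "u \<in> H" "card (moved u) \<le> 5" shows "u = id"
  using assms card_moved_le_4 card_moved_neq_5[OF assms(1)] by (cases "card (moved u) \<le> 4") auto

end

section \<open>A base of five points\<close>

context primitive_12_cycle
begin

text \<open>At least 5 points lie outside \<open>M\<close>. Five of them together with
  \<open>a\<close> and \<open>b\<close> form a set of size 7, and any support inside it meets
  \<open>M\<close> at most in \<open>a\<close> and \<open>b\<close>.\<close>

lemma ex_outside_pair:
  assumes "\<And>A. A \<subseteq> S \<Longrightarrow> card A = 7 \<Longrightarrow> \<exists>u\<in>H. u \<noteq> id \<and> moved u \<subseteq> A"
    and M: "M \<subseteq> S" "card M = 6 \<or> card M = 7" and ab: "a \<in> M" "b \<in> M" "a \<noteq> b"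
  obtains v where "v \<in> H" "v \<noteq> id" "moved v \<inter> M \<subseteq> {a, b}" "card (moved v - M) \<le> 5" "card (moved v) \<le> 7"
proof -
  have "finite M" using M(1) finite_S finite_subset by blast
  then have "card (S - M) \<ge> 5" using M card_S by (auto simp: card_Diff_subset)
  then obtain J where J: "J \<subseteq> S - M" "card J = 5" "finite J"
    using obtain_subset_with_card_n by metis
  have "card ({a, b} \<union> J) = 7"
  proof -
    have "{a, b} \<inter> J = {}" using J ab by blast
    then show ?thesis using J ab by (subst card_Un_disjoint) auto
  qed
  moreover have "{a, b} \<union> J \<subseteq> S" using J ab M by blast
  ultimately obtain v where v: "v \<in> H" "v \<noteq> id" "moved v \<subseteq> {a, b} \<union> J" using assms(1) by blast
  have "card (moved v - M) \<le> card J" using v(3) J ab by (intro card_mono) auto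
  moreover have "card (moved v) \<le> 7"
    using \<open>card ({a, b} \<union> J) = 7\<close> v(3) J(3) by (metis card_mono finite.emptyI finite_Un finite_insert)
  moreover have "moved v \<inter> M \<subseteq> {a, b}" using v(3) J(1) by blast
  ultimately show ?thesis using that v J(2) by simp
qed

text \<open>With two common points the commutator moves at most the six listed points; a single
  coincidence among them leaves a size at which no nontrivial element exists.\<close>

lemma commutator_small:
  assumes "u \<in> H" "v \<in> H" "moved u \<inter> moved v = {a, b}" "card {a, b, u a, u b, v a, v b} \<le> 5"
  shows "u \<circ> v \<circ> inv' u \<circ> inv' v = id"
proof (rule card_moved_le_5[OF commutator_mem])
  have "moved (u \<circ> v \<circ> inv' u \<circ> inv' v) \<subseteq> {a, b, u a, u b, v a, v b}"
    using moved_commutator_subset[OF assms(1,2) assms(3)[symmetric]] by auto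
  then have "card (moved (u \<circ> v \<circ> inv' u \<circ> inv' v)) \<le> card {a, b, u a, u b, v a, v b}"
    by (intro card_mono) auto
  with assms(4) show "card (moved (u \<circ> v \<circ> inv' u \<circ> inv' v)) \<le> 5" by linarith
qed fact+

text \<open>Otherwise every set of 7 points contains the support of a nontrivial element. If no
  support has size 6, choose two such elements whose supports share exactly two points: they
  commute, so one of them preserves an arbitrary pair in its support. If there is a support of size
  6, then all elements with such a support are involutions, but the commutator with a suitable
  second element is not.\<close>

lemma ex_base_5: "\<exists>B. is_base B \<and> card B = 5"
proof (cases "\<exists>A\<subseteq>S. card A = 7 \<and> (\<forall>u\<in>H. moved u \<subseteq> A \<longrightarrow> u = id)")
  case True
  then obtain A where A: "A \<subseteq> S" "card A = 7" "\<forall>u\<in>H. moved u \<subseteq> A \<longrightarrow> u = id" by blast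
  have "card (S - A) = 5" using A(1,2) card_S finite_S finite_subset by (subst card_Diff_subset) auto
  moreover have "h = id" if "h \<in> H" "\<forall>x\<in>S - A. h x = x" for h
  proof -
    have "moved h \<subseteq> A" using moved_subset[OF that(1)] that(2) unfolding moved_def by blast
    then show ?thesis using A(3) that(1) by blast
  qed
  ultimately show ?thesis unfolding is_base_def by blast
next
  case False
  then have ex: "\<exists>u\<in>H. u \<noteq> id \<and> moved u \<subseteq> A" if "A \<subseteq> S" "card A = 7" for A
    using that by blast
  have ge6: "6 \<le> card (moved v)" if "v \<in> H" "v \<noteq> id" for v
    using card_moved_le_5[OF that(1)] that(2) by (cases "card (moved v) \<le> 5") auto
  have False
  proof (cases "\<exists>u\<in>H. card (moved u) = 6")
    case False
    obtain A where A: "A \<subseteq> S" "card A = 7" using obtain_subset_with_card_n[of 7 S] card_S by auto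
    then obtain u where u: "u \<in> H" "u \<noteq> id" "moved u \<subseteq> A" using ex by blast
    have eq7: "moved v = X" if "v \<in> H" "v \<noteq> id" "moved v \<subseteq> X" "card X = 7" "finite X" for v X
    proof -
      have "card (moved v) \<noteq> 6" using False that(1) by blast
      then have "7 \<le> card (moved v)" using ge6[OF that(1,2)] by simp
      then show ?thesis using that by (metis card_seteq)
    qed
    have finA: "finite A" using A finite_S finite_subset by blast
    have mu: "moved u = A" using eq7 u A finA by blast
    obtain a where a: "a \<in> A" using A(2) by fastforce
    then have "u a \<in> A" "u a \<noteq> a" using moved_image_self[OF u(1)] mu unfolding moved_def by blast+
    have "card (A - {a, u a}) = 5" using a \<open>u a \<in> A\<close> \<open>u a \<noteq> a\<close> A(2) finA by simp
    \<comment> \<open>Because \<open>d\<close> differs from \<open>u a\<close>, the point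
      \<open>u a\<close> lies in \<open>A\<close> but outside \<open>{a, d}\<close>. So
      \<open>u\<close> cannot preserve a support that meets \<open>A\<close> in this pair.\<close>
    then obtain d where d: "d \<in> A" "d \<noteq> a" "d \<noteq> u a" by (metis DiffE card.empty equals0I insertI1 insertI2 zero_neq_numeral)
    obtain v where v: "v \<in> H" "v \<noteq> id" "moved v \<inter> A \<subseteq> {a, d}" "card (moved v - A) \<le> 5" "card (moved v) \<le> 7"
      using ex_outside_pair[OF ex A(1) _ a d(1)] A(2) d(2) by metis
    have "card (moved v) \<noteq> 6" using False v(1) by blast
    then have "card (moved v) = 7" using ge6[OF v(1,2)] v(5) by simp
    moreover have "card (moved v) = card (moved v \<inter> A) + card (moved v - A)"
      using finite_moved[OF v(1)] by (metis card_Int_Diff)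
    ultimately have "card {a, d} \<le> card (moved v \<inter> A)" using v(4) d by simp
    then have I: "moved v \<inter> A = {a, d}" using v(3) by (metis card_seteq finite.emptyI finite_insert)
    let ?w = "u \<circ> v \<circ> inv' u \<circ> inv' v"
    have "moved ?w \<subseteq> {a, d, u a, u d, v a, v d}"
    proof -
      have "{a, d} = moved u \<inter> moved v" using I mu by blast
      from moved_commutator_subset[OF u(1) v(1) this] show ?thesis by auto
    qed
    then have "card (moved ?w) \<le> card {a, d, u a, u d, v a, v d}" by (intro card_mono) auto
    also have "\<dots> \<le> 6" using card_length[of "[a, d, u a, u d, v a, v d]"] by simp
    finally have "card (moved ?w) \<le> 6" .
    then have "?w = id"
      using ge6[OF commutator_mem[OF u(1) v(1)]] False commutator_mem[OF u(1) v(1)]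
      by (metis le_antisym)
    then have "u a \<in> moved v" using commute_moved[OF u(1) v(1)] I by blast
    then show False using I \<open>u a \<in> A\<close> \<open>u a \<noteq> a\<close> d by blast
  next
    case True
    have outside: "\<exists>v. v \<in> H \<and> v \<noteq> id \<and> moved u \<inter> moved v = {a, b}"
      if u: "u \<in> H" "card (moved u) = 6" and ab: "a \<in> moved u" "b \<in> moved u" "a \<noteq> b" for u a b
    proof -
      obtain v where v: "v \<in> H" "v \<noteq> id" "moved v \<inter> moved u \<subseteq> {a, b}" "card (moved v - moved u) \<le> 5"
        using ex_outside_pair[OF ex moved_subset[OF u(1)] _ ab] u(2) by metis
      have "card (moved v) = card (moved v \<inter> moved u) + card (moved v - moved u)"
        using finite_moved[OF v(1)] by (metis card_Int_Diff)
      then have "moved u \<inter> moved v \<noteq> {}" using ge6[OF v(1,2)] v(4) by (auto simp: Int_commute)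
      moreover have "moved u \<inter> moved v \<noteq> {a}" "moved u \<inter> moved v \<noteq> {b}"
        using moved_inter_not_singleton[OF free u(1) v(1)] by auto
      ultimately have "moved u \<inter> moved v = {a, b}" using v(3) by blast
      then show ?thesis using v(1,2) by blast
    qed
    have invol: "u (u a) = a" if u: "u \<in> H" "card (moved u) = 6" for u a
    proof (rule ccontr)
      assume *: "u (u a) \<noteq> a"
      then have "u a \<noteq> a" by auto
      then have a: "a \<in> moved u" "u a \<in> moved u" using moved_image_self[OF u(1)] unfolding moved_def by auto
      obtain v where v: "v \<in> H" "v \<noteq> id" "moved u \<inter> moved v = {a, u a}"
        using outside[OF u a] \<open>u a \<noteq> a\<close> by metis
      \<comment> \<open>The pair is chosen as \<open>a\<close> and its image, so \<open>u a\<close>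
        is listed twice and the commutator is trivial.\<close>
      have "card {a, u a, u a, u (u a), v a, v (u a)} \<le> 5"
        using card_length[of "[a, u a, u (u a), v a, v (u a)]"] by simp
      then have "u \<circ> v \<circ> inv' u \<circ> inv' v = id" using commutator_small[OF u(1) v(1,3)] by blast
      then have "u (u a) \<in> moved v" using commute_moved[OF u(1) v(1)] v(3) by blast
      moreover have "u (u a) \<in> moved u" using a moved_image_self[OF u(1)] by blast
      ultimately have "u (u a) = u a" using v(3) * by blast
      then show False using inj_mem[OF u(1)] \<open>u a \<noteq> a\<close> by blast
    qed
    from True obtain u where u: "u \<in> H" "card (moved u) = 6" by blast
    then obtain a where a: "a \<in> moved u" by fastforce
    define a' where "a' = u a"
    have a': "a' \<in> moved u" "a' \<noteq> a" "u a' = a"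
      using a moved_image_self[OF u(1)] invol[OF u] unfolding a'_def moved_def by auto
    \<comment> \<open>\<open>b\<close> is taken off the 2-cycle of \<open>a\<close>, so that
      \<open>moved v\<close> omits \<open>a'\<close> and the two elements cannot commute.\<close>
    have "card (moved u - {a, a'}) = 4" using a a' u(2) finite_moved[OF u(1)] by simp
    then obtain b where b: "b \<in> moved u" "b \<noteq> a" "b \<noteq> a'" by (metis DiffE card.empty equals0I insertI1 insertI2 zero_neq_numeral)
    obtain v where v: "v \<in> H" "v \<noteq> id" "moved u \<inter> moved v = {a, b}"
      using outside[OF u a b(1)] b(2) by metis
    let ?w = "u \<circ> v \<circ> inv' u \<circ> inv' v"
    have wH: "?w \<in> H" using commutator_mem u v by blast
    have "?w \<noteq> id"
    proof
      assume "?w = id"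
      then have "a' \<in> moved v" using commute_moved[OF u(1) v(1)] v(3) a'_def by blast
      then show False using v(3) a' b by blast
    qed
    have sub: "moved ?w \<subseteq> {a, b, u a, u b, v a, v b}"
      using moved_commutator_subset[OF u(1) v(1) v(3)[symmetric]] by auto
    then have "card (moved ?w) \<le> card {a, b, u a, u b, v a, v b}" by (intro card_mono) auto
    also have "\<dots> \<le> 6" using card_length[of "[a, b, u a, u b, v a, v b]"] by simp
    finally have w6: "card (moved ?w) = 6" using ge6[OF wH \<open>?w \<noteq> id\<close>] by simp
    have notI: "\<not> card {a, b, u a, u b, v a, v b} \<le> 5"
      using commutator_small[OF u(1) v(1,3)] \<open>?w \<noteq> id\<close> by blast
    have va: "v a \<noteq> b"
    proof
      assume "v a = b"
      then have "{a, b, u a, u b, v a, v b} = set [a, b, u a, u b, v b]" by auto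
      then show False using notI card_length[of "[a, b, u a, u b, v b]"] by simp
    qed
    have vb: "v b \<noteq> a"
    proof
      assume "v b = a"
      then have "{a, b, u a, u b, v a, v b} = set [a, b, u a, u b, v a]" by auto
      then show False using notI card_length[of "[a, b, u a, u b, v a]"] by simp
    qed
    \<comment> \<open>The commutator \<open>?w\<close> has support of size 6, so it has to be an
      involution. But \<open>va\<close> puts \<open>p\<close> outside \<open>moved u\<close> and
      \<open>vb\<close> makes \<open>u\<close> fix \<open>r\<close>; then \<open>?w\<close> maps
      \<open>p\<close> to \<open>a\<close> and \<open>a\<close> to \<open>a'\<close>, which would
      force \<open>p = a'\<close>.\<close>
    define p where "p = v a"
    define r where "r = inv' v a"
    have vr: "v r = a" unfolding r_def using permutes_inverses[OF permutes[OF v(1)]] by simp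
    have mv: "a \<in> moved v" "b \<in> moved v" using v(3) by blast+
    have "p \<in> moved v" using moved_image_self[OF v(1)] mv unfolding p_def by blast
    moreover have "p \<noteq> a" using mv unfolding p_def moved_def by blast
    ultimately have p: "p \<notin> moved u" using v(3) va unfolding p_def by blast
    have "r \<in> moved v" using moved_image_self[OF v(1), of r] mv vr by simp
    moreover have "r \<noteq> a" using mv vr unfolding moved_def by blast
    moreover have "r \<noteq> b" using vr vb by blast
    ultimately have r: "u r = r" using v(3) unfolding moved_def by blast
    have va': "v a' = a'" using a' b v(3) unfolding moved_def by blast
    have inv: "inv' v p = a" "inv' u a = a'" "inv' v a = r" "inv' u r = r"
      using u(1) v(1) a' r vr inv_eq_iff unfolding p_def by auto
    have "?w p = a" using inv va' a' by simp
    moreover have "?w a = a'" using inv vr a'_def by simp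
    ultimately have "p = a'" using invol[OF wH w6, of p] by metis
    then show False using p a' by blast
  qed
  then show ?thesis ..
qed

end

section \<open>Permutations with at most three cycles\<close>

definition pts :: "nat set" where
  "pts = {1..12}"

lemma mem_pts: "x \<in> pts \<longleftrightarrow> 1 \<le> x \<and> x \<le> 12"
  by (simp add: pts_def)

lemma finite_pts: "finite pts" and card_pts: "card pts = 12"
  by (simp_all add: pts_def)

text \<open>For \<open>b < a\<close> this is the identity, which is how cycle types with fewer than
  three cycles are covered below.\<close>

definition cyc :: "nat \<Rightarrow> nat \<Rightarrow> nat \<Rightarrow> nat" where
  "cyc a b x = (if a \<le> x \<and> x \<le> b then if x = b then a else Suc x else x)"

lemma cyc_Suc: "a \<le> b \<Longrightarrow> cyc a (Suc b) = cyc a b \<circ> transpose b (Suc b)"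
  by (auto simp: fun_eq_iff cyc_def transpose_def)

lemma permutation_cyc: "a \<le> Suc b \<Longrightarrow> permutation (cyc a b) \<and> (evenperm (cyc a b) \<longleftrightarrow> a = Suc b \<or> even (b - a))"
proof (induction b)
  case 0
  have "cyc a 0 = id" by (auto simp: cyc_def fun_eq_iff)
  then show ?case by simp
next
  case (Suc b)
  show ?case
  proof (cases "a \<le> b")
    case True
    with Suc have "permutation (cyc a b)" "evenperm (cyc a b) \<longleftrightarrow> even (b - a)" by auto
    have "permutation (cyc a (Suc b))"
      unfolding cyc_Suc[OF True]
      by (intro permutation_compose permutation_swap_id \<open>permutation (cyc a b)\<close>)
    moreover have "evenperm (cyc a (Suc b)) \<longleftrightarrow> odd (b - a)"
      unfolding cyc_Suc[OF True] evenperm_comp[OF \<open>permutation (cyc a b)\<close> permutation_swap_id]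
      using \<open>evenperm (cyc a b) \<longleftrightarrow> even (b - a)\<close> by (simp add: evenperm_swap)
    ultimately show ?thesis using True by (simp add: Suc_diff_le)
  next
    case False
    then have "cyc a (Suc b) = id" by (auto simp: cyc_def fun_eq_iff)
    then show ?thesis using False Suc.prems by auto
  qed
qed

text \<open>With consecutive intervals as cycles, orbits, periods and invariant sets reduce to
  comparing numbers with \<open>i\<close> and \<open>j\<close>.\<close>

definition cyc3 :: "nat \<Rightarrow> nat \<Rightarrow> nat \<Rightarrow> nat" where
  "cyc3 i j = cyc 1 i \<circ> cyc (Suc i) j \<circ> cyc (Suc j) 12"

lemma cyc3_apply:
  assumes "i \<le> j" "j \<le> 12"
  shows "cyc3 i j x = (if x = 0 \<or> 12 < x then x else if x \<le> i then if x = i then 1 else Suc x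
    else if x \<le> j then if x = j then Suc i else Suc x else if x = 12 then Suc j else Suc x)"
  using assms by (auto simp: cyc3_def cyc_def)

lemma orb_interval:
  assumes "g permutes S" "finite S" "\<And>y. a \<le> y \<Longrightarrow> y < b \<Longrightarrow> g y = Suc y" "g b = a" "x \<in> {a..b}"
  shows "orb g x = {a..b}"
proof -
  have "g ` {a..b} \<subseteq> {a..b}"
  proof clarify
    fix y assume "y \<in> {a..b}"
    then show "g y \<in> {a..b}" using assms(3)[of y] assms(4) by (cases "y = b") auto
  qed
  then have sub: "orb g a \<subseteq> {a..b}"
    using assms(5) by (intro orb_subset[OF assms(1,2)]) auto
  have *: "(g ^^ k) a = a + k" if "k \<le> b - a" for k
    using that assms(5) by (induction k) (auto simp: assms(3))
  then have "y \<in> orb g a" if "y \<in> {a..b}" for y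
  proof -
    have "(g ^^ (y - a)) a = y" using *[of "y - a"] that by (simp add: diff_le_mono)
    then show ?thesis using funpow_in_orb[where p = g and k = "y - a" and x = a] by simp
  qed
  then have "orb g a = {a..b}" using sub by blast
  then show ?thesis using orb_eq[OF assms(1,2)] assms(5) by metis
qed

context
  fixes i j :: nat
  assumes ij: "i \<le> j" "j \<le> 12"
begin

lemma cyc3_permutes: "cyc3 i j permutes pts"
proof (rule bij_imp_permutes)
  have "inj_on (cyc3 i j) pts"
    using ij by (auto simp: inj_on_def cyc3_apply mem_pts split: if_splits)
  moreover have "cyc3 i j ` pts \<subseteq> pts"
    using ij by (auto simp: cyc3_apply mem_pts)
  ultimately show "bij_betw (cyc3 i j) pts pts"
    by (metis bij_betw_def endo_inj_surj finite_pts)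
  show "cyc3 i j x = x" if "x \<notin> pts" for x
    using that ij by (auto simp: cyc3_apply mem_pts)
qed

lemma orb_cyc3:
  assumes "x \<in> pts"
  shows "orb (cyc3 i j) x = (if x \<le> i then {1..i} else if x \<le> j then {Suc i..j} else {Suc j..12})"
proof -
  note * = orb_interval[OF cyc3_permutes finite_pts]
  show ?thesis
    using assms ij *[of 1 i x] *[of "Suc i" j x] *[of "Suc j" 12 x]
    by (auto simp: mem_pts cyc3_apply)
qed

definition cyc_len :: "nat \<Rightarrow> nat" where
  "cyc_len x = (if x \<le> i then i else if x \<le> j then j - i else 12 - j)"

lemma least_power_cyc3: "x \<in> pts \<Longrightarrow> least_power (cyc3 i j) x = cyc_len x"
  using card_orb[OF cyc3_permutes finite_pts, of x] orb_cyc3[of x] by (auto simp: cyc_len_def)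

lemma funpow_cyc3_eq_iff: "x \<in> pts \<Longrightarrow> (cyc3 i j ^^ n) x = x \<longleftrightarrow> cyc_len x dvd n"
  using funpow_eq_iff_least_power[OF cyc3_permutes finite_pts] least_power_cyc3 by metis

text \<open>A cycle of length \<open>n\<close> has the parity of \<open>n - 1\<close>; truncated
  subtraction gives an empty cycle the value 0, as the identity requires.\<close>

lemma cyc3_evenperm: "evenperm (cyc3 i j) \<longleftrightarrow> even ((i - 1) + (j - i - 1) + (12 - j - 1))"
proof -
  have p: "permutation (cyc 1 i)" "permutation (cyc (Suc i) j)" "permutation (cyc (Suc j) 12)"
    using permutation_cyc ij by auto
  have "evenperm (cyc3 i j) \<longleftrightarrow> (evenperm (cyc 1 i) = evenperm (cyc (Suc i) j)) = evenperm (cyc (Suc j) 12)"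
    unfolding cyc3_def using p by (simp add: evenperm_comp permutation_compose)
  moreover have "evenperm (cyc 1 i) \<longleftrightarrow> even (i - 1)"
    using permutation_cyc[of 1 i] by auto
  moreover have "evenperm (cyc (Suc i) j) \<longleftrightarrow> even (j - i - 1)"
    using permutation_cyc[of "Suc i" j] ij by auto
  moreover have "evenperm (cyc (Suc j) 12) \<longleftrightarrow> even (12 - j - 1)"
    using permutation_cyc[of "Suc j" 12] ij by auto
  ultimately show ?thesis by auto
qed

definition sel :: "bool \<times> bool \<times> bool \<Rightarrow> nat set" where
  "sel = (\<lambda>(p, q, r). (if p then {1..i} else {}) \<union> (if q then {Suc i..j} else {}) \<union> (if r then {Suc j..12} else {}))"

definition sel_card :: "bool \<times> bool \<times> bool \<Rightarrow> nat" where
  "sel_card = (\<lambda>(p, q, r). (if p then i else 0) + (if q then j - i else 0) + (if r then 12 - j else 0))"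

text \<open>Choices of cycles are counted, not the resulting sets: an empty cycle doubles the count.
  Only an upper bound is drawn from it.\<close>

definition sel_count :: "nat \<Rightarrow> nat" where
  "sel_count k = length (filter (\<lambda>t. sel_card t = k)
     [(True, True, True), (True, True, False), (True, False, True), (True, False, False),
      (False, True, True), (False, True, False), (False, False, True), (False, False, False)])"

lemma card_sel: "card (sel t) = sel_card t"
proof -
  obtain p q r where t: "t = (p, q, r)" using prod_cases3 by blast
  have "{1..i} \<inter> {Suc i..j} = {}" "({1..i} \<union> {Suc i..j}) \<inter> {Suc j..12} = {}"
    "{1..i} \<inter> {Suc j..12} = {}" "{Suc i..j} \<inter> {Suc j..12} = {}" using ij by auto
  then show ?thesis unfolding t sel_def sel_card_def
    by (cases p; cases q; cases r) (simp_all add: card_Un_disjoint)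
qed

lemma invariant_eq_sel:
  assumes "B \<subseteq> pts" "cyc3 i j ` B = B"
  obtains t where "B = sel t"
proof -
  have "orb (cyc3 i j) x \<subseteq> B" if "x \<in> B" for x
    using orb_subset[OF cyc3_permutes finite_pts] assms(2) that by blast
  then have *: "(if x \<le> i then {1..i} else if x \<le> j then {Suc i..j} else {Suc j..12}) \<subseteq> B" if "x \<in> B" for x
    using orb_cyc3 assms(1) that by blast
  have 1: "{1..i} \<subseteq> B" if "x \<in> B" "x \<le> i" for x using *[of x] that by simp
  have 2: "{Suc i..j} \<subseteq> B" if "x \<in> B" "i < x" "x \<le> j" for x using *[of x] that by simp
  have 3: "{Suc j..12} \<subseteq> B" if "x \<in> B" "j < x" for x using *[of x] that ij by simp
  have "x \<in> B \<longleftrightarrow> x \<in> sel (\<exists>x\<in>B. x \<le> i, \<exists>x\<in>B. i < x \<and> x \<le> j, \<exists>x\<in>B. j < x)" for x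
  proof
    assume "x \<in> B"
    then have "x \<in> pts" using assms(1) by blast
    then show "x \<in> sel (\<exists>x\<in>B. x \<le> i, \<exists>x\<in>B. i < x \<and> x \<le> j, \<exists>x\<in>B. j < x)"
      using \<open>x \<in> B\<close> unfolding sel_def mem_pts
      by (cases "x \<le> i"; cases "x \<le> j") auto
  next
    assume "x \<in> sel (\<exists>x\<in>B. x \<le> i, \<exists>x\<in>B. i < x \<and> x \<le> j, \<exists>x\<in>B. j < x)"
    then consider "\<exists>x\<in>B. x \<le> i" "x \<in> {1..i}" | "\<exists>x\<in>B. i < x \<and> x \<le> j" "x \<in> {Suc i..j}"
      | "\<exists>x\<in>B. j < x" "x \<in> {Suc j..12}"
      unfolding sel_def by (auto split: if_splits)
    then show "x \<in> B"
      by cases (use 1 2 3 in blast)+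
  qed
  then show ?thesis using that by blast
qed

lemma card_invariant_sets:
  "card {B. B \<subseteq> pts \<and> cyc3 i j ` B = B \<and> card B = k} \<le> sel_count k"
proof -
  let ?l = "filter (\<lambda>t. sel_card t = k)
     [(True, True, True), (True, True, False), (True, False, True), (True, False, False),
      (False, True, True), (False, True, False), (False, False, True), (False, False, False)]"
  have "t \<in> set ?l" if "sel_card t = k" for t
  proof -
    obtain p q r where t: "t = (p, q, r)" using prod_cases3 by blast
    show ?thesis using that unfolding t by (cases p; cases q; cases r) simp_all
  qed
  then have "{B. B \<subseteq> pts \<and> cyc3 i j ` B = B \<and> card B = k} \<subseteq> sel ` set ?l"
    using invariant_eq_sel card_sel by (smt (verit) image_iff mem_Collect_eq subsetI)
  then have "card {B. B \<subseteq> pts \<and> cyc3 i j ` B = B \<and> card B = k} \<le> card (sel ` set ?l)"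
    by (intro card_mono) auto
  also have "\<dots> \<le> card (set ?l)" by (intro card_image_le) auto
  also have "\<dots> \<le> length ?l" by (rule card_length)
  finally show ?thesis unfolding sel_count_def .
qed

end

section \<open>Conjugators and centralizers\<close>

lemma card_permutes_fixing_set:
  assumes "finite S" "A \<subseteq> S"
  shows "card {p. p permutes S \<and> p ` A = A} \<le> fact (card A) * fact (card S - card A)"
proof -
  let ?f = "\<lambda>p. (\<lambda>x. if x \<in> A then p x else x, \<lambda>x. if x \<in> S - A then p x else x)"
  let ?T = "{p. p permutes A} \<times> {p. p permutes (S - A)}"
  have finA: "finite A" using assms finite_subset by blast
  have restr: "(\<lambda>x. if x \<in> B then p x else x) permutes B" if "inj p" "p ` B = B" for p :: "'a \<Rightarrow> 'a" and B
  proof (rule bij_imp_permutes)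
    have "inj_on p B" using that(1) by (rule inj_on_subset) simp
    then have "bij_betw p B B" using that(2) by (simp add: bij_betw_def)
    then show "bij_betw (\<lambda>x. if x \<in> B then p x else x) B B"
      using bij_betw_cong[of B "\<lambda>x. if x \<in> B then p x else x" p B] by simp
  qed simp
  have "inj_on ?f {p. p permutes S \<and> p ` A = A}"
  proof (rule inj_onI)
    fix p q assume pq: "p \<in> {p. p permutes S \<and> p ` A = A}" "q \<in> {p. p permutes S \<and> p ` A = A}" "?f p = ?f q"
    show "p = q"
    proof
      fix x
      have "(if x \<in> A then p x else x) = (if x \<in> A then q x else x)"
        "(if x \<in> S - A then p x else x) = (if x \<in> S - A then q x else x)"
      proof -
        have "fst (?f p) x = fst (?f q) x" "snd (?f p) x = snd (?f q) x" unfolding pq(3) by (rule refl)+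
        then show "(if x \<in> A then p x else x) = (if x \<in> A then q x else x)"
          "(if x \<in> S - A then p x else x) = (if x \<in> S - A then q x else x)" by simp_all
      qed
      moreover have "p x = x \<and> q x = x" if "x \<notin> S"
        using that pq(1,2) permutes_not_in[of p S x] permutes_not_in[of q S x] by simp
      ultimately show "p x = q x" by (cases "x \<in> S"; cases "x \<in> A") simp_all
    qed
  qed
  moreover have "?f ` {p. p permutes S \<and> p ` A = A} \<subseteq> ?T"
  proof (rule image_subsetI)
    fix p assume "p \<in> {p. p permutes S \<and> p ` A = A}"
    then have p: "p permutes S" "p ` A = A" by simp_all
    have "p ` (S - A) = S - A"
      using image_set_diff[OF permutes_inj[OF p(1)], of S A] permutes_image[OF p(1)] p(2) by simp
    from restr[OF permutes_inj[OF p(1)] this] restr[OF permutes_inj[OF p(1)] p(2)]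
    show "?f p \<in> ?T" by (simp only: mem_Sigma_iff mem_Collect_eq simp_thms)
  qed
  moreover have "finite ?T" using finA assms(1) by (simp add: finite_permutations)
  ultimately have "card {p. p permutes S \<and> p ` A = A} \<le> card ?T"
    using card_inj_on_le by blast
  also have "\<dots> = fact (card A) * fact (card S - card A)"
    using finA assms by (simp add: card_cartesian_product card_permutations[OF refl] card_Diff_subset)
  finally show ?thesis .
qed

text \<open>In both uses \<open>X\<close>, if nonempty, is a left coset of the group
  \<open>Y\<close>: the permutations mapping one set to another, or those conjugating
  \<open>g\<close> to a given \<open>h\<close>.\<close>

lemma card_le_translate:
  assumes "finite Y" "\<And>p q. p \<in> X \<Longrightarrow> q \<in> X \<Longrightarrow> inv' p \<circ> q \<in> Y" "\<And>p. p \<in> X \<Longrightarrow> bij p"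
  shows "card X \<le> card Y"
proof (cases "X = {}")
  case False
  then obtain p where p: "p \<in> X" by blast
  have "inj_on (\<lambda>q. inv' p \<circ> q) X"
  proof (rule inj_onI)
    fix q r assume *: "inv' p \<circ> q = inv' p \<circ> r"
    have "inj (inv' p)" using assms(3)[OF p] by (simp add: bij_imp_bij_inv bij_is_inj)
    then have "q y = r y" for y using fun_cong[OF *, of y] by (simp add: inj_eq)
    then show "q = r" by blast
  qed
  then show ?thesis using assms(1,2) p by (intro card_inj_on_le[of "\<lambda>q. inv' p \<circ> q"]) auto
qed simp

lemma card_permutes_image:
  assumes "finite S" "A \<subseteq> S"
  shows "card {p. p permutes S \<and> p ` A = B} \<le> fact (card A) * fact (card S - card A)"
proof -
  have "card {p. p permutes S \<and> p ` A = B} \<le> card {p. p permutes S \<and> p ` A = A}"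
  proof (rule card_le_translate)
    fix p q assume pq: "p \<in> {p. p permutes S \<and> p ` A = B}" "q \<in> {p. p permutes S \<and> p ` A = B}"
    have "(inv' p \<circ> q) ` A = inv' p ` q ` A" by (rule image_comp[symmetric])
    also have "\<dots> = inv' p ` p ` A" using pq by simp
    also have "\<dots> = A"
    proof -
      have "inj p" using pq permutes_inj by blast
      then show ?thesis by (rule image_inv_f_f)
    qed
    finally show "inv' p \<circ> q \<in> {p. p permutes S \<and> p ` A = A}"
      using pq by (simp add: permutes_compose permutes_inv)
  next
    show "finite {p. p permutes S \<and> p ` A = A}"
      using finite_permutations[OF assms(1)] by (rule rev_finite_subset) blast
  qed (auto dest: permutes_bij)
  then show ?thesis using card_permutes_fixing_set[OF assms] by linarith
qed

lemma card_permutes_image_in: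
  assumes "finite S" "A \<subseteq> S" "finite \<B>"
  shows "card {p. p permutes S \<and> p ` A \<in> \<B>} \<le> card \<B> * (fact (card A) * fact (card S - card A))"
proof -
  have "{p. p permutes S \<and> p ` A \<in> \<B>} = (\<Union>B\<in>\<B>. {p. p permutes S \<and> p ` A = B})" by blast
  then have "card {p. p permutes S \<and> p ` A \<in> \<B>} \<le> (\<Sum>B\<in>\<B>. card {p. p permutes S \<and> p ` A = B})"
    by (simp only:) (rule card_UN_le[OF assms(3)])
  also have "\<dots> \<le> (\<Sum>B\<in>\<B>. fact (card A) * fact (card S - card A))"
    by (intro sum_mono card_permutes_image assms)
  finally show ?thesis by simp
qed

text \<open>For \<open>g\<close> permuting \<open>pts\<close>, the size of this set divided by 12!
  is the fraction of the conjugacy class of \<open>g\<close> that lies in \<open>H\<close>.\<close>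

definition conjugators :: "(nat \<Rightarrow> nat) \<Rightarrow> (nat \<Rightarrow> nat) set \<Rightarrow> (nat \<Rightarrow> nat) set" where
  "conjugators g H = {x. x permutes pts \<and> x \<circ> g \<circ> inv' x \<in> H}"

definition conjugates_in :: "(nat \<Rightarrow> nat) \<Rightarrow> (nat \<Rightarrow> nat) set \<Rightarrow> (nat \<Rightarrow> nat) set" where
  "conjugates_in g H = {h \<in> H. \<exists>x. x permutes pts \<and> h = x \<circ> g \<circ> inv' x}"

definition centralizer :: "(nat \<Rightarrow> nat) \<Rightarrow> (nat \<Rightarrow> nat) set" where
  "centralizer g = {y. y permutes pts \<and> y \<circ> g = g \<circ> y}"

lemma finite_permutes_pts: "finite {x. x permutes pts}"
  using finite_permutations finite_pts by blast

lemma finite_conjugators: "finite (conjugators g H)"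
  unfolding conjugators_def using finite_permutes_pts by (rule rev_finite_subset) blast

lemma finite_centralizer: "finite (centralizer g)"
  unfolding centralizer_def using finite_permutes_pts by (rule rev_finite_subset) blast

text \<open>The nonempty fibres of the map from \<open>x\<close> to the conjugate of
  \<open>g\<close> by \<open>x\<close> are cosets of the centralizer.\<close>

lemma card_conjugators_le_centralizer:
  assumes "finite H"
  shows "card (conjugators g H) \<le> card (conjugates_in g H) * card (centralizer g)"
proof -
  have fin: "finite (conjugates_in g H)" using assms unfolding conjugates_in_def by simp
  have "conjugators g H = (\<Union>h\<in>conjugates_in g H. {x. x permutes pts \<and> x \<circ> g \<circ> inv' x = h})"
    unfolding conjugators_def conjugates_in_def by auto
  then have "card (conjugators g H) \<le> (\<Sum>h\<in>conjugates_in g H. card {x. x permutes pts \<and> x \<circ> g \<circ> inv' x = h})"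
    by (simp only:) (rule card_UN_le[OF fin])
  also have "\<dots> \<le> (\<Sum>h\<in>conjugates_in g H. card (centralizer g))"
  proof (rule sum_mono)
    fix h
    show "card {x. x permutes pts \<and> x \<circ> g \<circ> inv' x = h} \<le> card (centralizer g)"
    proof (rule card_le_translate[OF finite_centralizer])
      fix p q assume pq: "p \<in> {x. x permutes pts \<and> x \<circ> g \<circ> inv' x = h}" "q \<in> {x. x permutes pts \<and> x \<circ> g \<circ> inv' x = h}"
      then have inv: "inv' p (p y) = y" "p (inv' p y) = y" "inv' q (q y) = y" for y
        using permutes_inverses[of p pts] permutes_inverses[of q pts] by simp_all
      have "p \<circ> g \<circ> inv' p = q \<circ> g \<circ> inv' q" using pq by simp
      from fun_cong[OF this] have eq: "p (g (inv' p z)) = q (g (inv' q z))" for z by simp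
      have "p (g (inv' p (q y))) = q (g y)" for y using eq[of "q y"] inv by simp
      then have "g (inv' p (q y)) = inv' p (q (g y))" for y using inv by metis
      then show "inv' p \<circ> q \<in> centralizer g"
        using pq unfolding centralizer_def by (auto simp: fun_eq_iff permutes_compose permutes_inv)
    qed (auto dest: permutes_bij)
  qed
  finally show ?thesis by simp
qed

lemma conjugator_funpow:
  fixes x :: "'a \<Rightarrow> 'a"
  assumes "bij x" shows "(x \<circ> g \<circ> inv' x) ^^ n = x \<circ> g ^^ n \<circ> inv' x"
proof (induction n)
  case 0
  show ?case using assms by (simp add: bij_is_surj surj_iff[THEN iffD1])
next
  case (Suc n)
  have "inv' x (x y) = y" for y using assms by (simp add: bij_is_inj)
  then show ?case using Suc by (simp add: fun_eq_iff)
qed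

lemma moved_conjugate:
  fixes x :: "'a \<Rightarrow> 'a"
  assumes "bij x" shows "moved (x \<circ> g \<circ> inv' x) = x ` moved g"
proof -
  have inv: "inv' x (x y) = y" "x (inv' x y) = y" for y
    using assms by (simp_all add: bij_is_inj bij_is_surj surj_f_inv_f)
  have "y \<in> moved (x \<circ> g \<circ> inv' x) \<longleftrightarrow> inv' x y \<in> moved g" for y
    unfolding moved_def using inv by (simp, metis)
  moreover have "inv' x y \<in> moved g \<longleftrightarrow> y \<in> x ` moved g" for y
    using inv by (metis imageE imageI)
  ultimately show ?thesis by blast
qed

lemma card_moved_conjugate:
  fixes x :: "'a \<Rightarrow> 'a"
  assumes "bij x" shows "card (moved (x \<circ> g \<circ> inv' x)) = card (moved g)"
  unfolding moved_conjugate[OF assms]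
  by (rule card_image) (meson assms bij_is_inj inj_on_subset subset_UNIV)

lemma centralizer_funpow:
  assumes "w \<in> centralizer g" shows "w ((g ^^ n) a) = (g ^^ n) (w a)"
proof (induction n)
  case (Suc n)
  have "w (g v) = g (w v)" for v using assms unfolding centralizer_def by (auto dest: fun_cong)
  then show ?case using Suc by simp
qed simp

lemma centralizer_eqI:
  assumes "y \<in> centralizer g" "z \<in> centralizer g" "y a = z a" "b \<in> orb g a"
  shows "y b = z b"
proof -
  obtain k where "b = (g ^^ k) a" using assms(4) unfolding orb_def by blast
  then show ?thesis
    using centralizer_funpow[OF assms(1)] centralizer_funpow[OF assms(2)] assms(3) by metis
qed

text \<open>If \<open>y\<close> commutes with the permutation, \<open>y a\<close> returns to itself
  after \<open>n\<close> steps exactly when \<open>a\<close> does.\<close>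

lemma centralizer_cyc_len:
  assumes ij: "i \<le> j" "j \<le> 12" and y: "y \<in> centralizer (cyc3 i j)" and a: "a \<in> pts"
  shows "y a \<in> pts" "cyc_len i j (y a) = cyc_len i j a"
proof -
  have perm: "y permutes pts" using y unfolding centralizer_def by blast
  show ya: "y a \<in> pts" using a perm permutes_in_image by metis
  have "cyc_len i j (y a) dvd n \<longleftrightarrow> cyc_len i j a dvd n" for n
  proof -
    have "cyc_len i j (y a) dvd n \<longleftrightarrow> y ((cyc3 i j ^^ n) a) = y a"
      using funpow_cyc3_eq_iff[OF ij ya] centralizer_funpow[OF y] by metis
    also have "\<dots> \<longleftrightarrow> (cyc3 i j ^^ n) a = a"
      using permutes_inj[OF perm] by (simp add: inj_eq)
    also have "\<dots> \<longleftrightarrow> cyc_len i j a dvd n" by (rule funpow_cyc3_eq_iff[OF ij a])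
    finally show ?thesis .
  qed
  then show "cyc_len i j (y a) = cyc_len i j a" by (meson dvd_antisym dvd_refl)
qed

text \<open>The parameters of \<^const>\<open>cyc3\<close> are the ends of the first two cycles; empty cycles
  occur in the first and the last of these five permutations.\<close>

abbreviation "g12 \<equiv> cyc3 12 12"
abbreviation "g345 \<equiv> cyc3 3 7"
abbreviation "g255 \<equiv> cyc3 2 7"
abbreviation "g147 \<equiv> cyc3 1 5"
abbreviation "g57 \<equiv> cyc3 5 5"

lemma centralizer_ext:
  assumes "y \<in> centralizer g" "z \<in> centralizer g" "\<And>b. b \<in> pts \<Longrightarrow> \<exists>a\<in>A. b \<in> orb g a"
    "\<And>a. a \<in> A \<Longrightarrow> y a = z a"
  shows "y = z"
proof
  fix b
  show "y b = z b"
  proof (cases "b \<in> pts")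
    case True
    then obtain a where "a \<in> A" "b \<in> orb g a" using assms(3) by blast
    then show ?thesis using centralizer_eqI[OF assms(1,2) assms(4)] by blast
  next
    case False
    have "y permutes pts" "z permutes pts" using assms(1,2) unfolding centralizer_def by blast+
    then show ?thesis using permutes_not_in[OF _ False] by metis
  qed
qed

text \<open>\<open>A\<close> meets every cycle of \<open>g\<close>. A centralizing permutation is
  determined by its values on \<open>A\<close>, and \<open>f\<close> records enough of them.\<close>

lemma card_centralizer_le:
  assumes "finite T" "\<And>y. y \<in> centralizer g \<Longrightarrow> f y \<in> T"
    and "\<And>y z. y \<in> centralizer g \<Longrightarrow> z \<in> centralizer g \<Longrightarrow> f y = f z \<Longrightarrow> \<forall>a\<in>A. y a = z a"
    and "\<forall>b\<in>pts. \<exists>a\<in>A. b \<in> orb g a"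
  shows "card (centralizer g) \<le> card T"
proof (rule card_inj_on_le[where f = f])
  show "inj_on f (centralizer g)"
  proof (rule inj_onI)
    fix y z assume yz: "y \<in> centralizer g" "z \<in> centralizer g" "f y = f z"
    show "y = z"
      by (rule centralizer_ext[OF yz(1,2), where A = A])
        (use assms(4) assms(3)[OF yz] in simp_all)
  qed
  show "f ` centralizer g \<subseteq> T" using assms(2) by (rule image_subsetI)
qed fact

declare One_nat_def [simp del]

lemma card_centralizer_g12: "card (centralizer g12) \<le> 12"
proof -
  have "card (centralizer g12) \<le> card pts"
  proof (rule card_centralizer_le[where f = "\<lambda>y. y 1" and A = "{1}"])
    show "y 1 \<in> pts" if "y \<in> centralizer g12" for y
      using centralizer_cyc_len(1)[OF _ _ that, of 1] by (simp add: mem_pts)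
  qed (auto simp: finite_pts orb_cyc3 mem_pts)
  then show ?thesis by (simp add: card_pts)
qed

lemma card_centralizer_g147: "card (centralizer g147) \<le> 28"
proof -
  have y: "y 1 = 1" "y 2 \<in> {2..5}" "y 6 \<in> {6..12}" if "y \<in> centralizer g147" for y
    using centralizer_cyc_len[OF _ _ that, of 1] centralizer_cyc_len[OF _ _ that, of 2]
      centralizer_cyc_len[OF _ _ that, of 6] by (auto simp: cyc_len_def mem_pts split: if_splits)
  have "card (centralizer g147) \<le> card ({2..5::nat} \<times> {6..12::nat})"
  proof (rule card_centralizer_le[where f = "\<lambda>y. (y 2, y 6)" and A = "{1, 2, 6}"])
    show "\<forall>b\<in>pts. \<exists>a\<in>{1, 2, 6}. b \<in> orb g147 a" by (auto simp: orb_cyc3 mem_pts)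
    show "\<forall>a\<in>{1, 2, 6}. v a = w a"
      if "v \<in> centralizer g147" "w \<in> centralizer g147" "(v 2, v 6) = (w 2, w 6)" for v w
      using y(1)[OF that(1)] y(1)[OF that(2)] that(3) by simp
  qed (use y in auto)
  then show ?thesis by simp
qed

lemma card_centralizer_g57: "card (centralizer g57) \<le> 35"
proof -
  have y: "y 1 \<in> {1..5}" "y 6 \<in> {6..12}" if "y \<in> centralizer g57" for y
    using centralizer_cyc_len[OF _ _ that, of 1] centralizer_cyc_len[OF _ _ that, of 6]
    by (auto simp: cyc_len_def mem_pts split: if_splits)
  have "card (centralizer g57) \<le> card ({1..5::nat} \<times> {6..12::nat})"
  proof (rule card_centralizer_le[where f = "\<lambda>y. (y 1, y 6)" and A = "{1, 6}"])
    show "\<forall>b\<in>pts. \<exists>a\<in>{1, 6}. b \<in> orb g57 a" by (auto simp: orb_cyc3 mem_pts)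
  qed (use y in auto)
  then show ?thesis by simp
qed

lemma card_centralizer_g255: "card (centralizer g255) \<le> 100"
proof -
  \<comment> \<open>For a point \<open>a\<close> of the two 5-cycles this is the 5-cycle that does
    not contain it. Distinct 5-cycles go to distinct 5-cycles, so there are 2 * 10 * 5
    choices.\<close>
  define other :: "nat \<Rightarrow> nat set" where "other a = (if a \<le> 7 then {8..12} else {3..7})" for a
  have y: "y 1 \<in> {1, 2}" "y 3 \<in> {3..12}" "y 8 \<in> {3..12}" if "y \<in> centralizer g255" for y
    using centralizer_cyc_len[OF _ _ that, of 1] centralizer_cyc_len[OF _ _ that, of 3]
      centralizer_cyc_len[OF _ _ that, of 8] by (auto simp: cyc_len_def mem_pts split: if_splits)
  have y8: "y 8 \<in> other (y 3)" if C: "y \<in> centralizer g255" for y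
  proof (rule ccontr)
    assume no: "y 8 \<notin> other (y 3)"
    have "y 3 \<in> pts" using y(2)[OF C] by (simp add: mem_pts)
    then have "y 8 \<in> orb g255 (y 3)"
      using no y(2,3)[OF C] by (auto simp: orb_cyc3 other_def split: if_splits)
    then obtain k where "y 8 = (g255 ^^ k) (y 3)" unfolding orb_def by blast
    also have "\<dots> = y ((g255 ^^ k) 3)" by (rule centralizer_funpow[OF C, symmetric])
    finally have eq: "y 8 = y ((g255 ^^ k) 3)" .
    have "inj y" using C permutes_inj unfolding centralizer_def by blast
    from injD[OF this eq] have "8 \<in> orb g255 3" unfolding orb_def by (rule range_eqI)
    then show False by (simp add: orb_cyc3 mem_pts)
  qed
  have "card (centralizer g255) \<le> card ({1, 2::nat} \<times> (SIGMA a:{3..12}. other a))"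
  proof (rule card_centralizer_le[where f = "\<lambda>y. (y 1, y 3, y 8)" and A = "{1, 3, 8}"])
    show "\<forall>b\<in>pts. \<exists>a\<in>{1, 3, 8}. b \<in> orb g255 a" by (auto simp: orb_cyc3 mem_pts)
    show "finite ({1, 2::nat} \<times> (SIGMA a:{3..12}. other a))" by (auto simp: other_def)
    show "(y 1, y 3, y 8) \<in> {1, 2} \<times> (SIGMA a:{3..12}. other a)" if "y \<in> centralizer g255" for y
      using y(1,2)[OF that] y8[OF that] by simp
  qed auto
  also have "\<dots> = 100"
  proof -
    have "card (other a) = 5" "finite (other a)" for a by (simp_all add: other_def)
    then show ?thesis by (simp add: card_cartesian_product card_SigmaI)
  qed
  finally show ?thesis .
qed

text \<open>The coefficients are the numbers of members of the five families in the optimal cover.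
  Normalising by the number of conjugating permutations avoids the sizes of the conjugacy classes.\<close>

definition weight :: "(nat \<Rightarrow> nat) set \<Rightarrow> nat" where
  "weight H = 462 * card (conjugators g12 H) + 220 * card (conjugators g345 H)
     + 66 * card (conjugators g255 H) + 12 * card (conjugators g147 H) + card (conjugators g57 H)"

section \<open>Intransitive groups\<close>

lemma inj_on_inv_permutes: "inj_on inv' {x. x permutes pts}"
proof (rule inj_onI)
  fix x y :: "nat \<Rightarrow> nat"
  assume "x \<in> {x. x permutes pts}" "y \<in> {x. x permutes pts}" and eq: "inv' x = inv' y"
  then have "x permutes pts" "y permutes pts" by simp_all
  then have "x = inv' (inv' x)" "inv' (inv' y) = y" by (simp_all add: permutes_inv_inv)
  then show "x = y" unfolding eq by (rule trans)
qed

lemma card_conjugators_image_in: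
  assumes A: "A \<subseteq> pts" and \<B>: "finite \<B>" "\<And>x. x \<in> conjugators g H \<Longrightarrow> inv' x ` A \<in> \<B>"
  shows "card (conjugators g H) \<le> card \<B> * (fact (card A) * fact (12 - card A))"
proof -
  have "card (conjugators g H) \<le> card {y. y permutes pts \<and> y ` A \<in> \<B>}"
  proof (rule card_inj_on_le)
    show "inj_on inv' (conjugators g H)"
      using inj_on_inv_permutes by (rule inj_on_subset) (auto simp: conjugators_def)
    show "inv' ` conjugators g H \<subseteq> {y. y permutes pts \<and> y ` A \<in> \<B>}"
    proof (rule image_subsetI)
      fix x assume x: "x \<in> conjugators g H"
      then have "inv' x permutes pts" unfolding conjugators_def by (blast intro: permutes_inv)
      then show "inv' x \<in> {y. y permutes pts \<and> y ` A \<in> \<B>}"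
        using \<B>(2)[OF x] by (simp only: mem_Collect_eq simp_thms)
    qed
    show "finite {y. y permutes pts \<and> y ` A \<in> \<B>}"
      using finite_permutes_pts by (rule rev_finite_subset) blast
  qed
  also have "\<dots> \<le> card \<B> * (fact (card A) * fact (card pts - card A))"
    by (rule card_permutes_image_in[OF finite_pts A \<B>(1)])
  finally show ?thesis unfolding card_pts .
qed

text \<open>If \<open>x\<close> conjugates the permutation into \<open>H\<close>, the preimage of
  \<open>A\<close> under \<open>x\<close> is one of its invariant sets. There are few of those, and
  each is attained by at most \<open>card A\<close>! times \<open>12 - card A\<close>!
  permutations.\<close>

lemma card_conjugators_intransitive:
  assumes ij: "i \<le> j" "j \<le> 12" and A: "A \<subseteq> pts" "\<And>h. h \<in> H \<Longrightarrow> h ` A = A"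
  shows "card (conjugators (cyc3 i j) H) \<le> sel_count i j (card A) * (fact (card A) * fact (12 - card A))"
proof -
  let ?B = "{B. B \<subseteq> pts \<and> cyc3 i j ` B = B \<and> card B = card A}"
  have "inv' x ` A \<in> ?B" if "x \<in> conjugators (cyc3 i j) H" for x
  proof -
    have x: "x permutes pts" "x \<circ> cyc3 i j \<circ> inv' x \<in> H" using that unfolding conjugators_def by auto
    let ?y = "inv' x"
    have y: "?y permutes pts" using x(1) by (rule permutes_inv)
    have "(x \<circ> cyc3 i j \<circ> ?y) ` A = A" using A(2) x(2) by blast
    then have "x ` cyc3 i j ` ?y ` A = A" by (simp add: image_comp comp_assoc)
    then have "?y ` x ` cyc3 i j ` ?y ` A = ?y ` A" by simp
    then have "cyc3 i j ` ?y ` A = ?y ` A"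
      by (simp only: image_inv_f_f[OF permutes_inj[OF x(1)]])
    moreover have "?y ` A \<subseteq> pts" using A(1) permutes_image[OF y] by blast
    moreover have "card (?y ` A) = card A"
      by (rule card_image) (meson inj_on_subset permutes_inj subset_UNIV y)
    ultimately show ?thesis by (simp only: mem_Collect_eq simp_thms)
  qed
  moreover have "finite ?B" by (rule finite_subset[of _ "Pow pts"]) (auto simp: finite_pts)
  ultimately have "card (conjugators (cyc3 i j) H) \<le> card ?B * (fact (card A) * fact (12 - card A))"
    using A(1) by (intro card_conjugators_image_in)
  also have "\<dots> \<le> sel_count i j (card A) * (fact (card A) * fact (12 - card A))"
    by (intro mult_right_mono card_invariant_sets ij) simp
  finally show ?thesis .
qed

text \<open>Passing to the complement, \<open>A\<close> has at most 6 points. For sizes 1, 2, 3 the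
  bound is attained: 12 * 1! * 11! = 66 * 2! * 10! = 220 * 3! * 9! = 12!. For sizes 4 and 5 the
  coefficients add up to 232 and 366, below the binomials 495 and 792; none of the five types has an
  invariant set of size 6.\<close>

lemma weight_intransitive:
  assumes "A \<subseteq> pts" "A \<noteq> {}" "A \<noteq> pts" "\<And>h. h \<in> H \<Longrightarrow> h permutes pts" "\<And>h. h \<in> H \<Longrightarrow> h ` A = A"
  shows "weight H \<le> fact 12"
proof -
  have main: "weight H \<le> fact 12"
    if A: "A \<subseteq> pts" "\<And>h. h \<in> H \<Longrightarrow> h ` A = A" and k: "card A = k" "1 \<le> k" "k \<le> 6" for A k
  proof -
    note b = card_conjugators_intransitive[OF _ _ A, unfolded k(1)]
    have "weight H \<le> (462 * sel_count 12 12 k + 220 * sel_count 3 7 k + 66 * sel_count 2 7 k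
        + 12 * sel_count 1 5 k + sel_count 5 5 k) * (fact k * fact (12 - k))"
      unfolding weight_def add_mult_distrib mult.assoc
      by (intro add_mono mult_left_mono b) simp_all
    also have "k = 1 \<or> k = 2 \<or> k = 3 \<or> k = 4 \<or> k = 5 \<or> k = 6" using k by linarith
    then have "(462 * sel_count 12 12 k + 220 * sel_count 3 7 k + 66 * sel_count 2 7 k
        + 12 * sel_count 1 5 k + sel_count 5 5 k) * (fact k * fact (12 - k)) \<le> fact 12"
      by (elim disjE) (simp_all add: sel_count_def sel_card_def fact_numeral)
    finally show ?thesis .
  qed
  have finA: "finite A" using assms(1) finite_pts finite_subset by blast
  have "card A \<noteq> 0" "card A < 12"
    using assms(1-3) finA psubset_card_mono[OF finite_pts, of A] card_pts by auto
  show ?thesis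
  proof (cases "card A \<le> 6")
    case True
    then show ?thesis using main[of A "card A"] assms(1,5) \<open>card A \<noteq> 0\<close> by simp
  next
    case False
    have "h ` (pts - A) = pts - A" if "h \<in> H" for h
      using image_set_diff[OF permutes_inj[OF assms(4)[OF that]], of pts A] permutes_image[OF assms(4)[OF that]] assms(5)[OF that] by simp
    moreover have "card (pts - A) = 12 - card A" using assms(1) finA by (simp add: card_Diff_subset card_pts)
    ultimately show ?thesis
      using main[of "pts - A" "12 - card A"] False \<open>card A < 12\<close> by auto
  qed
qed

section \<open>Imprimitive groups\<close>

lemma coprime_small:
  "coprime (1::nat) 5" "coprime (2::nat) 5" "coprime (3::nat) 5" "coprime (4::nat) 5"
  "coprime (1::nat) 7" "coprime (2::nat) 7" "coprime (3::nat) 7" "coprime (4::nat) 7"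
  "coprime (5::nat) 7" "coprime (6::nat) 7"
  unfolding coprime_iff_gcd_eq_1 by code_simp+

lemma ex_mem_if_card_pos: "card A \<ge> Suc n \<Longrightarrow> \<exists>x. x \<in> A"
  by (metis card.empty ex_in_conv not_less_eq_eq zero_le)

text \<open>By Bezout a power of \<open>g ^^ k\<close> acts on \<open>a\<close> like
  \<open>g\<close> itself, so \<open>g a\<close> lies in the class of \<open>a\<close> and then the
  whole cycle does.\<close>

lemma orb_subset_class:
  assumes g: "g permutes S" "finite S" and R: "equiv S R" "\<And>u v. (u, v) \<in> R \<Longrightarrow> (g u, g v) \<in> R"
    and k: "(a, (g ^^ k) a) \<in> R" "coprime k (least_power g a)" "k > 0"
  shows "orb g a \<subseteq> R `` {a}"
proof -
  have tr: "(u, w) \<in> R" if "(u, v) \<in> R" "(v, w) \<in> R" for u v w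
    using R(1) that unfolding equiv_def trans_def by blast
  have a: "(a, a) \<in> R"
    using R(1) k(1) unfolding equiv_def refl_on_def by blast
  have pow: "((g ^^ n) u, (g ^^ n) v) \<in> R" if "(u, v) \<in> R" for n u v
    using that by (induction n) (simp_all add: R(2))
  have mult: "(a, (g ^^ (k * n)) a) \<in> R" for n
  proof (induction n)
    case (Suc n)
    have "((g ^^ k) a, (g ^^ k) ((g ^^ (k * n)) a)) \<in> R" using pow[OF Suc] .
    then have "((g ^^ k) a, (g ^^ (k * Suc n)) a) \<in> R" by (simp add: funpow_add)
    then show ?case using tr k(1) by blast
  qed (simp add: a)
  obtain x y where "k * x = least_power g a * y + gcd k (least_power g a)"
    using bezout_nat[of k "least_power g a"] k(3) by blast
  then have "k * x = Suc 0 + least_power g a * y"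
    using k(2) by (simp add: coprime_iff_gcd_eq_1 One_nat_def)
  then have "k * x mod least_power g a = Suc 0 mod least_power g a"
    by (simp only: mod_mult_self2)
  then have "(g ^^ (k * x)) a = (g ^^ Suc 0) a"
    unfolding funpow_eq_iff_mod[OF g] .
  then have one: "(a, g a) \<in> R" using mult[of x] by simp
  have "(a, (g ^^ n) a) \<in> R" for n
  proof (induction n)
    case (Suc n)
    then have "(g a, (g ^^ Suc n) a) \<in> R" using R(2) by simp
    then show ?case using tr one by blast
  qed (simp add: a)
  then show ?thesis unfolding orb_def by blast
qed

text \<open>Only the single permutation \<open>g\<close> has to respect \<open>R\<close>. A block
  system of \<open>H\<close> can therefore be pulled back along a conjugator to one of the standard
  representative.\<close>

definition block_system :: "(nat \<Rightarrow> nat) \<Rightarrow> nat \<Rightarrow> (nat \<times> nat) set \<Rightarrow> bool" where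
  "block_system g d R \<longleftrightarrow> equiv pts R \<and> (\<forall>u v. (u, v) \<in> R \<longrightarrow> (g u, g v) \<in> R) \<and>
     (\<forall>a\<in>pts. card (R `` {a}) = d)"

lemma block_system_conj:
  assumes x: "x permutes pts" and R: "block_system (x \<circ> g \<circ> inv' x) d R"
  shows "block_system g d {(u, v). (x u, x v) \<in> R}" (is "block_system g d ?R")
proof -
  have inv: "inv' x (x y) = y" "x (inv' x y) = y" for y
    using permutes_inverses[OF x] by simp_all
  have mem: "x y \<in> pts \<longleftrightarrow> y \<in> pts" for y using permutes_in_image[OF x] .
  have eq: "equiv pts R" and c: "\<And>a. a \<in> pts \<Longrightarrow> card (R `` {a}) = d"
    and step: "\<And>u v. (u, v) \<in> R \<Longrightarrow> (x (g (inv' x u)), x (g (inv' x v))) \<in> R"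
    using R unfolding block_system_def by auto
  have "equiv pts ?R"
    using eq mem unfolding equiv_def refl_on_def sym_def trans_def by blast
  moreover have "(g u, g v) \<in> ?R" if "(u, v) \<in> ?R" for u v
    using step[of "x u" "x v"] that inv by simp
  moreover have "card (?R `` {a}) = d" if a: "a \<in> pts" for a
  proof -
    have "?R `` {a} = inv' x ` (R `` {x a})"
    proof
      show "?R `` {a} \<subseteq> inv' x ` (R `` {x a})"
      proof
        fix v assume "v \<in> ?R `` {a}"
        then have "x v \<in> R `` {x a}" by simp
        then have "inv' x (x v) \<in> inv' x ` (R `` {x a})" by (rule imageI)
        then show "v \<in> inv' x ` (R `` {x a})" using inv by simp
      qed
      show "inv' x ` (R `` {x a}) \<subseteq> ?R `` {a}" using inv by auto
    qed
    moreover have "inj_on (inv' x) (R `` {x a})"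
      using permutes_inj[OF permutes_inv[OF x]] by (rule inj_on_subset) simp
    ultimately show ?thesis using c mem a by (simp add: card_image)
  qed
  ultimately show ?thesis unfolding block_system_def by blast
qed

lemma block_system_class:
  assumes R: "block_system g d R" and g: "g permutes pts" and a: "a \<in> pts" "b \<in> R `` {a}" "g b \<in> R `` {a}"
  shows "g ` (R `` {a}) = R `` {a}"
proof -
  have eq: "equiv pts R" using R unfolding block_system_def by blast
  have tr: "(u, w) \<in> R" if "(u, v) \<in> R" "(v, w) \<in> R" for u v w
    using eq that unfolding equiv_def trans_def by blast
  have sy: "(v, u) \<in> R" if "(u, v) \<in> R" for u v
    using eq that unfolding equiv_def sym_def by blast
  have "R `` {a} \<subseteq> pts" using eq unfolding equiv_def by blast
  then have fin: "finite (R `` {a})" using finite_pts finite_subset by blast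
  have "g v \<in> R `` {a}" if "v \<in> R `` {a}" for v
  proof -
    have "(b, v) \<in> R" using a that tr sy by blast
    then have "(g b, g v) \<in> R" using R unfolding block_system_def by blast
    then show ?thesis using a tr by blast
  qed
  then have "g ` (R `` {a}) \<subseteq> R `` {a}" by blast
  moreover have "inj_on g (R `` {a})" using permutes_inj[OF g] by (rule inj_on_subset) simp
  ultimately show ?thesis using fin by (rule endo_inj_surj[rotated 1])
qed

lemma block_system_class_sel:
  assumes ij: "i \<le> j" "j \<le> 12" and R: "block_system (cyc3 i j) d R" and a: "a \<in> pts"
    and orb: "orb (cyc3 i j) a \<subseteq> R `` {a}"
  shows "\<exists>t. R `` {a} = sel i j t \<and> d = sel_card i j t"
proof -
  have "cyc3 i j a \<in> R `` {a}" using orb funpow_in_orb[of "Suc 0" "cyc3 i j" a] by auto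
  moreover have "a \<in> R `` {a}" using orb orb_self by fast
  ultimately have "cyc3 i j ` (R `` {a}) = R `` {a}"
    using block_system_class[OF R cyc3_permutes[OF ij] a] by blast
  moreover have "R `` {a} \<subseteq> pts" using R unfolding block_system_def equiv_def by blast
  ultimately obtain t where t: "R `` {a} = sel i j t" using invariant_eq_sel[OF ij] by blast
  then have "d = sel_card i j t"
    using R a card_sel[OF ij] unfolding block_system_def by metis
  with t show ?thesis by blast
qed

text \<open>As 5 and 7 are prime, every nontrivial step inside the cycle of \<open>a\<close> is
  coprime to its length. If \<open>b\<close> lies on a cycle of coprime length, going once around
  that cycle fixes \<open>b\<close> and moves \<open>a\<close> inside its block by such a
  step.\<close>

lemma block_system_orb:
  assumes ij: "i \<le> j" "j \<le> 12" and R: "block_system (cyc3 i j) d R" and ab: "(a, b) \<in> R" "a \<noteq> b"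
    and L: "cyc_len i j a \<in> {5, 7}"
    and b: "b \<in> orb (cyc3 i j) a \<or> cyc_len i j b > 0 \<and> coprime (cyc_len i j b) (cyc_len i j a)"
  shows "orb (cyc3 i j) a \<subseteq> R `` {a}"
proof -
  let ?g = "cyc3 i j"
  note g = cyc3_permutes[OF ij] finite_pts
  have eq: "equiv pts R" and step: "\<And>u v. (u, v) \<in> R \<Longrightarrow> (?g u, ?g v) \<in> R"
    using R unfolding block_system_def by auto
  have mem: "a \<in> pts" "b \<in> pts" using eq ab unfolding equiv_def by blast+
  have lp: "least_power ?g a = cyc_len i j a" using least_power_cyc3[OF ij mem(1)] .
  from b show ?thesis
  proof
    assume "b \<in> orb ?g a"
    then obtain k where k: "k < cyc_len i j a" "b = (?g ^^ k) a"
      unfolding orb_eq_image[OF g] lp by blast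
    have "k \<noteq> 0" using k ab by (cases k) auto
    moreover have "coprime k (cyc_len i j a)"
    proof -
      have "k \<in> {1, 2, 3, 4} \<and> cyc_len i j a = 5 \<or> k \<in> {1, 2, 3, 4, 5, 6} \<and> cyc_len i j a = 7"
        using L k(1) \<open>k \<noteq> 0\<close> by auto
      then show ?thesis by (auto simp: coprime_small)
    qed
    ultimately show ?thesis
      using orb_subset_class[OF g eq step, of a k] ab k lp by simp
  next
    assume b: "cyc_len i j b > 0 \<and> coprime (cyc_len i j b) (cyc_len i j a)"
    let ?k = "cyc_len i j b"
    have "((?g ^^ n) a, (?g ^^ n) b) \<in> R" for n
      by (induction n) (simp_all add: ab step)
    moreover have "(?g ^^ ?k) b = b" using funpow_cyc3_eq_iff[OF ij mem(2)] by simp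
    ultimately have "((?g ^^ ?k) a, b) \<in> R" by metis
    then have "(a, (?g ^^ ?k) a) \<in> R"
      using ab(1) eq unfolding equiv_def sym_def trans_def by blast
    then show ?thesis
      using orb_subset_class[OF g eq step, of a ?k] b lp by simp
  qed
qed

lemma block_system_ex_other:
  assumes "block_system g d R" "d \<ge> 2" "a \<in> pts"
  obtains b where "(a, b) \<in> R" "a \<noteq> b"
proof -
  have "card (R `` {a}) \<ge> 2" using assms unfolding block_system_def by simp
  then have "\<not> R `` {a} \<subseteq> {a}" using card_mono[of "{a}" "R `` {a}"] by auto
  then show ?thesis using that by blast
qed

text \<open>The block of \<open>a\<close> contains the cycle of \<open>a\<close>, so it is invariant
  and a union of cycles; it then suffices to compare sizes.\<close>

lemma no_block_system:
  assumes le: "i \<le> j" "j \<le> 12" and a: "a \<in> pts" "cyc_len i j a \<in> {5, 7}" and d: "2 \<le> d"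
    and others: "\<And>b. b \<in> pts \<Longrightarrow> b \<in> orb (cyc3 i j) a \<or> cyc_len i j b > 0 \<and> coprime (cyc_len i j b) (cyc_len i j a)"
    and sizes: "\<And>t. a \<in> sel i j t \<Longrightarrow> sel_card i j t \<noteq> d"
  shows "\<not> block_system (cyc3 i j) d R"
proof
  assume R: "block_system (cyc3 i j) d R"
  obtain b where b: "(a, b) \<in> R" "a \<noteq> b" using block_system_ex_other[OF R d a(1)] .
  have "b \<in> pts" using b R unfolding block_system_def equiv_def by blast
  have "orb (cyc3 i j) a \<subseteq> R `` {a}"
    by (rule block_system_orb[OF le R b a(2) others[OF \<open>b \<in> pts\<close>]])
  then obtain t where "R `` {a} = sel i j t" "d = sel_card i j t"
    using block_system_class_sel[OF le R a(1)] by blast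
  moreover have "a \<in> R `` {a}" using R a(1) unfolding block_system_def equiv_def refl_on_def by blast
  ultimately show False using sizes[of t] by simp
qed

text \<open>The block of 6 would contain the 7-cycle.\<close>

lemma no_block_system_g147: "2 \<le> d \<Longrightarrow> d \<le> 6 \<Longrightarrow> \<not> block_system g147 d R"
  by (rule no_block_system[of _ _ 6])
    (auto simp: cyc_len_def orb_cyc3 mem_pts coprime_small sel_def sel_card_def split: if_splits)

lemma no_block_system_g57: "2 \<le> d \<Longrightarrow> d \<le> 6 \<Longrightarrow> \<not> block_system g57 d R"
  by (rule no_block_system[of _ _ 6])
    (auto simp: cyc_len_def orb_cyc3 mem_pts coprime_small sel_def sel_card_def split: if_splits)

text \<open>Unions of cycles containing the 5-cycle have sizes 5, 8, 9 and 12.\<close>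

lemma no_block_system_g345: "d \<in> {2, 3, 4, 6} \<Longrightarrow> \<not> block_system g345 d R"
  by (rule no_block_system[of _ _ 8])
    (auto simp: cyc_len_def orb_cyc3 mem_pts coprime_small sel_def sel_card_def split: if_splits)

text \<open>The two 5-cycles have no coprime lengths; indeed blocks of size 2 pairing them exist. A
  block of size at least 3 through 8 that does not contain the cycle of 8 has two points in the
  other 5-cycle, hence contains all of it. So it is invariant and contains the cycle of 8 after
  all.\<close>

lemma no_block_system_g255:
  assumes "d \<in> {3, 4, 6}" shows "\<not> block_system g255 d R"
proof
  assume R: "block_system g255 d R"
  have le: "2 \<le> (7::nat)" "7 \<le> (12::nat)" by simp_all
  have eq: "equiv pts R" using R unfolding block_system_def by blast
  have 8: "8 \<in> pts" by (simp add: mem_pts)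
  have self: "8 \<in> R `` {8}" using eq 8 unfolding equiv_def refl_on_def by blast
  have no_orb: "\<not> orb g255 8 \<subseteq> R `` {8}"
  proof
    assume "orb g255 8 \<subseteq> R `` {8}"
    then obtain t where "R `` {8} = sel 2 7 t" "d = sel_card 2 7 t"
      using block_system_class_sel[OF le R 8] by blast
    then show False using assms self
      by (cases t) (auto simp: sel_def sel_card_def split: if_splits)
  qed
  have sub: "b \<in> {3..7}" if b: "(8, b) \<in> R" "8 \<noteq> b" for b
  proof (rule ccontr)
    assume "b \<notin> {3..7}"
    moreover have "b \<in> pts" using b eq unfolding equiv_def by blast
    ultimately have prem: "b \<in> orb g255 8 \<or> 0 < cyc_len 2 7 b \<and> coprime (cyc_len 2 7 b) (cyc_len 2 7 8)"
      by (auto simp: cyc_len_def orb_cyc3 mem_pts coprime_small)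
    have "orb g255 8 \<subseteq> R `` {8}"
      by (rule block_system_orb[OF le R b _ prem]) (simp add: cyc_len_def)
    then show False using no_orb by blast
  qed
  have "card (R `` {8}) = d" using R 8 unfolding block_system_def by blast
  then have "card (R `` {8}) \<ge> 3" using assms by auto
  have fin: "finite (R `` {8})"
  proof (rule finite_subset[OF _ finite_pts])
    show "R `` {8} \<subseteq> pts" using eq unfolding equiv_def by blast
  qed
  have "card (R `` {8} - {8}) \<ge> 2" using \<open>card (R `` {8}) \<ge> 3\<close> self fin by simp
  then obtain b where b: "b \<in> R `` {8}" "b \<noteq> 8"
    using ex_mem_if_card_pos[of 1 "R `` {8} - {8}"] by auto
  have "card (R `` {8} - {8} - {b}) \<ge> 1" using \<open>card (R `` {8} - {8}) \<ge> 2\<close> b fin by simp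
  then obtain b' where b': "b' \<in> R `` {8}" "b' \<noteq> 8" "b' \<noteq> b"
    using ex_mem_if_card_pos[of 0 "R `` {8} - {8} - {b}"] by (auto simp: One_nat_def)
  have bb': "(b, b') \<in> R" using b b' eq unfolding equiv_def sym_def trans_def by blast
  have mem: "b \<in> {3..7}" "b' \<in> {3..7}" using sub b b' by auto
  have "orb g255 b \<subseteq> R `` {b}"
    using block_system_orb[OF le R bb'] b'(3) mem
    by (auto simp: cyc_len_def orb_cyc3 mem_pts)
  moreover have "R `` {b} = R `` {8}"
    using equiv_class_eq[OF eq, of 8 b] b(1) by simp
  moreover have "g255 b \<in> orb g255 b" using funpow_in_orb[of "Suc 0" g255 b] by simp
  ultimately have "g255 ` (R `` {8}) = R `` {8}"
    using block_system_class[OF R cyc3_permutes[OF le] 8 b(1)] by blast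
  then have "orb g255 8 \<subseteq> R `` {8}"
    using orb_subset[OF cyc3_permutes[OF le] finite_pts, of "R `` {8}" 8] self by simp
  then show False using no_orb by blast
qed

lemma ex_bij_lessThan: "finite A \<Longrightarrow> \<exists>f. bij_betw f {..<card A} A"
  using ex_bij_betw_nat_finite unfolding atLeast0LessThan .

text \<open>The points are numbered block after block: \<open>i div d\<close> selects the block and
  \<open>i mod d\<close> the point in it. The successive choices below follow this order.\<close>

lemma ex_block_enumeration:
  assumes S: "finite S" and R: "equiv S R" and d: "\<And>a. a \<in> S \<Longrightarrow> card (R `` {a}) = d" "d > 0"
  shows "d dvd card S" and "\<exists>l. bij_betw l {..<card S} S \<and>
    (\<forall>i<card S. \<forall>j<card S. (l i, l j) \<in> R \<longleftrightarrow> i div d = j div d)"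
proof -
  have fin: "finite (S // R)" using finite_quotient[OF S equiv_type[OF R]] .
  have cardX: "card X = d" if "X \<in> S // R" for X
    using that d(1) by (auto elim!: quotientE)
  have U: "\<Union> (S // R) = S" by (rule Union_quotient[OF R])
  define m where "m = card (S // R)"
  have dm: "d * m = card S"
  proof -
    have "d * card (S // R) = card (\<Union> (S // R))"
    proof (rule card_partition[OF fin])
      show "finite (\<Union> (S // R))" unfolding U by (rule S)
      show "X \<inter> Y = {}" if "X \<in> S // R" "Y \<in> S // R" "X \<noteq> Y" for X Y
        using quotient_disj[OF R that(1,2)] that(3) by blast
    qed (rule cardX)
    then show ?thesis unfolding U m_def .
  qed
  from dvdI[OF this[symmetric]] show "d dvd card S" .
  obtain \<beta> where \<beta>: "bij_betw \<beta> {..<m} (S // R)"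
    unfolding m_def using ex_bij_lessThan[OF fin] by blast
  have "\<exists>f. bij_betw f {..<d} X" if "X \<in> S // R" for X
  proof -
    have "X \<subseteq> S" using that U by blast
    then have "finite X" using S by (rule finite_subset)
    from ex_bij_lessThan[OF this] show ?thesis unfolding cardX[OF that] .
  qed
  then obtain \<gamma> where \<gamma>: "\<And>X. X \<in> S // R \<Longrightarrow> bij_betw (\<gamma> X) {..<d} X" by metis
  define l where "l i = \<gamma> (\<beta> (i div d)) (i mod d)" for i
  have cls: "\<beta> (i div d) \<in> S // R" if "i < card S" for i
  proof -
    have "i div d < m" using that dm by (simp add: less_mult_imp_div_less mult.commute)
    then show ?thesis using \<beta> unfolding bij_betw_def by blast
  qed
  have mem: "l i \<in> \<beta> (i div d)" if "i < card S" for i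
  proof -
    have "i mod d \<in> {..<d}" using d(2) by simp
    then show ?thesis unfolding l_def using bij_betwE[OF \<gamma>[OF cls[OF that]]] by blast
  qed
  have rel: "(l i, l j) \<in> R \<longleftrightarrow> i div d = j div d" if ij: "i < card S" "j < card S" for i j
  proof -
    have "(l i, l j) \<in> R \<longleftrightarrow> \<beta> (i div d) = \<beta> (j div d)"
      by (rule quotient_eq_iff[OF R cls[OF ij(1)] cls[OF ij(2)] mem[OF ij(1)] mem[OF ij(2)], symmetric])
    also have "\<dots> \<longleftrightarrow> i div d = j div d"
    proof -
      have "i div d \<in> {..<m}" "j div d \<in> {..<m}"
        using ij dm by (simp_all add: less_mult_imp_div_less mult.commute)
      then show ?thesis by (rule inj_on_eq_iff[OF bij_betw_imp_inj_on[OF \<beta>]])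
    qed
    finally show ?thesis .
  qed
  have lS: "l i \<in> S" if "i < card S" for i
    using mem[OF that] cls[OF that] U by blast
  have "inj_on l {..<card S}"
  proof (rule inj_onI)
    fix i j assume "i \<in> {..<card S}" "j \<in> {..<card S}" and eq: "l i = l j"
    then have ij: "i < card S" "j < card S" by simp_all
    have "(l i, l i) \<in> R" using R lS[OF ij(1)] unfolding equiv_def refl_on_def by blast
    then have "(l i, l j) \<in> R" using eq by simp
    then have same: "i div d = j div d" using rel[OF ij] by blast
    have "inj_on (\<gamma> (\<beta> (i div d))) {..<d}" using \<gamma>[OF cls[OF ij(1)]] unfolding bij_betw_def by blast
    moreover have "\<gamma> (\<beta> (i div d)) (i mod d) = \<gamma> (\<beta> (i div d)) (j mod d)"
      using eq unfolding l_def same .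
    moreover have "i mod d < d" "j mod d < d" using d(2) by simp_all
    ultimately have "i mod d = j mod d" by (meson inj_onD lessThan_iff)
    then show "i = j" using same by (metis div_mult_mod_eq)
  qed
  moreover have "l ` {..<card S} = S"
  proof (rule card_subset_eq[OF S])
    show "l ` {..<card S} \<subseteq> S" using lS by blast
    show "card (l ` {..<card S}) = card S" using calculation by (simp add: card_image)
  qed
  ultimately have "bij_betw l {..<card S} S" unfolding bij_betw_def by blast
  with rel show "\<exists>l. bij_betw l {..<card S} S \<and>
    (\<forall>i<card S. \<forall>j<card S. (l i, l j) \<in> R \<longleftrightarrow> i div d = j div d)" by blast
qed

section \<open>Orders of groups with blocks or with a small base\<close>

context perm_group
begin

lemma image_of_new_point:
  assumes f: "f \<in> H" and l: "inj_on l {..<n}" "l ` {..<n} \<subseteq> S" and i: "i < n"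
  shows "card (S - (\<lambda>j. f (l j)) ` {..<i}) = card S - i"
    and "h \<in> H \<Longrightarrow> \<forall>j<i. h (l j) = f (l j) \<Longrightarrow> h (l i) \<in> S - (\<lambda>j. f (l j)) ` {..<i}"
proof -
  have lS: "l j \<in> S" if "j < n" for j using l(2) that by blast
  have linj: "l j = l k \<longleftrightarrow> j = k" if "j < n" "k < n" for j k
    using inj_on_eq_iff[OF l(1)] that by simp
  have "(\<lambda>j. f (l j)) ` {..<i} \<subseteq> S"
  proof (rule image_subsetI)
    fix j assume "j \<in> {..<i}"
    then have "l j \<in> S" using lS i by simp
    then show "f (l j) \<in> S" using mem_S_iff[OF f] by blast
  qed
  moreover have "inj_on (\<lambda>j. f (l j)) {..<i}"
    using inj_mem[OF f] linj i by (intro inj_onI) simp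
  ultimately show "card (S - (\<lambda>j. f (l j)) ` {..<i}) = card S - i"
    by (simp add: card_Diff_subset card_image)
  assume h: "h \<in> H" "\<forall>j<i. h (l j) = f (l j)"
  have "h (l i) \<noteq> f (l j)" if "j < i" for j
  proof -
    have "h (l i) \<noteq> h (l j)" using inj_mem[OF h(1)] linj i that by simp
    then show ?thesis using h(2) that by simp
  qed
  then have "h (l i) \<notin> (\<lambda>j. f (l j)) ` {..<i}" by (metis lessThan_iff imageE)
  moreover have "h (l i) \<in> S" using mem_S_iff[OF h(1)] lS[OF i] by blast
  ultimately show "h (l i) \<in> S - (\<lambda>j. f (l j)) ` {..<i}" by blast
qed

lemma card_imprimitive:
  assumes R: "invariant_equiv R" and d: "\<And>a. a \<in> S \<Longrightarrow> card (R `` {a}) = d" "d > 0"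
  shows "card H \<le> (\<Prod>i<card S. if i mod d = 0 then card S - i else d - i mod d)"
proof -
  have eq: "equiv S R" using R unfolding invariant_equiv_def by blast
  obtain l where l: "bij_betw l {..<card S} S"
    and rel: "\<And>i j. i < card S \<Longrightarrow> j < card S \<Longrightarrow> (l i, l j) \<in> R \<longleftrightarrow> i div d = j div d"
    using ex_block_enumeration(2)[OF finite_S eq d] by blast
  have lS: "l i \<in> S" if "i < card S" for i using l that unfolding bij_betw_def by blast
  have linj: "l i = l j \<longleftrightarrow> i = j" if "i < card S" "j < card S" for i j
    using l that unfolding bij_betw_def inj_on_def by blast
  have l': "inj_on l {..<card S}" "l ` {..<card S} \<subseteq> S"
    using l unfolding bij_betw_def by simp_all
  show ?thesis
  proof (rule card_le_prod_choices[of _ _ l, OF finite_H])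
    fix f h assume fh: "f \<in> H" "h \<in> H" "\<And>i. i < card S \<Longrightarrow> f (l i) = h (l i)"
    show "f = h"
    proof
      fix x
      show "f x = h x"
      proof (cases "x \<in> S")
        case True
        then obtain i where "i < card S" "x = l i" using l unfolding bij_betw_def by blast
        then show ?thesis using fh(3) by simp
      next
        case False
        then show ?thesis using permutes_not_in[OF permutes] fh(1,2) by metis
      qed
    qed
  next
    fix f i assume f: "f \<in> H" and i: "i < card S"
    let ?c = "if i mod d = 0 then card S - i else d - i mod d"
    show "\<exists>T. finite T \<and> card T \<le> ?c \<and> (\<forall>h\<in>H. (\<forall>j<i. h (l j) = f (l j)) \<longrightarrow> h (l i) \<in> T)"
    proof (cases "i mod d = 0")
      case True
      then show ?thesis
        using image_of_new_point[OF f l' i] finite_S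
        by (intro exI[of _ "S - (\<lambda>j. f (l j)) ` {..<i}"]) auto
    next
      case False
      \<comment> \<open>The first index in the block of \<open>i\<close>; its image determines the
        target block.\<close>
      define i0 where "i0 = i - i mod d"
      have i0: "i0 \<le> i" "i0 < i" "i - i0 = i mod d" "i0 < card S"
        using False i mod_less_eq_dividend[of i d] unfolding i0_def by linarith+
      have "i0 = d * (i div d)" unfolding i0_def by (simp add: minus_mod_eq_mult_div)
      then have same: "j div d = i div d" if "i0 \<le> j" "j \<le> i" for j
      proof (intro antisym)
        show "j div d \<le> i div d" using that(2) by (rule div_le_mono)
        have "i0 div d = i div d" using \<open>i0 = d * (i div d)\<close> d(2) by simp
        then show "i div d \<le> j div d" using div_le_mono[OF that(1), of d] by simp
      qed
      have related: "(h (l i0), h (l j)) \<in> R" if "h \<in> H" "i0 \<le> j" "j \<le> i" for h j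
      proof -
        have "(l i0, l j) \<in> R" using rel same[of i0] same[of j] i0 i that by simp
        then show ?thesis using R that(1) unfolding invariant_equiv_def by blast
      qed
      let ?C = "R `` {f (l i0)}"
      let ?T = "?C - (\<lambda>j. f (l j)) ` {i0..<i}"
      have "?C \<subseteq> S" using eq unfolding equiv_def by blast
      then have finC: "finite ?C" using finite_S by (rule finite_subset)
      have "card ?C = d" using d(1) mem_S_iff[OF f] lS[OF i0(4)] by blast
      moreover have "(\<lambda>j. f (l j)) ` {i0..<i} \<subseteq> ?C"
        using related[OF f] by auto
      moreover have "inj_on (\<lambda>j. f (l j)) {i0..<i}"
        using inj_mem[OF f] linj i by (intro inj_onI) simp
      ultimately have "card ?T = d - i mod d"
        using i i0 by (simp add: card_Diff_subset card_image)
      moreover have "h (l i) \<in> ?T" if h: "h \<in> H" "\<forall>j<i. h (l j) = f (l j)" for h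
      proof -
        have "h (l i) \<notin> (\<lambda>j. f (l j)) ` {i0..<i}"
          using image_of_new_point(2)[OF f l' i h] by auto
        moreover have "(f (l i0), h (l i)) \<in> R"
          using related[OF h(1), of i] h(2) i0 by simp
        ultimately show ?thesis by blast
      qed
      ultimately show ?thesis using False finC by (intro exI[of _ ?T]) auto
    qed
  qed
qed

lemma base_eqI:
  assumes B: "is_base B"
    and l: "bij_betw l {..<n} B" and fh: "f \<in> H" "h \<in> H" "\<And>i. i < n \<Longrightarrow> f (l i) = h (l i)"
  shows "f = h"
proof -
  have hinv: "inv' h (h y) = y" "h (inv' h y) = y" for y
    using permutes_inverses[OF permutes[OF fh(2)]] by simp_all
  have "inv' h \<circ> f \<in> H" using fh by (intro comp_mem inv_mem)
  moreover have "(inv' h \<circ> f) x = x" if xB: "x \<in> B" for x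
  proof -
    obtain i where "i < n" "x = l i" using xB l unfolding bij_betw_def by blast
    then show ?thesis using fh(3) hinv by simp
  qed
  ultimately have "inv' h \<circ> f = id" using B unfolding is_base_def by blast
  then have "inv' h (f y) = y" for y by (metis comp_apply id_apply)
  then have "f y = h y" for y using hinv(2)[of "f y"] by simp
  then show ?thesis by blast
qed

lemma card_le_base:
  assumes base: "is_base B"
  shows "card H \<le> (\<Prod>i<card B. card S - i)"
proof -
  have B: "B \<subseteq> S" using base unfolding is_base_def by blast
  then have "finite B" using finite_S by (rule finite_subset)
  then obtain l where l: "bij_betw l {..<card B} B" using ex_bij_lessThan by blast
  have l': "inj_on l {..<card B}" "l ` {..<card B} \<subseteq> S"
    using l B unfolding bij_betw_def by simp_all
  show ?thesis
  proof (rule card_le_prod_choices[of _ _ l, OF finite_H])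
    show "f = h" if "f \<in> H" "h \<in> H" "\<And>i. i < card B \<Longrightarrow> f (l i) = h (l i)" for f h
      using base_eqI[OF base l that] .
    show "\<exists>T. finite T \<and> card T \<le> card S - i \<and> (\<forall>h\<in>H. (\<forall>j<i. h (l j) = f (l j)) \<longrightarrow> h (l i) \<in> T)"
      if "f \<in> H" "i < card B" for f i
      using image_of_new_point[OF that(1) l' that(2)] finite_S
      by (intro exI[of _ "S - (\<lambda>j. f (l j)) ` {..<i}"]) auto
  qed
qed

end

section \<open>Counting conjugates, and weights of imprimitive groups\<close>

lemma card_permutes_pts: "card {x. x permutes pts} = fact 12"
  using card_permutations[OF card_pts finite_pts] .

lemma card_conjugators_le: "card (conjugators g H) \<le> fact 12"
  unfolding card_permutes_pts[symmetric] conjugators_def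
  by (rule card_mono[OF finite_permutes_pts]) blast

lemma moved_funpow_cyc3:
  assumes "i \<le> j" "j \<le> 12"
  shows "moved (cyc3 i j ^^ n) = {x \<in> pts. \<not> cyc_len i j x dvd n}"
proof -
  have "(cyc3 i j ^^ n) x = x" if "x \<notin> pts" for x
    using permutes_not_in[OF permutes_funpow[OF cyc3_permutes[OF assms]] that] .
  then show ?thesis
    unfolding moved_def using funpow_cyc3_eq_iff[OF assms] by blast
qed

lemma conjugates_in_moved:
  assumes "h \<in> conjugates_in g H"
  shows "card (moved (h ^^ n)) = card (moved (g ^^ n))"
proof -
  obtain x where x: "x permutes pts" "h = x \<circ> g \<circ> inv' x" using assms unfolding conjugates_in_def by blast
  have "bij x" using x(1) by (rule permutes_bij)
  then show ?thesis unfolding x(2) conjugator_funpow[OF \<open>bij x\<close>] by (rule card_moved_conjugate)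
qed

lemma conjugators_empty_iff: "conjugators g H = {} \<longleftrightarrow> conjugates_in g H = {}"
  unfolding conjugators_def conjugates_in_def by auto

text \<open>The number of points moved by a power is constant on a conjugacy class, so different
  numbers separate two classes.\<close>

lemma card_conjugates_disjoint:
  assumes "finite H" "card (moved (f ^^ n)) \<noteq> card (moved (g ^^ n))"
  shows "card (conjugates_in f H) + card (conjugates_in g H) \<le> card H"
proof -
  have "conjugates_in f H \<inter> conjugates_in g H = {}"
  proof (rule ccontr)
    assume "conjugates_in f H \<inter> conjugates_in g H \<noteq> {}"
    then obtain h where h: "h \<in> conjugates_in f H" "h \<in> conjugates_in g H" by blast
    then show False using conjugates_in_moved[OF h(1), of n] conjugates_in_moved[OF h(2), of n] assms(2) by simp
  qed
  moreover have sub: "conjugates_in f H \<subseteq> H" "conjugates_in g H \<subseteq> H"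
    unfolding conjugates_in_def by blast+
  ultimately have "card (conjugates_in f H) + card (conjugates_in g H) = card (conjugates_in f H \<union> conjugates_in g H)"
    using assms(1) by (subst card_Un_disjoint) (auto intro: finite_subset)
  also have "\<dots> \<le> card H" using assms(1) sub by (intro card_mono) auto
  finally show ?thesis .
qed

lemma conjugators_bound:
  assumes "finite H" "card (centralizer g) \<le> z"
  shows "card (conjugators g H) \<le> z * card (conjugates_in g H)"
proof -
  have "card (conjugators g H) \<le> card (conjugates_in g H) * card (centralizer g)"
    by (rule card_conjugators_le_centralizer[OF assms(1)])
  also have "\<dots> \<le> z * card (conjugates_in g H)" using assms(2) by (simp add: mult.commute)
  finally show ?thesis .
qed

lemma card_conjugates_in_le: "finite H \<Longrightarrow> card (conjugates_in g H) \<le> card H"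
  by (rule card_mono) (auto simp: conjugates_in_def)

text \<open>A 12-cycle preserves no set of size 6, so it swaps the two blocks, and membership
  alternates along the cycle.\<close>

lemma two_blocks_g12:
  assumes R: "block_system g12 6 R" and a: "a \<in> pts"
  shows "R `` {a} \<in> {{k \<in> pts. odd k}, {k \<in> pts. even k}}"
proof -
  define B where "B = R `` {a}"
  have eq: "equiv pts R" and card_B: "card B = 6"
    using R a unfolding block_system_def B_def by blast+
  have B: "B \<subseteq> pts" using eq unfolding B_def equiv_def by blast
  have g: "g12 permutes pts" by (rule cyc3_permutes) simp_all
  have no: "g12 b \<notin> B" if "b \<in> B" for b
  proof
    assume "g12 b \<in> B"
    then have gBB: "g12 ` B = B"
      using block_system_class[OF R g a, of b] that unfolding B_def by blast
    obtain t where "B = sel 12 12 t"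
      by (rule invariant_eq_sel[OF le_refl le_refl B gBB])
    then have "sel_card 12 12 t = 6" using card_sel[of 12 12 t] card_B by simp
    then show False by (cases t) (auto simp: sel_card_def split: if_splits)
  qed
  have finB: "finite B" using B finite_pts by (rule finite_subset)
  have gB: "g12 ` B = pts - B"
  proof (rule card_subset_eq)
    show "finite (pts - B)" using finite_pts by simp
    show "g12 ` B \<subseteq> pts - B" using no B permutes_in_image[OF g] by blast
    have "inj_on g12 B" using permutes_inj[OF g] by (rule inj_on_subset) simp
    then have "card (g12 ` B) = 6" using card_B by (simp add: card_image)
    moreover have "card (pts - B) = 6" using card_B B finB by (simp add: card_Diff_subset card_pts)
    ultimately show "card (g12 ` B) = card (pts - B)" by simp
  qed
  have flip: "g12 b \<in> B \<longleftrightarrow> b \<notin> B" if "b \<in> pts" for b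
  proof
    assume "b \<notin> B"
    show "g12 b \<in> B"
    proof (rule ccontr)
      assume "g12 b \<notin> B"
      then have "g12 b \<in> g12 ` B" using gB that permutes_in_image[OF g] by blast
      then have "b \<in> B" using permutes_inj[OF g] by (simp add: inj_image_mem_iff)
      then show False using \<open>b \<notin> B\<close> by blast
    qed
  qed (use no in blast)
  have alt: "Suc k \<le> 12 \<Longrightarrow> Suc k \<in> B \<longleftrightarrow> (even k \<longleftrightarrow> 1 \<in> B)" for k
  proof (induction k)
    case 0
    then show ?case by (simp add: One_nat_def)
  next
    case (Suc k)
    then have "g12 (Suc k) = Suc (Suc k)" by (simp add: cyc3_apply)
    then have "Suc (Suc k) \<in> B \<longleftrightarrow> Suc k \<notin> B"
      using flip[of "Suc k"] Suc.prems by (simp add: mem_pts)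
    moreover have "Suc k \<in> B \<longleftrightarrow> (even k \<longleftrightarrow> 1 \<in> B)" using Suc by simp
    moreover have "even (Suc k) \<longleftrightarrow> \<not> even k" by simp
    ultimately show ?case by blast
  qed
  have parity: "b \<in> B \<longleftrightarrow> b \<in> pts \<and> (odd b \<longleftrightarrow> 1 \<in> B)" for b
  proof (cases "b \<in> pts")
    case True
    then obtain k where "b = Suc k" by (cases b) (auto simp: mem_pts)
    then show ?thesis using alt[of k] True by (simp add: mem_pts)
  qed (use B in blast)
  then have "B = {k \<in> pts. odd k} \<or> B = {k \<in> pts. even k}"
  proof (cases "1 \<in> B")
    case True
    then have "B = {k \<in> pts. odd k}" using parity by blast
    then show ?thesis by blast
  next
    case False
    then have "B = {k \<in> pts. even k}" using parity by blast
    then show ?thesis by blast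
  qed
  then show ?thesis unfolding B_def by blast
qed

text \<open>By transitivity all blocks have the same size \<open>d\<close>, a divisor of 12. Types
  (3,4,5), (1,4,7) and (5,7) preserve no such system, and (2,5,5) only for \<open>d = 2\<close>.
  Group orders suffice except for \<open>d = 6\<close>, where the bound is attained.\<close>

lemma weight_imprimitive:
  assumes "perm_group pts H"
    and trans: "\<And>a b. a \<in> pts \<Longrightarrow> b \<in> pts \<Longrightarrow> \<exists>h\<in>H. h a = b"
    and imprim: "\<not> perm_group.primitive pts H"
  shows "weight H \<le> fact 12"
proof -
  interpret perm_group pts H by fact
  obtain R where R: "invariant_equiv R" and nontriv: "R \<noteq> Id_on pts" "R \<noteq> pts \<times> pts"
    using imprim unfolding primitive_def by blast
  have eq: "equiv pts R" and step: "\<And>h u v. h \<in> H \<Longrightarrow> (u, v) \<in> R \<Longrightarrow> (h u, h v) \<in> R"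
    using R unfolding invariant_equiv_def by blast+
  have Rsub: "R `` {a} \<subseteq> pts" for a using eq unfolding equiv_def by blast
  have refl: "a \<in> R `` {a}" if "a \<in> pts" for a using eq that unfolding equiv_def refl_on_def by blast
  have one: "1 \<in> pts" by (simp add: mem_pts)
  define d where "d = card (R `` {1})"
  have le: "card (R `` {a}) \<le> card (R `` {b})" if ab: "a \<in> pts" "b \<in> pts" for a b
  proof -
    obtain h where h: "h \<in> H" "h a = b" using trans[OF ab] by blast
    have "h ` (R `` {a}) \<subseteq> R `` {b}" using step[OF h(1)] h(2) by blast
    moreover have "inj_on h (R `` {a})" using inj_mem[OF h(1)] by (simp add: inj_on_def)
    moreover have "finite (R `` {b})" using Rsub finite_pts by (rule finite_subset)
    ultimately show ?thesis by (metis card_inj_on_le)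
  qed
  have d: "card (R `` {a}) = d" if "a \<in> pts" for a
    unfolding d_def using le[OF that one] le[OF one that] by (rule antisym)
  have bs: "block_system h d R" if "h \<in> H" for h
    unfolding block_system_def using eq step[OF that] d by blast
  have bs': "block_system g d {(u, v). (x u, x v) \<in> R}" if "x \<in> conjugators g H" for x g
  proof -
    have x: "x permutes pts" "x \<circ> g \<circ> inv' x \<in> H" using that unfolding conjugators_def by auto
    show ?thesis using block_system_conj[OF x(1) bs[OF x(2)]] .
  qed
  have finR: "finite (R `` {a})" for a using Rsub finite_pts by (rule finite_subset)
  have "d > 0" using refl[OF one] finR unfolding d_def by (auto simp: card_gt_0_iff)
  have "d dvd 12" using ex_block_enumeration(1)[OF finite_pts eq d \<open>d > 0\<close>] unfolding card_pts .
  have "d \<noteq> 1"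
  proof
    assume "d = 1"
    have single: "R `` {a} = {a}" if "a \<in> pts" for a
    proof (rule card_subset_eq[symmetric])
      show "card {a} = card (R `` {a})" using d[OF that] \<open>d = 1\<close> by simp
    qed (use refl[OF that] finR in auto)
    have "R = Id_on pts"
    proof
      show "R \<subseteq> Id_on pts"
      proof
        fix p assume p: "p \<in> R"
        then obtain u v where uv: "p = (u, v)" "u \<in> pts" using eq unfolding equiv_def by blast
        then have "v = u" using single[OF uv(2)] p by blast
        then show "p \<in> Id_on pts" using uv by blast
      qed
      show "Id_on pts \<subseteq> R" using refl by blast
    qed
    then show False using nontriv(1) by blast
  qed
  have "d \<noteq> 12"
  proof
    assume "d = 12"
    have full: "R `` {a} = pts" if "a \<in> pts" for a
      using card_subset_eq[OF finite_pts Rsub] d[OF that] \<open>d = 12\<close> card_pts by simp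
    have "R = pts \<times> pts"
    proof
      show "R \<subseteq> pts \<times> pts" using eq unfolding equiv_def by blast
      show "pts \<times> pts \<subseteq> R" using full by blast
    qed
    then show False using nontriv(2) by blast
  qed
  have "d \<le> 12" using \<open>d dvd 12\<close> by (simp add: dvd_imp_le)
  then have "d = 1 \<or> d = 2 \<or> d = 3 \<or> d = 4 \<or> d = 5 \<or> d = 6 \<or> d = 7 \<or> d = 8 \<or> d = 9 \<or> d = 10 \<or> d = 11 \<or> d = 12"
    using \<open>d > 0\<close> by presburger
  then have d_cases: "d = 2 \<or> d = 3 \<or> d = 4 \<or> d = 6"
    using \<open>d dvd 12\<close> \<open>d \<noteq> 1\<close> \<open>d \<noteq> 12\<close> by (elim disjE) simp_all
  have empty: "conjugators g H = {}" if "\<And>R. \<not> block_system g d R" for g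
    using bs' that by blast
  have dd: "2 \<le> d" "d \<le> 6" "d \<in> {2, 3, 4, 6}" using d_cases by auto
  have e345: "conjugators g345 H = {}" and e147: "conjugators g147 H = {}" and e57: "conjugators g57 H = {}"
    by (rule empty, rule no_block_system_g345 no_block_system_g147 no_block_system_g57; fact dd)+
  have cH: "card H \<le> (\<Prod>i<12. if i mod d = 0 then 12 - i else d - i mod d)"
    using card_imprimitive[OF R d \<open>d > 0\<close>] unfolding card_pts .
  note c12 = conjugators_bound[OF finite_H card_centralizer_g12]
  note N12 = card_conjugates_in_le[OF finite_H, of g12]
  from d_cases consider "d = 2" | "d = 3 \<or> d = 4" | "d = 6" by blast
  then show ?thesis
  proof cases
    case 1
    \<comment> \<open>46080 = 2^6 * 6!.\<close>
    have "card H \<le> 46080"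
      using cH unfolding 1 by (simp add: lessThan_nat_numeral lessThan_Suc)
    have "{x \<in> pts. \<not> cyc_len 12 12 x dvd 5} = pts" "{x \<in> pts. \<not> cyc_len 2 7 x dvd 5} = {1, 2}"
      by (auto simp: cyc_len_def mem_pts)
    then have "card (moved (g12 ^^ 5)) \<noteq> card (moved (g255 ^^ 5))"
      by (simp add: moved_funpow_cyc3 card_pts)
    then have "card (conjugates_in g12 H) + card (conjugates_in g255 H) \<le> card H"
      by (rule card_conjugates_disjoint[OF finite_H])
    moreover have "card (conjugators g255 H) \<le> 100 * card (conjugates_in g255 H)"
      by (rule conjugators_bound[OF finite_H card_centralizer_g255])
    \<comment> \<open>An element of type (2,5,5) contributes up to 66 * 100 = 6600, a 12-cycle only
      462 * 12 = 5544. The classes are disjoint, so 6600 per element of \<open>H\<close> is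
      enough.\<close>
    ultimately have "weight H \<le> 6600 * 46080"
      unfolding weight_def e345 e147 e57 using c12 \<open>card H \<le> 46080\<close> by simp
    then show ?thesis by (simp add: fact_numeral)
  next
    case 2
    \<comment> \<open>82944 = (4!)^3 * 3! comes from blocks of size 4; blocks of size 3 give only
      (3!)^4 * 4! = 31104.\<close>
    have "card H \<le> 82944"
      using cH 2 by (elim disjE) (simp_all add: lessThan_nat_numeral lessThan_Suc)
    moreover have "conjugators g255 H = {}"
      by (rule empty, rule no_block_system_g255) (use 2 in auto)
    ultimately have "weight H \<le> 5544 * 82944"
      unfolding weight_def e345 e147 e57 using c12 N12 by simp
    then show ?thesis by (simp add: fact_numeral)
  next
    case 3
    have e255: "conjugators g255 H = {}"
      by (rule empty, rule no_block_system_g255) (use 3 in auto)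
    \<comment> \<open>The order 2 * (6!)^2 of the group is too large here. Instead the conjugators
      are counted by where a block goes: its preimage is one of the two parity classes, and 462 * 2
      * (6!)^2 is exactly 12!.\<close>
    let ?A = "R `` {1}" and ?B = "{{k \<in> pts. odd k}, {k \<in> pts. even k}}"
    have "inv' x ` ?A \<in> ?B" if x: "x \<in> conjugators g12 H" for x
    proof -
      have px: "x permutes pts" using x unfolding conjugators_def by blast
      note inv = permutes_inverses[OF px]
      let ?R = "{(u, v). (x u, x v) \<in> R}"
      have "inv' x ` ?A = ?R `` {inv' x 1}"
      proof
        show "inv' x ` ?A \<subseteq> ?R `` {inv' x 1}" using inv by auto
        show "?R `` {inv' x 1} \<subseteq> inv' x ` ?A"
        proof
          fix v assume "v \<in> ?R `` {inv' x 1}"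
          then have "x v \<in> ?A" using inv by simp
          then have "inv' x (x v) \<in> inv' x ` ?A" by (rule imageI)
          then show "v \<in> inv' x ` ?A" using inv by simp
        qed
      qed
      moreover have "inv' x 1 \<in> pts" using permutes_in_image[OF permutes_inv[OF px]] one by blast
      ultimately show ?thesis
        using two_blocks_g12[of ?R "inv' x 1"] bs'[OF x] 3 by simp
    qed
    then have "card (conjugators g12 H) \<le> card ?B * (fact (card ?A) * fact (12 - card ?A))"
      by (intro card_conjugators_image_in Rsub) simp_all
    also have "\<dots> \<le> 2 * (fact 6 * fact 6)"
    proof -
      have "card ?A = 6" using 3 d_def by simp
      moreover have "card ?B \<le> 2" using card_length[of "[{k \<in> pts. odd k}, {k \<in> pts. even k}]"] by simp
      ultimately show ?thesis by simp
    qed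
    finally have "card (conjugators g12 H) \<le> 1036800" by (simp add: fact_numeral)
    then show ?thesis unfolding weight_def e345 e147 e57 e255 by (simp add: fact_numeral)
  qed
qed

section \<open>Primitive groups\<close>

text \<open>A 12-cycle has neither fixed points nor 2-cycles, which leaves 11 and then 10 choices for
  the images of the first two points of the base.\<close>

lemma card_conjugates_g12:
  assumes "perm_group pts H" and base: "perm_group.is_base pts H B" and card_B: "card B = 5"
  shows "card (conjugates_in g12 H) \<le> 79200"
proof -
  interpret perm_group pts H by fact
  let ?X = "conjugates_in g12 H"
  have XH: "?X \<subseteq> H" unfolding conjugates_in_def by blast
  have no_fix: "(h ^^ n) y \<noteq> y" if h: "h \<in> ?X" and y: "y \<in> pts" and n: "\<not> 12 dvd n" for h y n
  proof -
    have "moved (h ^^ n) \<subseteq> pts" using moved_subset funpow_mem h XH by blast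
    moreover have "moved (g12 ^^ n) = pts"
      unfolding moved_funpow_cyc3[OF le_refl le_refl] using n by (auto simp: cyc_len_def mem_pts)
    then have "card (moved (h ^^ n)) = card pts" using conjugates_in_moved[OF h] by simp
    ultimately have "moved (h ^^ n) = pts" using card_subset_eq[OF finite_pts] by blast
    then show ?thesis using y unfolding moved_def by blast
  qed
  have no1: "h y \<noteq> y" if "h \<in> ?X" "y \<in> pts" for h y
    using no_fix[OF that, of "Suc 0"] by simp
  have no2: "h (h y) \<noteq> y" if "h \<in> ?X" "y \<in> pts" for h y
    using no_fix[OF that, of 2] by (simp add: numeral_2_eq_2[symmetric]) (simp add: numeral_2_eq_2)
  have B: "B \<subseteq> pts" using base unfolding is_base_def by blast
  then have "finite B" using finite_pts by (rule finite_subset)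
  then obtain l :: "nat \<Rightarrow> nat" where l: "bij_betw l {..<5} B"
    using ex_bij_lessThan[of B] unfolding card_B by blast
  have lS: "l i \<in> pts" if "i < 5" for i using l B that unfolding bij_betw_def by blast
  have linj: "l i = l j \<longleftrightarrow> i = j" if "i < 5" "j < 5" for i j
    using inj_on_eq_iff[OF bij_betw_imp_inj_on[OF l], of i j] that by simp
  have "card ?X \<le> (\<Prod>i<5. [11, 10, 10, 9, 8] ! i)"
  proof (rule card_le_prod_choices[of _ _ l])
    show "finite ?X" using XH finite_H by (rule finite_subset)
    fix f h assume fh: "f \<in> ?X" "h \<in> ?X" "\<And>i. i < 5 \<Longrightarrow> f (l i) = h (l i)"
    then have "f \<in> H" "h \<in> H" using XH by blast+
    then show "f = h" using fh(3) by (rule base_eqI[OF base l])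
  next
    fix f i assume f: "f \<in> ?X" and i: "i < (5::nat)"
    have fH: "f \<in> H" using f XH by blast
    consider "i = 0" | "i = 1" | "i \<ge> 2" by linarith
    then show "\<exists>T. finite T \<and> card T \<le> [11, 10, 10, 9, 8] ! i \<and> (\<forall>h\<in>?X. (\<forall>j<i. h (l j) = f (l j)) \<longrightarrow> h (l i) \<in> T)"
    proof cases
      case 1
      have "card (pts - {l 0}) = 11" using lS[of 0] finite_pts card_pts by simp
      moreover have "h (l 0) \<in> pts - {l 0}" if "h \<in> ?X" for h
        using no1[OF that lS[of 0]] mem_S_iff[of h "l 0"] lS[of 0] that XH by auto
      ultimately show ?thesis
        unfolding 1 using finite_pts by (intro exI[of _ "pts - {l 0}"]) simp
    next
      case 2
      \<comment> \<open>Besides \<open>l 1\<close>, one more value is impossible: \<open>l 0\<close>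
        if \<open>f\<close> maps \<open>l 0\<close> to \<open>l 1\<close>, since that would close a
        2-cycle, and otherwise \<open>f (l 0)\<close> by injectivity.\<close>
      define z where "z = (if f (l 0) = l 1 then l 0 else f (l 0))"
      have z: "z \<in> pts" "z \<noteq> l 1"
        using lS[of 0] mem_S_iff[OF fH] linj[of 0 1] unfolding z_def by auto
      have "card (pts - {l 1, z}) = 10" using lS[of 1] z finite_pts card_pts by simp
      moreover have "h (l 1) \<in> pts - {l 1, z}" if h: "h \<in> ?X" "h (l 0) = f (l 0)" for h
      proof -
        have hH: "h \<in> H" using h(1) XH by blast
        have "h (l 1) \<in> pts" using mem_S_iff[OF hH] lS[of 1] by simp
        moreover have "h (l 1) \<noteq> l 1" using no1[OF h(1) lS[of 1]] by simp
        moreover have "h (l 1) \<noteq> z"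
        proof (cases "f (l 0) = l 1")
          case True
          have "h (h (l 0)) \<noteq> l 0" using no2[OF h(1) lS[of 0]] by simp
          then show ?thesis using True h(2) unfolding z_def by simp
        next
          case False
          have "h (l 1) \<noteq> h (l 0)" using inj_mem[OF hH] linj[of 1 0] by simp
          then show ?thesis using False h(2) unfolding z_def by simp
        qed
        ultimately show ?thesis by blast
      qed
      ultimately show ?thesis
        unfolding 2 using finite_pts by (intro exI[of _ "pts - {l 1, z}"]) simp
    next
      case 3
      have l': "inj_on l {..<5}" "l ` {..<5} \<subseteq> pts"
        using l B unfolding bij_betw_def by simp_all
      note new = image_of_new_point[OF fH l' i]
      have "i = 2 \<or> i = 3 \<or> i = 4" using i 3 by linarith
      then have "card (pts - (\<lambda>j. f (l j)) ` {..<i}) \<le> [11, 10, 10, 9, 8] ! i"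
        unfolding new(1) card_pts by (elim disjE) simp_all
      then show ?thesis
        using new(2) XH finite_pts by (intro exI[of _ "pts - (\<lambda>j. f (l j)) ` {..<i}"]) auto
    qed
  qed
  also have "\<dots> = 79200" by (simp add: lessThan_nat_numeral lessThan_Suc)
  finally show ?thesis .
qed

lemma evenperm_conjugate:
  assumes "x permutes pts" "g permutes pts"
  shows "evenperm (x \<circ> g \<circ> inv' x) \<longleftrightarrow> evenperm g"
proof -
  have p: "permutation x" "permutation g" using assms finite_pts permutation_permutes by blast+
  have "permutation (inv' x)" using p(1) by (rule permutation_inverse)
  then show ?thesis
    using p by (auto simp: evenperm_comp permutation_compose evenperm_inv)
qed

text \<open>Of the five cycle types only (5,7) is even, and its coefficient is 1.\<close>

lemma weight_all_even:
  assumes "\<And>h. h \<in> H \<Longrightarrow> evenperm h"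
  shows "weight H \<le> fact 12"
proof -
  have empty: "conjugators (cyc3 i j) H = {}"
    if ij: "i \<le> j" "j \<le> 12" and odd: "\<not> even ((i - 1) + (j - i - 1) + (12 - j - 1))" for i j
  proof (rule ccontr)
    assume "conjugators (cyc3 i j) H \<noteq> {}"
    then obtain x where x: "x permutes pts" "x \<circ> cyc3 i j \<circ> inv' x \<in> H" unfolding conjugators_def by blast
    then have "evenperm (cyc3 i j)"
      using assms evenperm_conjugate[OF x(1) cyc3_permutes[OF ij]] by blast
    then show False using odd cyc3_evenperm[OF ij] by blast
  qed
  have "conjugators g12 H = {}" "conjugators g345 H = {}" "conjugators g255 H = {}" "conjugators g147 H = {}"
    by (rule empty; simp)+
  then show ?thesis unfolding weight_def using card_conjugators_le[of g57 H] by simp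
qed

lemma weight_primitive:
  assumes "perm_group pts H" and prim: "perm_group.primitive pts H"
    and proper: "H \<noteq> {p. p permutes pts}"
  shows "weight H \<le> fact 12"
proof -
  interpret perm_group pts H by fact
  show ?thesis
  proof (cases three_cycle_free)
    case False
    have "carrier (alt_group 12) \<subseteq> H"
    proof (rule alt_group_subset)
      show "perm_group {1..12} H" using assms(1) unfolding pts_def .
      show "rot3 a b c \<in> H" if "distinct [a, b, c]" "{a, b, c} \<subseteq> {1..12}" for a b c
        using primitive_all_three_cycles[OF prim False that(1)] that(2) unfolding pts_def .
    qed
    then have alt: "p \<in> H" if "p permutes pts" "evenperm p" for p
      using that alt_group_carrier[of p 12] unfolding pts_def by blast
    have "evenperm h" if h: "h \<in> H" for h
    proof (rule ccontr)
      assume odd: "\<not> evenperm h"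
      have perm: "permutation q" if "q permutes pts" for q
        using that finite_pts permutation_permutes by blast
      have "p \<in> H" if p: "p permutes pts" for p
      proof (cases "evenperm p")
        case True
        then show ?thesis using alt p by blast
      next
        case False
        have "evenperm (p \<circ> inv' h)"
          using evenperm_comp[OF perm[OF p] permutation_inverse[OF perm[OF permutes[OF h]]]]
            evenperm_inv[OF perm[OF permutes[OF h]]] False odd by simp
        moreover have "p \<circ> inv' h permutes pts"
          using permutes_compose[OF permutes_inv[OF permutes[OF h]] p] .
        ultimately have "p \<circ> inv' h \<circ> h \<in> H" using alt by (intro comp_mem[OF _ h]) blast
        moreover have "p \<circ> inv' h \<circ> h = p"
          using permutes_inverses[OF permutes[OF h]] by (simp add: fun_eq_iff)
        ultimately show ?thesis by simp
      qed
      then show False using proper permutes by blast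
    qed
    then show ?thesis by (rule weight_all_even)
  next
    case free: True
    have "conjugates_in g345 H = {}"
    proof (rule ccontr)
      assume "conjugates_in g345 H \<noteq> {}"
      then obtain h where h: "h \<in> conjugates_in g345 H" by blast
      then have "h \<in> H" unfolding conjugates_in_def by blast
      \<comment> \<open>20 is divisible by 4 and 5 but not by 3, so the 20th power is a
        3-cycle.\<close>
      have "{x \<in> pts. \<not> cyc_len 3 7 x dvd 20} = {1, 2, 3}"
        by (auto simp: cyc_len_def mem_pts)
      then have "card (moved (g345 ^^ 20)) = 3" by (simp add: moved_funpow_cyc3)
      then have "card (moved (h ^^ 20)) = 3" using conjugates_in_moved[OF h] by simp
      then show False using card_moved_3[OF free funpow_mem[OF \<open>h \<in> H\<close>]] by blast
    qed
    then have e345: "conjugators g345 H = {}" by (simp add: conjugators_empty_iff)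
    have "conjugates_in g255 H = {}"
    proof (rule ccontr)
      assume "conjugates_in g255 H \<noteq> {}"
      then obtain h where h: "h \<in> conjugates_in g255 H" by blast
      then have "h \<in> H" unfolding conjugates_in_def by blast
      \<comment> \<open>The fifth power of an element of type (2,5,5) is a transposition.\<close>
      have "{x \<in> pts. \<not> cyc_len 2 7 x dvd 5} = {1, 2}"
        by (auto simp: cyc_len_def mem_pts)
      then have "card (moved (g255 ^^ 5)) = 2" by (simp add: moved_funpow_cyc3)
      then have "card (moved (h ^^ 5)) = 2" using conjugates_in_moved[OF h] by simp
      then obtain a b where ab: "a \<noteq> b" "h ^^ 5 = transpose a b"
        using card_moved_2_transpose[OF funpow_mem[OF \<open>h \<in> H\<close>]] by metis
      have "transpose a b \<in> H" using funpow_mem[OF \<open>h \<in> H\<close>, of 5] unfolding ab(2) .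
      then show False using primitive_transposition[OF prim _ ab(1)] free card_pts by simp
    qed
    then have e255: "conjugators g255 H = {}" by (simp add: conjugators_empty_iff)
    have c147: "card (conjugators g147 H) \<le> 28 * card (conjugates_in g147 H)"
      by (rule conjugators_bound[OF finite_H card_centralizer_g147])
    have c57: "card (conjugators g57 H) \<le> 35 * card (conjugates_in g57 H)"
      by (rule conjugators_bound[OF finite_H card_centralizer_g57])
    have c12: "card (conjugators g12 H) \<le> 12 * card (conjugates_in g12 H)"
      by (rule conjugators_bound[OF finite_H card_centralizer_g12])
    have "{x \<in> pts. \<not> cyc_len 1 5 x dvd 4} = {6..12}" "{x \<in> pts. \<not> cyc_len 5 5 x dvd 4} = pts"
      by (auto simp: cyc_len_def mem_pts)
    then have "card (moved (g147 ^^ 4)) \<noteq> card (moved (g57 ^^ 4))"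
      by (simp add: moved_funpow_cyc3 card_pts)
    then have "card (conjugates_in g147 H) + card (conjugates_in g57 H) \<le> card H"
      by (rule card_conjugates_disjoint[OF finite_H])
    \<comment> \<open>5544 = 462 * 12 and 336 = 12 * 28; the factor 35 of type (5,7) is smaller than
      336.\<close>
    then have w: "weight H \<le> 5544 * card (conjugates_in g12 H) + 336 * card H"
      unfolding weight_def e345 e255 using c147 c57 c12 by simp
    show ?thesis
    proof (cases "conjugates_in g12 H = {}")
      case True
      obtain B where B: "is_base B" "2 * card B \<le> card pts"
        using ex_small_base[OF free] by blast
      have "card H \<le> (\<Prod>i<card B. 12 - i)" using card_le_base[OF B(1)] unfolding card_pts .
      also have "\<dots> \<le> 665280"
      proof -
        have "card B = 0 \<or> card B = 1 \<or> card B = 2 \<or> card B = 3 \<or> card B = 4 \<or> card B = 5 \<or> card B = 6"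
          using B(2) unfolding card_pts by linarith
        then show ?thesis by (elim disjE) (simp_all add: lessThan_nat_numeral lessThan_Suc One_nat_def)
      qed
      finally have "weight H \<le> 336 * 665280" using w True by simp
      then show ?thesis by (simp add: fact_numeral)
    next
      case False
      then obtain h x where h: "h \<in> H" and x: "x permutes pts" and hx: "h = x \<circ> g12 \<circ> inv' x"
        unfolding conjugates_in_def by blast
      interpret primitive_12_cycle pts H h "\<lambda>i. x (Suc i)"
      proof
        have "bij_betw Suc {..<12} pts"
          by (rule bij_betwI[where g = "\<lambda>k. k - 1"]) (auto simp: mem_pts One_nat_def)
        then show "bij_betw (\<lambda>i. x (Suc i)) {..<12} pts"
          using bij_betw_trans[OF _ permutes_imp_bij[OF x], of Suc "{..<12}"] by (simp add: comp_def)
        fix i :: nat assume i: "i < 12"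
        have "g12 (Suc i) = Suc (Suc i mod 12)"
          using i by (cases "i = 11") (simp_all add: cyc3_apply)
        then show "h (x (Suc i)) = x (Suc (Suc i mod 12))"
          unfolding hx using permutes_inverses[OF x] by simp
      qed (fact h prim free)+
      obtain B where B: "is_base B" "card B = 5"
        using ex_base_5 by blast
      have "card H \<le> (\<Prod>i<5. 12 - i)" using card_le_base[OF B(1)] unfolding card_pts B(2) .
      also have "\<dots> = 95040" by (simp add: lessThan_nat_numeral lessThan_Suc)
      finally have "card H \<le> 95040" .
      moreover have "card (conjugates_in g12 H) \<le> 79200"
        by (rule card_conjugates_g12[OF assms(1) B])
      \<comment> \<open>The order bound 95040 alone would not do for the 12-cycles: 5544 * 95040
        exceeds 12!.\<close>
      ultimately have "weight H \<le> 5544 * 79200 + 336 * 95040" using w by linarith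
      then show ?thesis by (simp add: fact_numeral)
    qed
  qed
qed

lemma weight_proper:
  assumes "perm_group pts H" and proper: "H \<noteq> {p. p permutes pts}"
  shows "weight H \<le> fact 12"
proof -
  interpret perm_group pts H by fact
  show ?thesis
  proof (cases "\<forall>a\<in>pts. \<forall>b\<in>pts. \<exists>h\<in>H. h a = b")
    case True
    then show ?thesis using weight_primitive[OF assms(1) _ proper] weight_imprimitive[OF assms(1)] by blast
  next
    case False
    then obtain a b where ab: "a \<in> pts" "b \<in> pts" "\<And>h. h \<in> H \<Longrightarrow> h a \<noteq> b" by blast
    define A where "A = {h a | h. h \<in> H}"
    have "A \<subseteq> pts" unfolding A_def using mem_S_iff ab(1) by blast
    moreover have "a \<in> A" unfolding A_def using id_mem by (metis (mono_tags, lifting) id_apply mem_Collect_eq)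
    moreover have "b \<notin> A" unfolding A_def using ab(3) by blast
    moreover have "h ` A = A" if h: "h \<in> H" for h
    proof (rule endo_inj_surj)
      show "finite A" using \<open>A \<subseteq> pts\<close> finite_pts by (rule finite_subset)
      show "h ` A \<subseteq> A"
      proof (rule image_subsetI)
        fix y assume "y \<in> A"
        then obtain f where f: "f \<in> H" "y = f a" unfolding A_def by blast
        then have "h y = (h \<circ> f) a" by simp
        then show "h y \<in> A" unfolding A_def using comp_mem[OF h f(1)] by blast
      qed
      show "inj_on h A" using inj_mem[OF h] by (simp add: inj_on_def)
    qed
    ultimately show ?thesis
      using weight_intransitive[of A H] permutes ab(2) by blast
  qed
qed

section \<open>The optimal cover\<close>

lemma invariant_complement:
  assumes "p permutes S" "A \<subseteq> S" "p ` A = A" shows "p ` (S - A) = S - A"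
  using image_set_diff[OF permutes_inj[OF assms(1)], of S A] permutes_image[OF assms(1)] assms(3) by simp

text \<open>Colour the points of each cycle alternately; this is consistent because the cycle
  lengths are even.\<close>

lemma all_orbits_even_halves:
  assumes p: "p permutes S" "finite S" and even: "\<And>x. x \<in> S \<Longrightarrow> even (least_power p x)"
  shows "\<exists>A\<subseteq>S. p ` A = S - A"
proof -
  \<comment> \<open>The choice depends on the orbit as a set only, so \<open>r\<close> is constant
    on orbits. Parity is measured from this point.\<close>
  define r where "r x = (SOME y. y \<in> orb p x)" for x
  have r: "r x \<in> orb p x" for x
    unfolding r_def using orb_self by (rule someI)
  define A where "A = {x \<in> S. \<exists>k. x = (p ^^ (2 * k)) (r x)}"
  have r_step: "r (p x) = r x" for x
  proof -
    have "p x \<in> orb p x" using imageI[OF orb_self[of x p], of p] unfolding orb_image[OF p] .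
    then have "orb p (p x) = orb p x" by (rule orb_eq[OF p])
    then show ?thesis unfolding r_def by simp
  qed
  have mem: "p x \<in> S \<longleftrightarrow> x \<in> S" for x using permutes_in_image[OF p(1)] .
  have flip: "p x \<in> A \<longleftrightarrow> x \<notin> A" if x: "x \<in> S" for x
  proof -
    have "orb p (r x) = orb p x" using orb_eq[OF p r] .
    then have "x \<in> orb p (r x)" by (simp only: orb_self)
    then obtain j where j: "x = (p ^^ j) (r x)" unfolding orb_def by blast
    have lp: "even (least_power p (r x))"
    proof -
      have "card (orb p (r x)) = card (orb p x)" using orb_eq[OF p r] by simp
      then show ?thesis using even[OF x] unfolding card_orb[OF p] by simp
    qed
    have *: "(\<exists>k. (p ^^ i) (r x) = (p ^^ (2 * k)) (r x)) \<longleftrightarrow> even i" for i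
    proof
      assume "\<exists>k. (p ^^ i) (r x) = (p ^^ (2 * k)) (r x)"
      then obtain k where "i mod least_power p (r x) = 2 * k mod least_power p (r x)"
        unfolding funpow_eq_iff_mod[OF p] by blast
      then show "even i" using lp by (metis dvd_mod_iff dvd_triv_left)
    next
      assume "even i"
      then obtain k where "i = 2 * k" by (rule evenE)
      then show "\<exists>k. (p ^^ i) (r x) = (p ^^ (2 * k)) (r x)" by blast
    qed
    have "x \<in> A \<longleftrightarrow> (\<exists>k. x = (p ^^ (2 * k)) (r x))"
      unfolding A_def using x by simp
    then have 1: "x \<in> A \<longleftrightarrow> even j" using *[of j] unfolding j[symmetric] by blast
    have px: "(p ^^ Suc j) (r x) = p x" using j by (simp only: funpow.simps comp_apply)
    have "p x \<in> A \<longleftrightarrow> (\<exists>k. p x = (p ^^ (2 * k)) (r x))"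
      unfolding A_def using x mem by (simp add: r_step)
    then have "p x \<in> A \<longleftrightarrow> even (Suc j)" using *[of "Suc j"] unfolding px by blast
    then show ?thesis using 1 by simp
  qed
  have "p ` A = S - A"
  proof
    show "p ` A \<subseteq> S - A" using flip mem unfolding A_def by blast
    show "S - A \<subseteq> p ` A"
    proof
      fix y assume y: "y \<in> S - A"
      then obtain x where x: "x \<in> S" "y = p x" using permutes_image[OF p(1)] by blast
      then show "y \<in> p ` A" using flip y by blast
    qed
  qed
  moreover have "A \<subseteq> S" unfolding A_def by blast
  ultimately show ?thesis by blast
qed

lemma evenperm_if_odd_order:
  assumes "permutation p" "p ^^ n = id" "odd n" shows "evenperm p"
proof (rule ccontr)
  assume odd: "\<not> evenperm p"
  have "permutation (p ^^ k) \<and> (evenperm (p ^^ k) \<longleftrightarrow> even k)" for k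
  proof (induction k)
    case 0
    show ?case unfolding funpow.simps by simp
  next
    case (Suc k)
    then have k: "permutation (p ^^ k)" "evenperm (p ^^ k) \<longleftrightarrow> even k" by blast+
    show ?case
      unfolding funpow.simps evenperm_comp[OF assms(1) k(1)] k(2)
      using permutation_compose[OF assms(1) k(1)] odd by (intro conjI) (assumption, simp)
  qed
  from this[of n] show False using assms(2,3) by simp
qed

lemma odd_size_cases:
  fixes n :: nat
  shows "n \<le> 12 \<Longrightarrow> n \<notin> {1, 2, 3} \<Longrightarrow> n \<notin> {9, 10, 11} \<Longrightarrow> odd n \<Longrightarrow> n = 5 \<or> n = 7"
  unfolding insert_iff empty_iff by presburger

lemma part_size_eq:
  fixes m n :: nat
  assumes "n = 5 \<or> n = 7" "0 < m" "m \<le> n" "m \<notin> {1, 2, 3}" "n - m \<notin> {1, 2, 3}"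
  shows "m = n"
  using assms unfolding insert_iff empty_iff by presburger

text \<open>If some cycle has odd length and no invariant set has size 1, 2 or 3, then the cycle type
  is (5,7) and the permutation has odd order.\<close>

lemma odd_permutation_cases:
  assumes p: "p permutes pts" and odd: "\<not> evenperm p"
  shows "(\<exists>A\<subseteq>pts. card A \<in> {1, 2, 3} \<and> p ` A = A) \<or> (\<exists>A\<subseteq>pts. card A = 6 \<and> p ` A = pts - A)"
proof (rule ccontr)
  assume neg: "\<not> ?thesis"
  note pf = p finite_pts
  have small: "card A \<notin> {1, 2, 3}" if "A \<subseteq> pts" "p ` A = A" for A
  proof
    assume "card A \<in> {1, 2, 3}"
    then have "\<exists>A\<subseteq>pts. card A \<in> {1, 2, 3} \<and> p ` A = A"
      using that by (intro exI[of _ A] conjI)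
    with neg show False by (rule notE[OF _ disjI1])
  qed
  have large: "card A \<notin> {9, 10, 11}" if A: "A \<subseteq> pts" "p ` A = A" for A
  proof -
    have "card (pts - A) = 12 - card A"
      using card_Diff_subset[OF finite_subset[OF A(1) finite_pts] A(1)] card_pts by simp
    moreover have "card (pts - A) \<notin> {1, 2, 3}" by (rule small[OF Diff_subset invariant_complement[OF p A]])
    ultimately show ?thesis by auto
  qed
  have orb_pts: "orb p x \<subseteq> pts" if "x \<in> pts" for x
    by (rule orb_subset[OF pf _ that]) (simp add: permutes_image[OF p])
  note orb_inv = orb_image[OF pf]
  show False
  proof (cases "\<forall>x\<in>pts. even (least_power p x)")
    case True
    then obtain A where A: "A \<subseteq> pts" "p ` A = pts - A" using all_orbits_even_halves[OF pf bspec[OF True]] by blast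
    have "card (p ` A) = card A"
      using permutes_inj[OF p] by (intro card_image) (rule inj_on_subset, auto)
    moreover have "card (pts - A) = 12 - card A"
      using card_Diff_subset[OF finite_subset[OF A(1) finite_pts] A(1)] card_pts by simp
    moreover have "card A \<le> 12" using card_mono[OF finite_pts A(1)] card_pts by simp
    ultimately have "card A = 6" using A(2) by simp
    then have "\<exists>A\<subseteq>pts. card A = 6 \<and> p ` A = pts - A"
      using A by (intro exI[of _ A] conjI)
    with neg show False by (rule notE[OF _ disjI2])
  next
    case False
    then have "\<exists>x\<in>pts. odd (least_power p x)" by (simp only: ball_simps not_not simp_thms)
    then obtain x where x: "x \<in> pts" "odd (least_power p x)" by (rule bexE)
    let ?O = "orb p x"
    have O: "?O \<subseteq> pts" "p ` ?O = ?O" by (rule orb_pts[OF x(1)], rule orb_inv)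
    have cardO: "card ?O = least_power p x" by (rule card_orb[OF pf])
    have "card ?O \<le> 12" using card_mono[OF finite_pts O(1)] card_pts by simp
    then have O57: "card ?O = 5 \<or> card ?O = 7"
      using odd_size_cases small[OF O] large[OF O] x(2) unfolding cardO[symmetric] by blast
    define C where "C = pts - ?O"
    have C: "C \<subseteq> pts" "p ` C = C" unfolding C_def using invariant_complement[OF p O] by auto
    have cardC: "card C = 12 - card ?O"
      unfolding C_def using card_Diff_subset[OF finite_subset[OF O(1) finite_pts] O(1)] card_pts by simp
    \<comment> \<open>\<open>C\<close> has 7 or 5 points and is a single cycle: a shorter invariant
      part and its remainder in \<open>C\<close> cannot both avoid the sizes 1, 2 and 3.\<close>
    have lpC: "least_power p y = card C" if y: "y \<in> C" for y
    proof -
      have yC: "orb p y \<subseteq> C" using orb_subset[OF pf _ y] C(2) by simp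
      have "y \<in> pts" using y C(1) by blast
      have s1: "card (orb p y) \<notin> {1, 2, 3}" using small[OF orb_pts[OF \<open>y \<in> pts\<close>] orb_inv] .
      have finC: "finite C" using C(1) finite_pts by (rule finite_subset)
      have "p ` (C - orb p y) = C - orb p y"
        using image_set_diff[OF permutes_inj[OF p], of C "orb p y"] C(2) orb_inv by simp
      moreover have "C - orb p y \<subseteq> pts" using C(1) by blast
      ultimately have s2: "card (C - orb p y) \<notin> {1, 2, 3}" using small by blast
      have "card (C - orb p y) = card C - card (orb p y)"
        using card_Diff_subset[OF finite_subset[OF yC finC] yC] .
      moreover have "card (orb p y) \<le> card C" using card_mono[OF finC yC] .
      moreover have "card (orb p y) > 0" using card_orb[OF pf, of y] least_power_pos[OF pf, of y] by simp
      moreover have "card C = 5 \<or> card C = 7" using O57 cardC by auto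
      ultimately have "card (orb p y) = card C"
        using s1 s2 by (intro part_size_eq) simp_all
      then show ?thesis using card_orb[OF pf, of y] by simp
    qed
    have "p ^^ 35 = id"
    proof
      fix y
      show "(p ^^ 35) y = id y"
      proof (cases "y \<in> pts")
        case False
        then show ?thesis using permutes_not_in[OF permutes_funpow[OF p]] by simp
      next
        case True
        have "least_power p y dvd 35"
        proof (cases "y \<in> ?O")
          case True
          then have "least_power p y = card ?O" using card_orb[OF pf, of y] orb_eq[OF pf True] by simp
          then show ?thesis using O57 by auto
        next
          case False
          then have "least_power p y = card C" using lpC True unfolding C_def by blast
          then show ?thesis using O57 cardC by auto
        qed
        then show ?thesis using funpow_eq_iff_least_power[OF pf] by simp
      qed
    qed
    moreover have "permutation p" using p finite_pts permutation_permutes by blast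
    ultimately show False using evenperm_if_odd_order[of p 35] odd by simp
  qed
qed

section \<open>Lower bound for covers and construction of the optimal one\<close>

lemma carrier_sym_group_12: "carrier (sym_group 12) = {p. p permutes pts}"
  unfolding sym_group_def pts_def by simp

lemma subgroup_iff_perm_group: "subgroup H (sym_group 12) \<longleftrightarrow> perm_group pts H"
proof
  assume H: "subgroup H (sym_group 12)"
  have carrier: "h \<in> carrier (sym_group 12)" if "h \<in> H" for h using subgroup.subset[OF H] that by blast
  show "perm_group pts H"
  proof
    show "finite pts" by (rule finite_pts)
    show "h permutes pts" if "h \<in> H" for h using carrier[OF that] unfolding carrier_sym_group_12 by blast
    show "id \<in> H" using subgroup.one_closed[OF H] unfolding sym_group_one .
    show "g \<circ> h \<in> H" if "g \<in> H" "h \<in> H" for g h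
      using subgroup.m_closed[OF H that] unfolding sym_group_mult .
    show "inv' h \<in> H" if "h \<in> H" for h
      using subgroup.m_inv_closed[OF H that] unfolding sym_group_inv_equality[OF carrier[OF that]] .
  qed
next
  assume "perm_group pts H"
  then interpret perm_group pts H .
  have carrier: "h \<in> carrier (sym_group 12)" if "h \<in> H" for h
    using permutes[OF that] unfolding carrier_sym_group_12 by blast
  show "subgroup H (sym_group 12)"
  proof
    show "H \<subseteq> carrier (sym_group 12)" using carrier by blast
    show "x \<otimes>\<^bsub>sym_group 12\<^esub> y \<in> H" if "x \<in> H" "y \<in> H" for x y
      unfolding sym_group_mult using comp_mem[OF that] .
    show "\<one>\<^bsub>sym_group 12\<^esub> \<in> H" unfolding sym_group_one by (rule id_mem)
    show "inv\<^bsub>sym_group 12\<^esub> x \<in> H" if "x \<in> H" for x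
      unfolding sym_group_inv_equality[OF carrier[OF that]] using inv_mem[OF that] .
  qed
qed

text \<open>Every permutation conjugates each representative into some member of the cover, so for
  each type the numbers of conjugators add up to at least 12!. Summing with coefficients of total
  761 and bounding every member's weight by 12! gives the claim.\<close>

lemma card_cover_ge:
  assumes "group_cover (sym_group 12) \<A>"
  shows "761 \<le> card \<A>"
proof -
  have fin: "finite \<A>" and cov: "{p. p permutes pts} = \<Union>\<A>"
    and sub: "\<And>H. H \<in> \<A> \<Longrightarrow> perm_group pts H \<and> H \<noteq> {p. p permutes pts}"
    using assms unfolding group_cover_def carrier_sym_group_12 subgroup_iff_perm_group by blast+
  have total: "fact 12 \<le> (\<Sum>H\<in>\<A>. card (conjugators g H))" if g: "g permutes pts" for g
  proof -
    have "{x. x permutes pts} \<subseteq> (\<Union>H\<in>\<A>. conjugators g H)"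
    proof
      fix x assume "x \<in> {x. x permutes pts}"
      then have x: "x permutes pts" by simp
      have "x \<circ> g \<circ> inv' x permutes pts"
        using permutes_compose[OF permutes_inv[OF x] permutes_compose[OF g x]] .
      then have "x \<circ> g \<circ> inv' x \<in> \<Union>\<A>" using cov by blast
      then show "x \<in> (\<Union>H\<in>\<A>. conjugators g H)" unfolding conjugators_def using x by blast
    qed
    then have "card {x. x permutes pts} \<le> card (\<Union>H\<in>\<A>. conjugators g H)"
      using fin finite_conjugators by (intro card_mono) auto
    also have "\<dots> \<le> (\<Sum>H\<in>\<A>. card (conjugators g H))" by (rule card_UN_le[OF fin])
    finally show ?thesis unfolding card_permutes_pts .
  qed
  have "g12 permutes pts" "g345 permutes pts" "g255 permutes pts" "g147 permutes pts" "g57 permutes pts"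
    by (rule cyc3_permutes; simp)+
  note t = this[THEN total]
  have "761 * fact 12 \<le> 462 * (\<Sum>H\<in>\<A>. card (conjugators g12 H)) + 220 * (\<Sum>H\<in>\<A>. card (conjugators g345 H))
      + 66 * (\<Sum>H\<in>\<A>. card (conjugators g255 H)) + 12 * (\<Sum>H\<in>\<A>. card (conjugators g147 H))
      + (\<Sum>H\<in>\<A>. card (conjugators g57 H))"
    using t by linarith
  also have "\<dots> = (\<Sum>H\<in>\<A>. weight H)"
    unfolding weight_def by (simp only: sum.distrib sum_distrib_left)
  also have "\<dots> \<le> (\<Sum>H\<in>\<A>. fact 12)"
    using sub weight_proper by (intro sum_mono) blast
  also have "\<dots> = card \<A> * fact 12" by simp
  finally show ?thesis by (simp only: mult_le_cancel2 fact_gt_zero simp_thms)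
qed

text \<open>Stabilizing a set of sets covers both kinds of members at once: a single set, and an
  unordered pair of halves that may be swapped.\<close>

definition stabilizer :: "nat set set \<Rightarrow> (nat \<Rightarrow> nat) set" where
  "stabilizer P = {p. p permutes pts \<and> (`) p ` P = P}"

lemma perm_group_stabilizer: "perm_group pts (stabilizer P)"
proof
  show "finite pts" by (rule finite_pts)
  show "id \<in> stabilizer P" unfolding stabilizer_def using permutes_id by simp
  show "h permutes pts" if "h \<in> stabilizer P" for h using that unfolding stabilizer_def by blast
  have comp: "(`) (g \<circ> h) ` P = (`) g ` (`) h ` P" for g h :: "nat \<Rightarrow> nat"
  proof -
    have "(`) (g \<circ> h) = (`) g \<circ> (`) h"
      by (rule ext) (simp only: image_comp[symmetric] comp_apply)
    then show ?thesis by (simp only: image_comp)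
  qed
  show "g \<circ> h \<in> stabilizer P" if "g \<in> stabilizer P" "h \<in> stabilizer P" for g h
    using that permutes_compose[of h pts g] unfolding stabilizer_def mem_Collect_eq comp by simp
  show "inv' h \<in> stabilizer P" if h: "h \<in> stabilizer P" for h
  proof -
    have perm: "h permutes pts" and P: "(`) h ` P = P" using h unfolding stabilizer_def by blast+
    have "(`) (inv' h \<circ> h) ` P = P" using permutes_inv_o(2)[OF perm] by simp
    then have "(`) (inv' h) ` P = P" unfolding comp P .
    then show ?thesis unfolding stabilizer_def using permutes_inv[OF perm] by blast
  qed
qed

abbreviation set_stabilizer :: "nat set \<Rightarrow> (nat \<Rightarrow> nat) set" where
  "set_stabilizer A \<equiv> stabilizer {A}"

definition halves_stabilizer :: "nat set \<Rightarrow> (nat \<Rightarrow> nat) set" where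
  "halves_stabilizer A = stabilizer {A, pts - A}"

lemma transpose_image_not:
  assumes "a \<in> A" "b \<in> pts - A" "A \<subseteq> pts"
  shows "transpose a b permutes pts" "transpose a b ` A \<noteq> A"
proof -
  show "transpose a b permutes pts" using assms by (intro permutes_swap_id) auto
  have "transpose a b a \<in> transpose a b ` A" using assms(1) by (rule imageI)
  then show "transpose a b ` A \<noteq> A" using assms(2) by auto
qed

lemma set_stabilizer_proper:
  assumes "A \<subseteq> pts" "A \<noteq> {}" "A \<noteq> pts" shows "set_stabilizer A \<noteq> {p. p permutes pts}"
proof -
  obtain a b where "a \<in> A" "b \<in> pts - A" using assms by blast
  note t = transpose_image_not[OF this assms(1)]
  have "transpose a b \<notin> set_stabilizer A" unfolding stabilizer_def using t(2) by simp
  then show ?thesis using t(1) by blast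
qed

lemma halves_stabilizer_proper:
  assumes A: "A \<subseteq> pts" "card A = 6" shows "halves_stabilizer A \<noteq> {p. p permutes pts}"
proof -
  have "A \<noteq> pts" using A card_pts by auto
  then obtain b where b: "b \<in> pts - A" using A(1) by blast
  obtain a where a: "a \<in> A" using A(2) by fastforce
  have "card (A - {a}) = 5" using A(2) a by simp
  then obtain a' where a': "a' \<in> A" "a' \<noteq> a" using ex_mem_if_card_pos[of 4 "A - {a}"] by auto
  \<comment> \<open>The second point \<open>a'\<close> of \<open>A\<close> stays in place, so the
    image of \<open>A\<close> still meets \<open>A\<close> and is not its complement.\<close>
  have "transpose a b a' = a'" using a' b by (auto simp: transpose_def)
  then have "a' \<in> transpose a b ` A" using a'(1) by (metis imageI)
  then have "transpose a b ` A \<noteq> pts - A" using a'(1) by blast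
  moreover note t = transpose_image_not[OF a b A(1)]
  ultimately have notin: "transpose a b ` A \<notin> {A, pts - A}" by simp
  have "transpose a b \<notin> halves_stabilizer A"
  proof
    assume "transpose a b \<in> halves_stabilizer A"
    then have "(`) (transpose a b) ` {A, pts - A} = {A, pts - A}"
      unfolding halves_stabilizer_def stabilizer_def mem_Collect_eq by (rule conjunct2)
    then have "transpose a b ` A \<in> {A, pts - A}"
      using imageI[OF insertI1, of "(`) (transpose a b)" A "{pts - A}"] by (simp only:)
    with notin show False by (rule notE)
  qed
  then show ?thesis using t(1) by blast
qed

text \<open>Requiring the point 1 in the chosen half counts every pair of halves once.\<close>

definition optimal_cover :: "(nat \<Rightarrow> nat) set set" where
  "optimal_cover = insert (carrier (alt_group 12))
     (set_stabilizer ` {A. A \<subseteq> pts \<and> card A = 1} \<union> set_stabilizer ` {A. A \<subseteq> pts \<and> card A = 2} \<union>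
      set_stabilizer ` {A. A \<subseteq> pts \<and> card A = 3} \<union>
      (halves_stabilizer \<circ> insert 1) ` {A. A \<subseteq> pts - {1} \<and> card A = 5})"

lemma finite_pts_subsets: "finite {A. A \<subseteq> pts \<and> P A}" "finite {A. A \<subseteq> pts - {1} \<and> P A}"
  by (rule finite_subset[of _ "Pow pts"]; auto simp: finite_pts)+

lemma finite_optimal_cover: "finite optimal_cover"
  unfolding optimal_cover_def using finite_pts_subsets by simp

lemma card_optimal_cover: "card optimal_cover \<le> 761"
proof -
  have s: "card (set_stabilizer ` {A. A \<subseteq> pts \<and> card A = k}) \<le> 12 choose k" for k
    using card_image_le[OF finite_pts_subsets(1), of set_stabilizer "\<lambda>A. card A = k"]
      n_subsets[OF finite_pts, of k] card_pts by simp
  have h: "card ((halves_stabilizer \<circ> insert 1) ` {A. A \<subseteq> pts - {1} \<and> card A = 5}) \<le> 11 choose 5"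
  proof -
    have "finite (pts - {1})" "card (pts - {1}) = 11" using finite_pts card_pts by (simp_all add: mem_pts)
    then show ?thesis
      using card_image_le[OF finite_pts_subsets(2), of "halves_stabilizer \<circ> insert 1" "\<lambda>A. card A = 5"]
        n_subsets[of "pts - {1}" 5] by simp
  qed
  let ?rest = "set_stabilizer ` {A. A \<subseteq> pts \<and> card A = 1} \<union> set_stabilizer ` {A. A \<subseteq> pts \<and> card A = 2} \<union>
      set_stabilizer ` {A. A \<subseteq> pts \<and> card A = 3} \<union>
      (halves_stabilizer \<circ> insert 1) ` {A. A \<subseteq> pts - {1} \<and> card A = 5}"
  have "card ?rest \<le> (12 choose 1) + (12 choose 2) + (12 choose 3) + (11 choose 5)"
    by (rule order_trans[OF card_Un_le], rule add_mono[OF _ h])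
      (rule order_trans[OF card_Un_le], rule add_mono[OF _ s], rule order_trans[OF card_Un_le], rule add_mono[OF s s])
  \<comment> \<open>12 + 66 + 220 + 462, to which the alternating group adds one.\<close>
  also have "\<dots> = 760" by (simp add: binomial_fact' fact_numeral)
  finally show ?thesis unfolding optimal_cover_def by (intro card_insert_le_m1) simp_all
qed

lemma group_cover_optimal_cover: "group_cover (sym_group 12) optimal_cover"
  unfolding group_cover_def carrier_sym_group_12 subgroup_iff_perm_group
proof (intro conjI ballI)
  show "finite optimal_cover" by (rule finite_optimal_cover)
  have "perm_group pts H \<and> H \<noteq> {p. p permutes pts}" if H: "H \<in> optimal_cover" for H
  proof -
    consider "H = carrier (alt_group 12)" | A where "A \<subseteq> pts" "card A \<in> {1, 2, 3}" "H = set_stabilizer A"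
      | A where "A \<subseteq> pts - {1}" "card A = 5" "H = halves_stabilizer (insert 1 A)"
      using H unfolding optimal_cover_def by auto
    then show ?thesis
    proof cases
      case 1
      have "perm_group pts H"
        using alt_group_is_subgroup[of 12] unfolding 1 subgroup_iff_perm_group .
      moreover have "transpose 1 2 permutes pts" by (intro permutes_swap_id) (simp_all add: mem_pts)
      moreover have "transpose 1 2 \<notin> H"
        unfolding 1 alt_group_carrier evenperm_swap by simp
      ultimately show ?thesis by blast
    next
      case (2 A)
      then have "A \<noteq> {}" "A \<noteq> pts" using card_pts by auto
      then show ?thesis using set_stabilizer_proper[OF 2(1)] perm_group_stabilizer 2(3) by blast
    next
      case (3 A)
      have "insert 1 A \<subseteq> pts" using 3(1) by (auto simp: mem_pts)
      moreover have "finite A" using 3(1) finite_pts finite_subset[of A pts] by auto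
      then have "card (insert 1 A) = 6" using 3(1,2) by (subst card_insert_disjoint) auto
      ultimately show ?thesis using halves_stabilizer_proper perm_group_stabilizer 3(3) unfolding halves_stabilizer_def by blast
    qed
  qed
  then show "perm_group pts H" "H \<noteq> {p. p permutes pts}" if "H \<in> optimal_cover" for H
    using that by blast+
  then have "\<Union>optimal_cover \<subseteq> {p. p permutes pts}"
    using perm_group.permutes by blast
  moreover have "{p. p permutes pts} \<subseteq> \<Union>optimal_cover"
  proof
    fix p assume "p \<in> {p. p permutes pts}"
    then have p: "p permutes pts" by simp
    show "p \<in> \<Union>optimal_cover"
    proof (cases "evenperm p")
      case True
      then have "p \<in> carrier (alt_group 12)" unfolding alt_group_carrier using p unfolding pts_def by blast
      then show ?thesis unfolding optimal_cover_def by blast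
    next
      case False
      from odd_permutation_cases[OF p this] show ?thesis
      proof
        assume "\<exists>A\<subseteq>pts. card A \<in> {1, 2, 3} \<and> p ` A = A"
        then obtain A where A: "A \<subseteq> pts" "card A \<in> {1, 2, 3}" "p ` A = A" by blast
        have "p \<in> set_stabilizer A" unfolding stabilizer_def using p A(3) by simp
        moreover have "set_stabilizer A \<in> optimal_cover" unfolding optimal_cover_def using A(1,2) by auto
        ultimately show ?thesis by blast
      next
        assume "\<exists>A\<subseteq>pts. card A = 6 \<and> p ` A = pts - A"
        then obtain A where A: "A \<subseteq> pts" "card A = 6" "p ` A = pts - A" by blast
        define B where "B = (if 1 \<in> A then A else pts - A)"
        have "card (pts - A) = 6"
          using card_Diff_subset[OF finite_subset[OF A(1) finite_pts] A(1)] A(2) card_pts by simp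
        moreover have AA: "pts - (pts - A) = A" using A(1) by blast
        moreover have "p ` (pts - A) = A"
          using image_set_diff[OF permutes_inj[OF p], of pts A] permutes_image[OF p] A(3) AA by simp
        moreover have "1 \<in> pts" by (simp add: mem_pts)
        ultimately have B: "B \<subseteq> pts" "card B = 6" "p ` B = pts - B" "1 \<in> B" "p ` (pts - B) = B"
          unfolding B_def using A by (cases "1 \<in> A"; simp)+
        have "(`) p ` {B, pts - B} = {B, pts - B}"
          by (simp only: image_insert image_empty B(3,5) insert_commute)
        then have "p \<in> halves_stabilizer B"
          unfolding halves_stabilizer_def stabilizer_def using p by blast
        moreover have "B - {1} \<in> {A. A \<subseteq> pts - {1} \<and> card A = 5}" using B by auto
        then have "(halves_stabilizer \<circ> insert 1) (B - {1}) \<in> optimal_cover"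
          unfolding optimal_cover_def by blast
        then have "halves_stabilizer B \<in> optimal_cover" using B(4) by (simp add: insert_absorb)
        ultimately show ?thesis by blast
      qed
    qed
  qed
  ultimately show "{p. p permutes pts} = \<Union>optimal_cover" by blast
qed

theorem theorem5p1:
  shows "covering_number (sym_group 12) = 761"
proof (rule antisym)
  have "covering_number (sym_group 12) \<le> enat (card optimal_cover)"
    unfolding covering_number_def by (rule INF_lower) (simp add: group_cover_optimal_cover)
  also have "\<dots> \<le> enat 761" using card_optimal_cover by (simp only: enat_ord_simps)
  finally show "covering_number (sym_group 12) \<le> 761" by (simp add: numeral_eq_enat)
  have "enat 761 \<le> covering_number (sym_group 12)"
    unfolding covering_number_def
    by (rule INF_greatest) (use card_cover_ge in \<open>simp only: enat_ord_simps mem_Collect_eq\<close>)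
  then show "761 \<le> covering_number (sym_group 12)" by (simp add: numeral_eq_enat)
qed

end
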